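(* Let $\kappa>0$ and $\gamma\in(0,2]$, and let $\theta_0,S\in C^\infty(\Omega)$ be an initial datum and a forcing term with $\int_\Omega\theta_0\,dx=\int_\Omega S\,dx=0$. Assume that the operators $T_{ij}$ satisfy (A1), (A2), (A3') and (A4). If $\theta^{(\lambda)}$ and $\theta^{(0)}$ are smooth solutions of $$\partial_t\theta+u\cdot\nabla\theta+\lambda\mathcal{D}\theta+\kappa\Lambda^{\gamma}\theta=S,\qquad u=u[\theta],\qquad \theta(x,0)=\theta_0(x)$$ for $\lambda>0$ and for $\lambda=0$ respectively, then $$\lim_{\lambda\to0}\|(\theta^{(\lambda)}-\theta^{(0)})(\cdot,t)\|_{H^s}=0$$ for all $s\ge0$ and all $t\ge0$.
   Context: Let $d\in\{2,3\}$ and $\Omega=\mathbb{T}^d=[-\pi,\pi]^d$ with periodic boundary conditions. $\Lambda=\sqrt{-\Delta}$ is the Fourier multiplier with symbol $|k|$, and $\mathcal{D}=\Lambda+\mathbf{1}$, where $\mathbf 1$ is the identity. The equation is posed on $\Omega\times(0,\infty)$, the forcing $S=S(x)$ is time-independent, and solutions have zero spatial mean. $H^s$ is the closure of mean-zero $C^\infty(\mathbb{T}^d)$ functions under $\|f\|_{H^s}=\|\Lambda^s f\|_{L^2}$. The velocity is $u=u[\theta]$ with components $u_j[\theta]=\sum_i\partial_{x_i}T_{ij}[\theta]$, where the $T_{ij}$, $1\le i,j\le d$, are Fourier multiplier operators satisfying: (A1) $\sum_{i,j}\partial_{x_i}\partial_{x_j}T_{ij}f=0$ for all smooth $f$; (A2)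 $T_{ij}:L^\infty(\Omega)\to BMO(\Omega)$ is linear and bounded for all $i,j$; (A3') there is a constant $C>0$ such that $|\widehat{T_{ij}}(k)|\le C|k|^{-3}$ for all $i,j$ and all $k\neq 0$; (A4) $\widehat{T_{ij}}(0)=0$ for all $i,j$. *)

theory Defs
  imports "HOL-Analysis.Analysis" "HOL-Probability.Essential_Supremum"
begin

text \<open>
  Functions on the torus are $2\pi$-periodic functions on \<open>real ^ 'n\<close>, with fundamental domain
  \<open>torus\<close>; frequencies are vectors in \<open>int ^ 'n\<close>.
\<close>

definition torus :: "(real ^ 'n) set" where
  "torus = cbox (\<chi> i. - pi) (\<chi> i. pi)"

definition periodic :: "(real ^ 'n \<Rightarrow> 'b) \<Rightarrow> bool" where
  "periodic f \<longleftrightarrow> (\<forall>x i. f (x + axis i (2 * pi)) = f x)"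

text \<open>
  Derivatives are taken within \<open>X\<close>, so for the closed half-space \<open>{0..} \<times> UNIV\<close> this is
  smoothness up to the boundary (where the derivative within \<open>X\<close> is unique).
\<close>

primrec Ck_on :: "nat \<Rightarrow> 'a::euclidean_space set \<Rightarrow> ('a \<Rightarrow> real) \<Rightarrow> bool" where
  "Ck_on 0 X f \<longleftrightarrow> continuous_on X f"
| "Ck_on (Suc k) X f \<longleftrightarrow>
     (\<exists>f'. (\<forall>x\<in>X. (f has_derivative f' x) (at x within X)) \<and> (\<forall>v. Ck_on k X (\<lambda>x. f' x v)))"

definition smooth_on :: "'a::euclidean_space set \<Rightarrow> ('a \<Rightarrow> real) \<Rightarrow> bool" where
  "smooth_on X f \<longleftrightarrow> (\<forall>k. Ck_on k X f)"

definition smooth_torus :: "(real ^ 'n \<Rightarrow> real) \<Rightarrow> bool" where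
  "smooth_torus f \<longleftrightarrow> periodic f \<and> smooth_on UNIV f"

definition torus_integral :: "(real ^ 'n \<Rightarrow> 'b::{banach,second_countable_topology}) \<Rightarrow> 'b" where
  "torus_integral f = integral\<^sup>L (lebesgue_on torus) f"

definition partial :: "'n \<Rightarrow> (real ^ 'n \<Rightarrow> real) \<Rightarrow> real ^ 'n \<Rightarrow> real" where
  "partial i f x = deriv (\<lambda>h. f (x + axis i h)) 0"

definition grad :: "(real ^ 'n \<Rightarrow> real) \<Rightarrow> real ^ 'n \<Rightarrow> real ^ 'n" where
  "grad f x = (\<chi> j. partial j f x)"


definition freq :: "int ^ 'n \<Rightarrow> real ^ 'n" where
  "freq k = (\<chi> i. real_of_int (k $ i))"

definition fourier_coeff :: "(real ^ 'n \<Rightarrow> real) \<Rightarrow> int ^ 'n \<Rightarrow> complex" where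
  "fourier_coeff f k =
     torus_integral (\<lambda>x. complex_of_real (f x) * cis (- (freq k \<bullet> x))) / (2 * pi) ^ CARD('n)"

text \<open>
  A multiplier maps real functions to real functions iff its symbol is Hermitian; then the
  series below is real and \<open>Re\<close> is only a coercion.
\<close>

definition hermitian_symbol :: "(int ^ 'n \<Rightarrow> complex) \<Rightarrow> bool" where
  "hermitian_symbol m \<longleftrightarrow> (\<forall>k. m (- k) = cnj (m k))"

text \<open>
  The series converges absolutely if \<open>f\<close> is smooth and \<open>m\<close> grows at most polynomially, and also
  if \<open>f\<close> is merely in $L^\infty$ and $|m(k)| \le C|k|^{-3}$ in dimension at most 3 (by
  Cauchy--Schwarz and Bessel). These are the only cases in which it is used.
\<close>

definition fourier_multiplier ::
  "(int ^ 'n \<Rightarrow> complex) \<Rightarrow> (real ^ 'n \<Rightarrow> real) \<Rightarrow> real ^ 'n \<Rightarrow> real" where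
  "fourier_multiplier m f x = Re (\<Sum>\<^sub>\<infinity>k. m k * fourier_coeff f k * cis (freq k \<bullet> x))"

text \<open>
  The case split makes \<open>Lam_pow 0\<close> the identity, since \<open>0 powr 0 = 0\<close>.
\<close>

definition Lam_pow :: "real \<Rightarrow> (real ^ 'n \<Rightarrow> real) \<Rightarrow> real ^ 'n \<Rightarrow> real" where
  "Lam_pow s =
     fourier_multiplier (\<lambda>k. complex_of_real (if s = 0 then 1 else norm (freq k) powr s))"

definition D_op :: "(real ^ 'n \<Rightarrow> real) \<Rightarrow> real ^ 'n \<Rightarrow> real" where
  "D_op f x = Lam_pow 1 f x + f x"

definition L2_norm :: "(real ^ 'n \<Rightarrow> real) \<Rightarrow> real" where
  "L2_norm f = sqrt (torus_integral (\<lambda>x. (f x)\<^sup>2))"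

definition Hs_norm :: "real \<Rightarrow> (real ^ 'n \<Rightarrow> real) \<Rightarrow> real" where
  "Hs_norm s f = L2_norm (Lam_pow s f)"


definition Linf_norm :: "(real ^ 'n \<Rightarrow> real) \<Rightarrow> ereal" where
  "Linf_norm f = esssup (lebesgue_on torus) (\<lambda>x. ereal \<bar>f x\<bar>)"

definition Linf :: "(real ^ 'n \<Rightarrow> real) set" where
  "Linf = {f. periodic f \<and> f \<in> borel_measurable (lebesgue_on torus) \<and> Linf_norm f < \<infinity>}"

definition cube :: "real ^ 'n \<Rightarrow> real \<Rightarrow> (real ^ 'n) set" where
  "cube a l = cbox a (\<chi> i. a $ i + l)"

definition cube_mean :: "real ^ 'n \<Rightarrow> real \<Rightarrow> (real ^ 'n \<Rightarrow> real) \<Rightarrow> real" where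
  "cube_mean a l f = integral\<^sup>L (lebesgue_on (cube a l)) f / l ^ CARD('n)"

definition mean_osc :: "(real ^ 'n \<Rightarrow> real) \<Rightarrow> real ^ 'n \<Rightarrow> real \<Rightarrow> real" where
  "mean_osc f a l = cube_mean a l (\<lambda>x. \<bar>f x - cube_mean a l f\<bar>)"

text \<open>
  Cubes on the torus are the projections of cubes of side at most $2\pi$.
\<close>

definition BMO_seminorm :: "(real ^ 'n \<Rightarrow> real) \<Rightarrow> ereal" where
  "BMO_seminorm f = (SUP a. SUP l\<in>{0<..2 * pi}. ereal (mean_osc f a l))"

definition BMO :: "(real ^ 'n \<Rightarrow> real) set" where
  "BMO = {f. periodic f \<and> integrable (lebesgue_on torus) f \<and> BMO_seminorm f < \<infinity>}"


text \<open>
  The operators $T_{ij}$ are given by their symbols \<open>T i j = \<close> $\widehat{T_{ij}}$.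
\<close>

definition condA1 :: "('n \<Rightarrow> 'n \<Rightarrow> int ^ 'n \<Rightarrow> complex) \<Rightarrow> bool" where
  "condA1 T \<longleftrightarrow> (\<forall>f. smooth_torus f \<longrightarrow>
     (\<forall>x. (\<Sum>i\<in>UNIV. \<Sum>j\<in>UNIV. partial i (partial j (fourier_multiplier (T i j) f)) x) = 0))"

definition linear_bounded_Linf_BMO ::
  "((real ^ 'n \<Rightarrow> real) \<Rightarrow> real ^ 'n \<Rightarrow> real) \<Rightarrow> bool" where
  "linear_bounded_Linf_BMO A \<longleftrightarrow>
     (\<forall>f\<in>Linf. A f \<in> BMO) \<and>
     (\<forall>f\<in>Linf. \<forall>g\<in>Linf. \<forall>a b.
        AE x in lebesgue_on torus. A (\<lambda>y. a * f y + b * g y) x = a * A f x + b * A g x) \<and>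
     (\<exists>C::real. \<forall>f\<in>Linf. BMO_seminorm (A f) \<le> ereal C * Linf_norm f)"

definition condA2 :: "('n \<Rightarrow> 'n \<Rightarrow> int ^ 'n \<Rightarrow> complex) \<Rightarrow> bool" where
  "condA2 T \<longleftrightarrow> (\<forall>i j. linear_bounded_Linf_BMO (fourier_multiplier (T i j)))"

definition condA3' :: "('n \<Rightarrow> 'n \<Rightarrow> int ^ 'n \<Rightarrow> complex) \<Rightarrow> bool" where
  "condA3' T \<longleftrightarrow>
     (\<exists>C>0. \<forall>i j k. k \<noteq> 0 \<longrightarrow> cmod (T i j k) \<le> C * norm (freq k) powr (- 3))"

definition condA4 :: "('n \<Rightarrow> 'n \<Rightarrow> int ^ 'n \<Rightarrow> complex) \<Rightarrow> bool" where
  "condA4 T \<longleftrightarrow> (\<forall>i j. T i j 0 = 0)"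

definition velocity ::
  "('n \<Rightarrow> 'n \<Rightarrow> int ^ 'n \<Rightarrow> complex) \<Rightarrow> (real ^ 'n \<Rightarrow> real) \<Rightarrow> real ^ 'n \<Rightarrow> real ^ 'n" where
  "velocity T f x = (\<chi> j. \<Sum>i\<in>UNIV. partial i (fourier_multiplier (T i j) f) x)"

definition smooth_solution ::
  "('n \<Rightarrow> 'n \<Rightarrow> int ^ 'n \<Rightarrow> complex) \<Rightarrow> real \<Rightarrow> real \<Rightarrow> (real ^ 'n \<Rightarrow> real) \<Rightarrow> (real ^ 'n \<Rightarrow> real)
     \<Rightarrow> real \<Rightarrow> (real \<Rightarrow> real ^ 'n \<Rightarrow> real) \<Rightarrow> bool" where
  "smooth_solution T \<kappa> \<gamma> S \<theta>\<^sub>0 lam \<theta> \<longleftrightarrow>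
     smooth_on ({0..} \<times> UNIV) (\<lambda>(t, x). \<theta> t x) \<and>
     (\<forall>t\<ge>0. periodic (\<theta> t) \<and> torus_integral (\<theta> t) = 0) \<and>
     (\<forall>t>0. \<forall>x. deriv (\<lambda>\<tau>. \<theta> \<tau> x) t + velocity T (\<theta> t) x \<bullet> grad (\<theta> t) x
                 + lam * D_op (\<theta> t) x + \<kappa> * Lam_pow \<gamma> (\<theta> t) x = S x) \<and>
     (\<forall>x. \<theta> 0 x = \<theta>\<^sub>0 x)"

end

theory Submission
  imports Defs
begin

text \<open>
  Let \<open>b\<close> be the Fourier coefficients of $\theta^{(0)}$ and \<open>c\<close> those of the difference
  $\theta^{(\lambda)}-\theta^{(0)}$. No a priori bound on $\theta^{(\lambda)}$ is needed: the nonlinearity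
  splits as $N(b,c)+N(c,b)+N(c,c)$, and the energy $E=\sum_k|k|^{2m}|c_k|^2$ is estimated directly.
  Since the velocity is real and divergence free, the part of $N(\cdot,c)$ without commutator is
  antisymmetric and drops out; in the rest one derivative falls on the velocity, whose symbol is
  bounded. This gives $E'\le C(1+E)E+C\lambda$ with $E(0)=0$ and $C$ depending only on $\theta^{(0)}$,
  and a continuity argument yields $E=O(\lambda)$ on bounded time intervals for all \<open>m\<close>.
  All convolution sums are bounded by
  $\sum_{k,l}\alpha_{k-l}\beta_l\gamma_k\le\frac12\|\alpha\|_1(\|\beta\|_2^2+\|\gamma\|_2^2)$,
  with the weights distributed so that the right-hand side is at least quadratic in \<open>c\<close>.
\<close>

section \<open>Rapidly decreasing sequences of Fourier coefficients\<close>

text \<open>The obstacle is the loss of one derivative: u . grad c carries one more power of the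
  frequency than \<open>E\<close> controls. Dissipation cannot pay for it, since \<gamma> may be
  arbitrarily small and the damping \<lambda> D disappears in the limit; both enter only through
  their sign. The damping acts on b + c: its c part has a good sign, its b part is the forcing of
  size \<lambda>. The commutator obeys ||k|^m - |l|^m| |l| <= C (|k-l| |l|^m + |k-l|^m |l|). In
  N(b,c) all surplus weight may go to b. In N(c,c) the two terms are treated separately, so that the
  l1 factor is only the sum of |k| |c_k|, with a single weight; for m >= 1 + d this is at most (K +
  E) / 2, which is the source of the factor 1 + E. N(c,b) has no cancellation, but there the
  gradient falls on b. The factor 1 + E is harmless only while \<open>E\<close> is bounded, so the
  inequality is used as long as E <= 1, and for small \<lambda> Gronwall keeps \<open>E\<close>
  below 1. The H^s norm is reached through the supremum of an absolutely convergent series, that is,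
  the sum of |k|^p |c_k| with p the ceiling of s. Young's inequality with parameter sqrt \<lambda>
  bounds this sum by \<open>E\<close> and gives the rate sqrt \<lambda>.\<close>

abbreviation wt :: "int ^ 'n \<Rightarrow> real" where
  "wt k \<equiv> norm (freq k)"

lemma freq_nth [simp]: "freq k $ i = real_of_int (k $ i)"
  by (simp add: freq_def)

lemma freq_diff: "freq (k - l) = freq k - freq l"
  and freq_minus: "freq (- k) = - freq k"
  and freq_0: "freq 0 = 0"
  by (simp_all add: vec_eq_iff)

lemma wt_minus [simp]: "wt (- k) = wt k"
  by (simp add: freq_minus)

lemma wt_0 [simp]: "wt 0 = 0"
  by (simp add: freq_0)

lemma wt_ge_1:
  assumes "k \<noteq> 0"
  shows "1 \<le> wt k"
proof -
  from assms obtain i where "k $ i \<noteq> 0" by (auto simp: vec_eq_iff)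
  then have "1 \<le> \<bar>real_of_int (k $ i)\<bar>" by linarith
  also have "\<dots> \<le> wt k" using component_le_norm_cart[of "freq k" i] by simp
  finally show ?thesis .
qed

lemma wt_diff_le: "\<bar>wt k - wt l\<bar> \<le> wt (k - l)"
  by (simp add: freq_diff norm_triangle_ineq3)

lemma summable_inverse_quadratic_int: "(\<lambda>k::int. 1 / (1 + (real_of_int k)\<^sup>2)) summable_on UNIV"
proof -
  have s: "summable (\<lambda>n::nat. 1 / (1 + (real n)\<^sup>2))"
  proof (rule summable_comparison_test')
    show "summable (\<lambda>n::nat. inverse ((real n)\<^sup>2))"
      using inverse_power_summable[of 2, where 'a=real] by simp
    show "norm (1 / (1 + (real n)\<^sup>2)) \<le> inverse ((real n)\<^sup>2)" if "n \<ge> 1" for n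
      using that le_imp_inverse_le[of "(real n)\<^sup>2" "1 + (real n)\<^sup>2"] by (simp add: inverse_eq_divide)
  qed
  then have n: "(\<lambda>n::nat. 1 / (1 + (real n)\<^sup>2)) summable_on UNIV"
    by (subst summable_on_UNIV_nonneg_real_iff) auto
  have 1: "(\<lambda>k::int. 1 / (1 + (real_of_int k)\<^sup>2)) summable_on range int"
    by (subst summable_on_reindex) (use n in \<open>auto simp: o_def\<close>)
  have 2: "(\<lambda>k::int. 1 / (1 + (real_of_int k)\<^sup>2)) summable_on range (\<lambda>n. - int n)"
    by (subst summable_on_reindex) (use n in \<open>auto simp: o_def inj_on_def\<close>)
  have "UNIV = range int \<union> range (\<lambda>n. - int n)"
    by (auto intro: int_cases2)
  with summable_on_union[OF 1 2] show ?thesis by simp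
qed

lemma prod_le_jap:
  fixes k :: "int ^ 'n"
  shows "(\<Prod>i\<in>UNIV. 1 + (real_of_int (k $ i))\<^sup>2) \<le> (1 + wt k) ^ (2 * CARD('n))"
proof -
  have "(\<Prod>i\<in>UNIV. 1 + (real_of_int (k $ i))\<^sup>2) \<le> (\<Prod>i\<in>(UNIV::'n set). (1 + wt k)\<^sup>2)"
  proof (intro prod_mono conjI)
    fix i :: 'n
    have "(real_of_int (k $ i))\<^sup>2 \<le> (wt k)\<^sup>2"
      using power_mono[OF component_le_norm_cart[of "freq k" i], of 2] by simp
    moreover have "0 \<le> 2 * wt k" by simp
    ultimately show "1 + (real_of_int (k $ i))\<^sup>2 \<le> (1 + wt k)\<^sup>2"
      unfolding power2_sum one_power2 mult_1_right by linarith
  qed simp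
  also have "\<dots> = (1 + wt k) ^ (2 * CARD('n))" by (simp add: power_mult)
  finally show ?thesis .
qed

text \<open>A finite set of lattice points lies in the product of its coordinate projections, and
  there the sum of products is a product of one-dimensional sums, each at most the full sum.\<close>

lemma summable_on_vec_prod:
  fixes f :: "int \<Rightarrow> real"
  assumes f: "f summable_on UNIV" and nn: "\<And>k. 0 \<le> f k"
  shows "(\<lambda>k::int ^ 'n. \<Prod>i\<in>UNIV. f (k $ i)) summable_on UNIV"
proof (rule nonneg_bdd_above_summable_on)
  show "bdd_above (sum (\<lambda>k::int ^ 'n. \<Prod>i\<in>UNIV. f (k $ i)) ` {F. F \<subseteq> UNIV \<and> finite F})"
  proof (rule bdd_aboveI2)
    fix F :: "(int ^ 'n) set" assume "F \<in> {F. F \<subseteq> UNIV \<and> finite F}"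
    then have F: "finite F" by simp
    let ?B = "\<lambda>i. (\<lambda>k. k $ i) ` F"
    have "(\<Sum>k\<in>F. \<Prod>i\<in>UNIV. f (k $ i)) = (\<Sum>g\<in>vec_nth ` F. \<Prod>i\<in>UNIV. f (g i))"
      by (subst sum.reindex) (auto simp: inj_on_def vec_nth_inject)
    also have "\<dots> \<le> (\<Sum>g\<in>PiE UNIV ?B. \<Prod>i\<in>UNIV. f (g i))"
      by (rule sum_mono2) (use F nn in \<open>auto intro!: finite_PiE prod_nonneg\<close>)
    also have "\<dots> = (\<Prod>i\<in>UNIV. \<Sum>y\<in>?B i. f y)"
      by (rule prod_sum_PiE[symmetric]) (use F in auto)
    also have "\<dots> \<le> (\<Prod>i\<in>(UNIV::'n set). infsum f UNIV)"
      by (rule prod_mono) (use F f nn in \<open>auto intro!: finite_sum_le_infsum sum_nonneg\<close>)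
    finally show "(\<Sum>k\<in>F. \<Prod>i\<in>UNIV. f (k $ i)) \<le> (\<Prod>i\<in>(UNIV::'n set). infsum f UNIV)" .
  qed
qed (use nn in \<open>auto intro: prod_nonneg\<close>)

text \<open>The exponent \<open>2 * CARD('n)\<close> is what the comparison with the product of the
  weights 1 + k_i^2 costs: each factor is at most (1 + |k|)^2. This reduces lattice sums to sums
  over the integers.\<close>

lemma summable_jap:
  assumes "2 * CARD('n) \<le> M"
  shows "(\<lambda>k::int ^ 'n. inverse ((1 + wt k) ^ M)) summable_on UNIV"
proof (rule summable_on_comparison_test[OF summable_on_vec_prod[OF summable_inverse_quadratic_int]])
  fix k :: "int ^ 'n"
  have "(\<Prod>i\<in>UNIV. 1 + (real_of_int (k $ i))\<^sup>2) \<le> (1 + wt k) ^ M"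
    by (rule order_trans[OF prod_le_jap]) (use assms in \<open>auto intro: power_increasing\<close>)
  moreover have "0 < (\<Prod>i\<in>UNIV. 1 + (real_of_int (k $ i))\<^sup>2)"
    by (intro prod_pos) (auto simp: add_pos_nonneg)
  ultimately have "inverse ((1 + wt k) ^ M) \<le> inverse (\<Prod>i\<in>UNIV. 1 + (real_of_int (k $ i))\<^sup>2)"
    by (rule le_imp_inverse_le)
  then show "inverse ((1 + wt k) ^ M) \<le> (\<Prod>i\<in>UNIV. 1 / (1 + (real_of_int (k $ i))\<^sup>2))"
    by (simp add: prod_dividef inverse_eq_divide)
qed auto

text \<open>The index set \<open>I\<close> will be a compact time interval; uniformity over it is
  what permits differentiating sums over frequencies in time.\<close>

definition rapid_on :: "'i set \<Rightarrow> ('i \<Rightarrow> int ^ 'n \<Rightarrow> 'b::real_normed_vector) \<Rightarrow> bool" where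
  "rapid_on I c \<longleftrightarrow> (\<forall>M. \<exists>C. \<forall>t\<in>I. \<forall>k. (1 + wt k) ^ M * norm (c t k) \<le> C)"

definition rapid :: "(int ^ 'n \<Rightarrow> 'b::real_normed_vector) \<Rightarrow> bool" where
  "rapid c \<longleftrightarrow> rapid_on UNIV (\<lambda>_::unit. c)"

lemma rapid_alt: "rapid c \<longleftrightarrow> (\<forall>M. \<exists>C. \<forall>k. (1 + wt k) ^ M * norm (c k) \<le> C)"
  by (simp add: rapid_def rapid_on_def)

lemma rapid_onD:
  assumes "rapid_on I c" "t \<in> I"
  shows "rapid (c t)"
  unfolding rapid_alt
proof
  fix M
  from assms(1)[unfolded rapid_on_def, rule_format, of M] assms(2)
  show "\<exists>C. \<forall>k. (1 + wt k) ^ M * norm (c t k) \<le> C" by fast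
qed

lemma rapid_on_bound:
  assumes c: "rapid_on I c" and d: "\<And>t k. t \<in> I \<Longrightarrow> norm (d t k) \<le> K * (1 + wt k) ^ r * norm (c t k)"
  shows "rapid_on I d"
  unfolding rapid_on_def
proof
  fix M
  from c obtain C where C: "\<And>t k. t \<in> I \<Longrightarrow> (1 + wt k) ^ (M + r) * norm (c t k) \<le> C"
    unfolding rapid_on_def by blast
  show "\<exists>C. \<forall>t\<in>I. \<forall>k. (1 + wt k) ^ M * norm (d t k) \<le> C"
  proof (intro exI ballI allI)
    fix t k assume t: "t \<in> I"
    have "(1 + wt k) ^ M * norm (d t k) \<le> (1 + wt k) ^ M * (\<bar>K\<bar> * (1 + wt k) ^ r * norm (c t k))"
      by (intro mult_left_mono order_trans[OF d[OF t]] mult_right_mono) auto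
    also have "\<dots> = \<bar>K\<bar> * ((1 + wt k) ^ (M + r) * norm (c t k))" by (simp add: power_add)
    also have "\<dots> \<le> \<bar>K\<bar> * C" by (intro mult_left_mono C t) auto
    finally show "(1 + wt k) ^ M * norm (d t k) \<le> \<bar>K\<bar> * C" .
  qed
qed

lemma rapid_bound:
  assumes "rapid c" "\<And>k. norm (d k) \<le> K * (1 + wt k) ^ r * norm (c k)"
  shows "rapid d"
  using rapid_on_bound[of UNIV "\<lambda>_::unit. c" "\<lambda>_. d" K r] assms by (auto simp: rapid_def)

lemma rapid_on_diff:
  assumes a: "rapid_on I a" and b: "rapid_on I b"
  shows "rapid_on I (\<lambda>t k. a t k - b t k)"
  unfolding rapid_on_def
proof
  fix M
  from a obtain A where A: "\<And>t k. t \<in> I \<Longrightarrow> (1 + wt k) ^ M * norm (a t k) \<le> A"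
    unfolding rapid_on_def by blast
  from b obtain B where B: "\<And>t k. t \<in> I \<Longrightarrow> (1 + wt k) ^ M * norm (b t k) \<le> B"
    unfolding rapid_on_def by blast
  show "\<exists>C. \<forall>t\<in>I. \<forall>k. (1 + wt k) ^ M * norm (a t k - b t k) \<le> C"
  proof (intro exI ballI allI)
    fix t k assume t: "t \<in> I"
    have "(1 + wt k) ^ M * norm (a t k - b t k) \<le> (1 + wt k) ^ M * (norm (a t k) + norm (b t k))"
      by (intro mult_left_mono norm_triangle_ineq4) auto
    also have "\<dots> \<le> A + B" using A[OF t] B[OF t] by (simp add: distrib_left add_mono)
    finally show "(1 + wt k) ^ M * norm (a t k - b t k) \<le> A + B" .
  qed
qed

text \<open>Spending \<open>2 * CARD('n)\<close> extra weights buys a summable bound that does not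
  depend on \<open>t\<close>, as required by the Weierstrass test.\<close>

lemma rapid_majorant:
  fixes c :: "'i \<Rightarrow> int ^ 'n \<Rightarrow> 'b::real_normed_vector"
  assumes "rapid_on I c"
  obtains g :: "int ^ 'n \<Rightarrow> real"
  where "g summable_on UNIV" "\<And>k. 0 \<le> g k"
    "\<And>t k. t \<in> I \<Longrightarrow> (1 + wt k) ^ r * norm (c t k) \<le> g k"
proof -
  let ?M = "2 * CARD('n)"
  from assms obtain C where C: "\<And>t k. t \<in> I \<Longrightarrow> (1 + wt k) ^ (r + ?M) * norm (c t k) \<le> C"
    unfolding rapid_on_def by blast
  show thesis
  proof (rule that[of "\<lambda>k. \<bar>C\<bar> * inverse ((1 + wt k) ^ ?M)"])
    show "(\<lambda>k. \<bar>C\<bar> * inverse ((1 + wt k) ^ ?M)) summable_on (UNIV :: (int^'n) set)"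
      by (intro summable_on_cmult_right summable_jap) simp
    show "(1 + wt k) ^ r * norm (c t k) \<le> \<bar>C\<bar> * inverse ((1 + wt k) ^ ?M)" if "t \<in> I" for t k
    proof -
      have "(1 + wt k) ^ r * norm (c t k) * (1 + wt k) ^ ?M \<le> \<bar>C\<bar>"
        using C[OF that, of k] by (simp add: power_add mult_ac)
      moreover have "0 < (1 + wt k) ^ ?M" by (simp add: add_pos_nonneg)
      ultimately show ?thesis by (simp only: pos_le_divide_eq[symmetric] divide_inverse)
    qed
  qed simp
qed

lemma rapid_summable:
  assumes "rapid c"
  shows "(\<lambda>k. (1 + wt k) ^ r * norm (c k)) summable_on UNIV"
proof -
  obtain g where g: "g summable_on UNIV" "\<And>k. (1 + wt k) ^ r * norm (c k) \<le> g k"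
    by (rule rapid_majorant[OF assms[unfolded rapid_def], of r]) simp
  show ?thesis
    by (rule summable_on_comparison_test[OF g(1)]) (use g(2) in auto)
qed

lemma rapid_abs_summable: "rapid c \<Longrightarrow> (\<lambda>k. norm (c k)) summable_on UNIV"
  using rapid_summable[of c 0] by simp

lemma rapid_summable_on: "rapid (c :: int ^ 'n \<Rightarrow> 'b::banach) \<Longrightarrow> c summable_on UNIV"
  by (rule abs_summable_summable[OF rapid_abs_summable])

section \<open>Termwise operations on infinite series\<close>

lemma infsum_finite_sum:
  fixes f :: "'i \<Rightarrow> 'k \<Rightarrow> 'b::real_normed_vector"
  assumes "finite I" "\<And>i. i \<in> I \<Longrightarrow> f i summable_on A"
  shows "(\<Sum>\<^sub>\<infinity>x\<in>A. \<Sum>i\<in>I. f i x) = (\<Sum>i\<in>I. \<Sum>\<^sub>\<infinity>x\<in>A. f i x)"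
proof -
  have "((\<lambda>x. \<Sum>i\<in>I. f i x) has_sum (\<Sum>i\<in>I. \<Sum>\<^sub>\<infinity>x\<in>A. f i x)) A"
    using assms
  proof (induction I rule: finite_induct)
    case (insert j I)
    have "((\<lambda>x. f j x + (\<Sum>i\<in>I. f i x)) has_sum
        (infsum (f j) A + (\<Sum>i\<in>I. \<Sum>\<^sub>\<infinity>x\<in>A. f i x))) A"
      by (rule has_sum_add) (use insert in auto)
    with insert show ?case by simp
  qed simp
  then show ?thesis by (rule infsumI)
qed

lemma has_vector_derivative_iff_quotient:
  fixes f :: "real \<Rightarrow> 'b::real_normed_vector"
  shows "(f has_vector_derivative D) (at x within S) \<longleftrightarrow>
    ((\<lambda>y. (f y - f x) /\<^sub>R (y - x)) \<longlongrightarrow> D) (at x within S)"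
proof -
  have "(f has_vector_derivative D) (at x within S) \<longleftrightarrow>
      ((\<lambda>y. norm ((f y - f x) - (y - x) *\<^sub>R D) / norm (y - x)) \<longlongrightarrow> 0) (at x within S)"
    by (simp add: has_vector_derivative_def has_derivative_iff_norm bounded_linear_scaleR_left)
  also have "\<dots> \<longleftrightarrow> ((\<lambda>y. norm ((f y - f x) /\<^sub>R (y - x) - D)) \<longlongrightarrow> 0) (at x within S)"
  proof (rule Lim_cong_within[OF refl refl refl])
    fix y :: real assume "y \<noteq> x"
    then have "(f y - f x) /\<^sub>R (y - x) - D = ((f y - f x) - (y - x) *\<^sub>R D) /\<^sub>R (y - x)"
      by (simp add: scaleR_diff_right)
    then show "norm ((f y - f x) - (y - x) *\<^sub>R D) / norm (y - x) = norm ((f y - f x) /\<^sub>R (y - x) - D)"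
      by (simp add: divide_inverse mult.commute)
  qed
  also have "\<dots> \<longleftrightarrow> ((\<lambda>y. (f y - f x) /\<^sub>R (y - x)) \<longlongrightarrow> D) (at x within S)"
    by (simp add: tendsto_norm_zero_iff LIM_zero_iff)
  finally show ?thesis .
qed

lemma has_sum_diff:
  fixes f g :: "'k \<Rightarrow> 'b::real_normed_vector"
  assumes "(f has_sum a) A" "(g has_sum b) A"
  shows "((\<lambda>x. f x - g x) has_sum (a - b)) A"
  using has_sum_add[OF assms(1), of "\<lambda>x. - g x" "- b"] assms(2) by (simp add: has_sum_uminus)

text \<open>By the mean value inequality on the convex set \<open>S\<close> the difference quotients
  inherit the bound \<open>M k\<close>, so their sums converge uniformly and the two limits may be
  exchanged. Working within \<open>S\<close> covers one-sided derivatives at the ends of a time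
  interval.\<close>

lemma has_vector_derivative_infsum:
  fixes f :: "'k \<Rightarrow> real \<Rightarrow> 'b::banach"
  assumes S: "convex S" "x \<in> S"
    and f: "\<And>k y. y \<in> S \<Longrightarrow> (f k has_vector_derivative f' k y) (at y within S)"
    and M: "\<And>k y. y \<in> S \<Longrightarrow> norm (f' k y) \<le> M k" "M summable_on UNIV"
    and sm: "\<And>y. y \<in> S \<Longrightarrow> (\<lambda>k. f k y) summable_on UNIV"
  shows "((\<lambda>y. \<Sum>\<^sub>\<infinity>k. f k y) has_vector_derivative (\<Sum>\<^sub>\<infinity>k. f' k x)) (at x within S)"
\<comment> \<open>If x is isolated in \<open>S\<close>, every limit statement holds trivially;
  otherwise the filter is nontrivial, as the exchange of limits requires.\<close>
proof (cases "at x within S = bot")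
  case True
  then show ?thesis unfolding has_vector_derivative_iff_quotient by simp
next
  case False
  let ?q = "\<lambda>k y. (f k y - f k x) /\<^sub>R (y - x)"
  have q: "norm (?q k y) \<le> M k" if "y \<in> S - {x}" for k y
  proof -
    have "norm (f k y - f k x) \<le> M k * norm (y - x)"
    proof (rule differentiable_bound[OF S(1) _ _ _ S(2)])
      show "(f k has_derivative (\<lambda>h. h *\<^sub>R f' k z)) (at z within S)" if "z \<in> S" for z
        using f[OF that] by (simp add: has_vector_derivative_def)
      show "onorm (\<lambda>h. h *\<^sub>R f' k z) \<le> M k" if "z \<in> S" for z
        by (rule onorm_le) (use M(1)[OF that, of k] in \<open>simp add: mult.commute mult_left_mono\<close>)
    qed (use that in auto)
    then show ?thesis using that unfolding norm_scaleR by (simp add: field_simps)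
  qed
  have at: "at x within (S - {x}) = at x within S"
    by (simp add: at_within_def)
  have "uniform_limit (S - {x}) (\<lambda>X y. \<Sum>k\<in>X. ?q k y) (\<lambda>y. \<Sum>\<^sub>\<infinity>k. ?q k y) (finite_subsets_at_top UNIV)"
    by (rule Weierstrass_m_test_general[OF q M(2)])
  then have lim: "((\<lambda>y. \<Sum>\<^sub>\<infinity>k. ?q k y) \<longlongrightarrow> (\<Sum>\<^sub>\<infinity>k. f' k x)) (at x within (S - {x}))"
  proof (rule swap_uniform_limit[rotated 2])
    have "(?q k \<longlongrightarrow> f' k x) (at x within (S - {x}))" for k
      using f[OF S(2), of k] unfolding at has_vector_derivative_iff_quotient .
    then show "\<forall>\<^sub>F X in finite_subsets_at_top UNIV. ((\<lambda>y. \<Sum>k\<in>X. ?q k y) \<longlongrightarrow> (\<Sum>k\<in>X. f' k x)) (at x within (S - {x}))"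
      by (intro always_eventually allI tendsto_sum)
    have "(\<lambda>k. f' k x) summable_on UNIV"
      by (rule abs_summable_summable, rule Infinite_Sum.abs_summable_on_comparison_test'[OF M(2)]) (use M S in auto)
    then show "((\<lambda>X. \<Sum>k\<in>X. f' k x) \<longlongrightarrow> (\<Sum>\<^sub>\<infinity>k. f' k x)) (finite_subsets_at_top UNIV)"
      by (rule infsum_tendsto)
  qed (use at False in simp_all)
  have "(\<Sum>\<^sub>\<infinity>k. ?q k y) = ((\<Sum>\<^sub>\<infinity>k. f k y) - (\<Sum>\<^sub>\<infinity>k. f k x)) /\<^sub>R (y - x)" if "y \<in> S" for y
  proof -
    have "((\<lambda>k. f k y - f k x) has_sum ((\<Sum>\<^sub>\<infinity>k. f k y) - (\<Sum>\<^sub>\<infinity>k. f k x))) UNIV"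
      using has_sum_diff[OF has_sum_infsum[OF sm[OF that]] has_sum_infsum[OF sm[OF S(2)]]] .
    from has_sum_scaleR[OF this] show ?thesis by (rule infsumI)
  qed
  then have "((\<lambda>y. ((\<Sum>\<^sub>\<infinity>k. f k y) - (\<Sum>\<^sub>\<infinity>k. f k x)) /\<^sub>R (y - x)) \<longlongrightarrow> (\<Sum>\<^sub>\<infinity>k. f' k x)) (at x within S)"
    by (intro Lim_transform_within[OF lim[unfolded at] zero_less_one]) simp
  then show ?thesis
    unfolding has_vector_derivative_iff_quotient .
qed

section \<open>Fourier coefficients on the torus\<close>

text \<open>Trades the Lebesgue integral of the definitions for the gauge integral, whose rules for
  shifting, splitting and differentiating under the integral carry the following arguments.\<close>

lemma torus_integral_eq:
  fixes f :: "real ^ 'n \<Rightarrow> 'b::euclidean_space"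
  assumes "continuous_on UNIV f"
  shows "torus_integral f = integral torus f"
proof -
  have "integrable (lebesgue_on torus) f"
    unfolding torus_def
    by (rule continuous_imp_integrable) (rule continuous_on_subset[OF assms], simp)
  then show ?thesis
    unfolding torus_integral_def by (rule lebesgue_integral_eq_integral) (simp add: torus_def)
qed

lemma integrable_on_torus:
  fixes f :: "real ^ 'n \<Rightarrow> 'b::banach"
  assumes "continuous_on UNIV f"
  shows "f integrable_on torus"
  unfolding torus_def by (rule integrable_continuous) (rule continuous_on_subset[OF assms], simp)

section \<open>Translation invariance and integration by parts\<close>

lemma axis_scaleR: "axis i (h :: real) = h *\<^sub>R axis i 1"
  by (simp add: vec_eq_iff axis_def)

lemma axis_0: "axis i 0 = (0 :: real ^ 'n)"
  by (simp add: vec_eq_iff axis_def)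

text \<open>The shifted box is cut at the face where coordinate i equals pi; the slab sticking out
  is moved back by one period and fills the gap on the other side.\<close>

lemma torus_integral_shift:
  fixes g :: "real ^ 'n \<Rightarrow> 'b::banach"
  assumes g: "continuous_on UNIV g" "periodic g" and h: "0 \<le> h" "h \<le> 2 * pi"
  shows "integral torus (\<lambda>x. g (x + axis i h)) = integral torus g"
proof -
  let ?a = "(\<chi> j. - pi) :: real ^ 'n" and ?b = "(\<chi> j. pi) :: real ^ 'n"
  let ?c = "axis i h :: real ^ 'n" and ?s = "axis i (2 * pi) :: real ^ 'n"
  \<comment> \<open>Upper corner of the slab of width h at the lower face: the gap left by the
    shift.\<close>
  let ?u = "(\<chi> j. if j = i then - pi + h else pi) :: real ^ 'n"
  have int: "g integrable_on cbox u v" for u v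
    by (rule integrable_continuous) (rule continuous_on_subset[OF g(1)], simp)
  have e: "axis i 1 \<in> (Basis :: (real ^ 'n) set)" by simp
  have ip: "x \<bullet> axis i 1 = x $ i" for x :: "real ^ 'n" by (simp add: inner_axis)
  have sp: "cbox u v \<inter> {x. x $ i \<le> r} = cbox u (\<chi> j. if j = i then min (v $ i) r else v $ j)"
    "cbox u v \<inter> {x. x $ i \<ge> r} = cbox (\<chi> j. if j = i then max (u $ i) r else u $ j) v" for u v :: "real ^ 'n" and r
    unfolding Int_iff mem_box_cart mem_Collect_eq set_eq_iff vec_lambda_beta by auto
  have 1: "cbox (?a + ?c) (?b + ?c) \<inter> {x. x \<bullet> axis i 1 \<le> pi} = cbox (?a + ?c) ?b"
    unfolding ip sp using h by (intro arg_cong2[of _ _ _ _ cbox]) (auto simp: vec_eq_iff axis_def)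
  have 2: "cbox (?a + ?c) (?b + ?c) \<inter> {x. x \<bullet> axis i 1 \<ge> pi} = cbox (?a + ?s) (?u + ?s)"
    unfolding ip sp using h by (intro arg_cong2[of _ _ _ _ cbox]) (auto simp: vec_eq_iff axis_def)
  have 3: "cbox ?a ?b \<inter> {x. x \<bullet> axis i 1 \<le> - pi + h} = cbox ?a ?u"
    unfolding ip sp using h by (intro arg_cong2[of _ _ _ _ cbox]) (auto simp: vec_eq_iff axis_def)
  have 4: "cbox ?a ?b \<inter> {x. x \<bullet> axis i 1 \<ge> - pi + h} = cbox (?a + ?c) ?b"
    unfolding ip sp using h by (intro arg_cong2[of _ _ _ _ cbox]) (auto simp: vec_eq_iff axis_def)
  have "integral (cbox ?a ?b) (g \<circ> (+) ?c) = integral (cbox (?a + ?c) (?b + ?c)) g"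
    by (rule integral_shift_cbox_plus)
  also have "\<dots> = integral (cbox (?a + ?c) ?b) g + integral (cbox (?a + ?s) (?u + ?s)) g"
    using integral_split[OF int e, of "?a + ?c" "?b + ?c" pi] unfolding 1 2 .
  also have "integral (cbox (?a + ?s) (?u + ?s)) g = integral (cbox ?a ?u) (g \<circ> (+) ?s)"
    by (rule integral_shift_cbox_plus[symmetric])
  also have "g \<circ> (+) ?s = g"
    using g(2) by (auto simp: periodic_def fun_eq_iff add.commute)
  also have "integral (cbox (?a + ?c) ?b) g + integral (cbox ?a ?u) g = integral (cbox ?a ?b) g"
    using integral_split[OF int e, of ?a ?b "- pi + h"] unfolding 3 4 by (simp add: add.commute)
  finally show ?thesis
    by (simp add: torus_def o_def add.commute)
qed

text \<open>The integral of g(x + h e_i) is constant in h, and its derivative at h = 0 is the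
  integral of \<open>g'\<close>. Shifts are available for nonnegative h only, so the derivative is
  taken one-sidedly within [0, 1], where it is still unique.\<close>

lemma torus_integral_derivative:
  fixes g g' :: "real ^ 'n \<Rightarrow> 'b::banach"
  assumes g: "continuous_on UNIV g" "periodic g" and g': "continuous_on UNIV g'"
    and D: "\<And>x. ((\<lambda>h. g (x + axis i h)) has_vector_derivative g' x) (at 0)"
  shows "integral torus g' = 0"
proof -
  have ax: "continuous_on UNIV (\<lambda>h. axis i h :: real ^ 'n)"
    by (subst axis_scaleR) (intro continuous_intros)
  have D': "((\<lambda>h. g (x + axis i h)) has_vector_derivative g' (x + axis i h)) (at h within S)" for x h S
  proof -
    have "((\<lambda>s. g (x + axis i s)) has_vector_derivative g' (x + axis i h)) (at h)"
    proof -
      have "((\<lambda>s. g ((x + axis i h) + axis i (s - h))) has_derivative (\<lambda>s. s *\<^sub>R g' (x + axis i h))) (at h)"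
        by (rule has_derivative_compose[of "\<lambda>s. s - h" "\<lambda>s. s" h UNIV])
          (use D[of "x + axis i h"] in \<open>auto simp: has_vector_derivative_def intro!: derivative_eq_intros\<close>)
      moreover have "(x + axis i h) + axis i (s - h) = x + axis i s" for s
        by (simp add: axis_def vec_eq_iff)
      ultimately show ?thesis by (simp add: has_vector_derivative_def)
    qed
    then show ?thesis by (rule has_vector_derivative_at_within)
  qed
  have "((\<lambda>h. integral (cbox (\<chi> i. - pi) (\<chi> i. pi)) (\<lambda>x. g (x + axis i h))) has_vector_derivative
      integral (cbox (\<chi> i. - pi) (\<chi> i. pi)) (\<lambda>x. g' (x + axis i 0))) (at 0 within {0..1})"
  proof (rule leibniz_rule_vector_derivative)
    show "(\<lambda>x. g (x + axis i h)) integrable_on cbox (\<chi> i. - pi) (\<chi> i. pi)" for h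
      by (rule integrable_continuous) (intro continuous_on_compose2[OF g(1)] continuous_intros, auto)
    show "continuous_on ({0..1} \<times> cbox (\<chi> i. - pi) (\<chi> i. pi)) (\<lambda>(h, x). g' (x + axis i h))"
      unfolding split_beta
      by (rule continuous_on_compose2[OF g'])
        (auto intro!: continuous_on_add continuous_on_compose2[OF ax] continuous_on_fst continuous_on_snd continuous_on_id)
  qed (simp_all add: D')
  note D1 = this
  have "((\<lambda>h. integral torus g) has_vector_derivative
      integral (cbox (\<chi> i. - pi) (\<chi> i. pi)) (\<lambda>x. g' (x + axis i 0))) (at 0 within {0..1})"
  proof (rule has_vector_derivative_transform[OF _ _ D1])
    show "integral torus g = integral (cbox (\<chi> i. - pi) (\<chi> i. pi)) (\<lambda>x. g (x + axis i h))"
      if "h \<in> {0..1}" for h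
      using torus_integral_shift[OF g, of h i] that pi_gt3 by (simp add: torus_def)
  qed simp
  then have "((\<lambda>h. integral torus g) has_vector_derivative integral torus g') (at 0 within cbox 0 1)"
    by (simp add: torus_def axis_0)
  from vector_derivative_unique_within_closed_interval[OF _ _ this has_vector_derivative_const]
  show ?thesis by simp
qed

section \<open>Characters and Fourier coefficients\<close>

lemma cis_add_axis:
  fixes x :: "real ^ 'n"
  shows "cis (freq k \<bullet> (x + axis i h)) = cis (freq k \<bullet> x) * cis (real_of_int (k $ i) * h)"
  by (simp add: inner_add_right inner_axis cis_mult)

lemma continuous_on_cis_freq [continuous_intros]:
  "continuous_on S (\<lambda>x. cis (freq k \<bullet> x))"
  "continuous_on S (\<lambda>x. cis (- (freq k \<bullet> x)))"
  by (intro continuous_on_cis continuous_intros)+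

lemma periodic_cis_freq: "cis (freq k \<bullet> (x + axis i (2 * pi))) = cis (freq k \<bullet> x)"
proof -
  have "cis (real_of_int (k $ i) * (2 * pi)) = 1"
    using cis_multiple_2pi[of "real_of_int (k $ i)"] by (simp add: mult_ac)
  then show ?thesis by (simp only: cis_add_axis mult_1_right)
qed

lemma cis_freq_derivative:
  "((\<lambda>h. cis (freq k \<bullet> (x + axis i h))) has_vector_derivative
    \<i> * of_int (k $ i) * cis (freq k \<bullet> (x + axis i h))) (at h within S)"
proof -
  have "((\<lambda>h. cis (freq k \<bullet> x + real_of_int (k $ i) * h)) has_derivative
      (\<lambda>t. (real_of_int (k $ i) * t) *\<^sub>R (\<i> * cis (freq k \<bullet> x + real_of_int (k $ i) * h)))) (at h within S)"
    by (auto intro!: derivative_eq_intros)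
  then show ?thesis
    by (simp add: has_vector_derivative_def inner_add_right inner_axis scaleR_conv_of_real mult_ac)
qed

text \<open>Up to the nonzero factor i k_i the character is its own derivative in a direction with
  k_i different from 0, and derivatives of periodic functions integrate to zero.\<close>

lemma integral_cis_freq:
  fixes k :: "int ^ 'n"
  shows "integral torus (\<lambda>x. cis (freq k \<bullet> x)) = (if k = 0 then (2 * pi) ^ CARD('n) else 0)"
proof (cases "k = 0")
  case True
  then show ?thesis
    by (simp add: torus_def freq_0 content_cbox_cart interval_ne_empty_cart of_real_def[symmetric])
next
  case False
  then obtain i where i: "k $ i \<noteq> 0" by (auto simp: vec_eq_iff)
  have "integral torus (\<lambda>x. \<i> * of_int (k $ i) * cis (freq k \<bullet> x)) = 0"
  proof (rule torus_integral_derivative[where i = i])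
    show "((\<lambda>h. cis (freq k \<bullet> (x + axis i h))) has_vector_derivative \<i> * of_int (k $ i) * cis (freq k \<bullet> x)) (at 0)" for x
      
      using cis_freq_derivative[of k x i 0] by (simp add: axis_0)
  qed (auto intro!: continuous_intros simp: periodic_def periodic_cis_freq)
  with i False show ?thesis by simp
qed

lemma fourier_coeff_eq:
  fixes f :: "real ^ 'n \<Rightarrow> real"
  assumes "continuous_on UNIV f"
  shows "fourier_coeff f k = integral torus (\<lambda>x. of_real (f x) * cis (- (freq k \<bullet> x))) / (2 * pi) ^ CARD('n)"
  unfolding fourier_coeff_def
  by (subst torus_integral_eq) (auto intro!: continuous_intros assms)

text \<open>Integration by parts: the derivative of f times the conjugate character has integral
  zero.\<close>

lemma fourier_coeff_partial:
  fixes f f' :: "real ^ 'n \<Rightarrow> real"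
  assumes f: "continuous_on UNIV f" "periodic f" and f': "continuous_on UNIV f'"
    and D: "\<And>x. ((\<lambda>h. f (x + axis i h)) has_real_derivative f' x) (at 0)"
  shows "fourier_coeff f' k = \<i> * of_int (k $ i) * fourier_coeff f k"
proof -
  let ?e = "\<lambda>x. cis (- (freq k \<bullet> x))"
  let ?g = "\<lambda>x. of_real (f x) * ?e x"
  let ?g' = "\<lambda>x. of_real (f' x) * ?e x - \<i> * of_int (k $ i) * (of_real (f x) * ?e x)"
  have "integral torus ?g' = 0"
  proof (rule torus_integral_derivative[where i = i and g = ?g])
    show "periodic ?g"
      using f(2) periodic_cis_freq[of "- k"] by (simp add: periodic_def freq_minus)
    show "((\<lambda>h. ?g (x + axis i h)) has_vector_derivative ?g' x) (at 0)" for x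
    proof -
      have "((\<lambda>h. of_real (f (x + axis i h)) :: complex) has_vector_derivative of_real (f' x)) (at 0)"
        using D[of x] by (simp add: has_vector_derivative_of_real)
      from has_vector_derivative_mult[OF this cis_freq_derivative[of "- k" x i 0]]
      show ?thesis by (simp add: axis_0 freq_minus algebra_simps)
    qed
  qed (intro continuous_intros f f')+
  moreover have "integral torus ?g' = integral torus (\<lambda>x. of_real (f' x) * ?e x)
      - \<i> * of_int (k $ i) * integral torus ?g"
    by (subst integral_diff) (auto intro!: integrable_on_torus continuous_intros f f')
  ultimately show ?thesis
    by (simp add: fourier_coeff_eq f f')
qed

section \<open>Absolutely convergent trigonometric series\<close>

text \<open>Kept complex, without the real part taken in \<open>fourier_multiplier\<close>, so that
  it can be multiplied by characters and integrated term by term; \<open>trig_real\<close> shows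
  that the real part loses nothing for Hermitian coefficients.\<close>

definition trig :: "(int ^ 'n \<Rightarrow> complex) \<Rightarrow> real ^ 'n \<Rightarrow> complex" where
  "trig c x = (\<Sum>\<^sub>\<infinity>k. c k * cis (freq k \<bullet> x))"

lemma fourier_multiplier_eq_trig:
  "fourier_multiplier m f = (\<lambda>x. Re (trig (\<lambda>k. m k * fourier_coeff f k) x))"
  by (simp add: fun_eq_iff fourier_multiplier_def trig_def)

lemma trig_has_sum:
  assumes "(\<lambda>k. norm (c k)) summable_on UNIV"
  shows "((\<lambda>k. c k * cis (freq k \<bullet> x)) has_sum trig c x) UNIV"
  unfolding trig_def
  by (rule has_sum_infsum, rule abs_summable_summable) (simp add: norm_mult assms)

lemma trig_uniform_limit:
  assumes "(\<lambda>k. norm (c k)) summable_on UNIV"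
  shows "uniform_limit S (\<lambda>F x. \<Sum>k\<in>F. c k * cis (freq k \<bullet> x)) (trig c) (finite_subsets_at_top UNIV)"
  by (rule Weierstrass_m_test_general'[OF _ trig_has_sum[OF assms] assms]) (simp add: norm_mult)

lemma continuous_on_trig:
  assumes "(\<lambda>k. norm (c k)) summable_on UNIV"
  shows "continuous_on S (trig c)"
  by (rule uniform_limit_theorem[OF _ trig_uniform_limit[OF assms]])
    (auto intro!: always_eventually continuous_intros)

lemma trig_sum:
  assumes "finite I" "\<And>i. i \<in> I \<Longrightarrow> (\<lambda>k. norm (c i k)) summable_on UNIV"
  shows "trig (\<lambda>k. \<Sum>i\<in>I. c i k) x = (\<Sum>i\<in>I. trig (c i) x)"
  unfolding trig_def sum_distrib_right
  by (rule infsum_finite_sum) (auto intro: assms has_sum_imp_summable trig_has_sum)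

lemma trig_real:
  assumes "\<And>k. c (- k) = cnj (c k)"
  shows "of_real (Re (trig c x)) = trig c x"
proof -
  have "cnj (trig c x) = (\<Sum>\<^sub>\<infinity>k. c (- k) * cis (freq (- k) \<bullet> x))"
    unfolding trig_def infsum_cnj[symmetric] by (simp add: assms freq_minus cis_cnj)
  also have "\<dots> = trig c x"
    unfolding trig_def by (rule infsum_reindex_bij_betw) (rule bij_uminus)
  finally show ?thesis by (simp add: complex_eq_iff)
qed

lemma norm_trig_le:
  assumes "(\<lambda>k. norm (c k)) summable_on UNIV"
  shows "norm (trig c x) \<le> (\<Sum>\<^sub>\<infinity>k. norm (c k))"
  by (rule norm_infsum_le[OF trig_has_sum[OF assms] has_sum_infsum[OF assms]]) (simp add: norm_mult)

text \<open>The continuous factor is bounded on the compact torus, so the product series still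
  converges uniformly and may be integrated term by term.\<close>

lemma integral_trig_mult:
  fixes g :: "real ^ 'n \<Rightarrow> complex"
  assumes c: "(\<lambda>k. norm (c k)) summable_on UNIV" and g: "continuous_on UNIV g"
  shows "((\<lambda>k. c k * integral torus (\<lambda>x. cis (freq k \<bullet> x) * g x)) has_sum
    integral torus (\<lambda>x. trig c x * g x)) UNIV"
proof -
  have g': "continuous_on torus g" by (rule continuous_on_subset[OF g]) simp
  have "bounded (g ` torus)"
    by (rule compact_imp_bounded, rule compact_continuous_image[OF g']) (simp add: torus_def)
  then obtain K where "\<forall>y\<in>g ` torus. norm y \<le> K"
    unfolding bounded_iff ..
  then have K: "norm (g x) \<le> K" if "x \<in> torus" for x using that by blast
  have cs: "continuous_on S (\<lambda>x. c k * (cis (freq k \<bullet> x) * g x))" for k S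
    by (intro continuous_intros continuous_on_subset[OF g]) auto
  have "uniform_limit torus (\<lambda>F x. \<Sum>k\<in>F. c k * (cis (freq k \<bullet> x) * g x)) (\<lambda>x. trig c x * g x)
      (finite_subsets_at_top UNIV)"
  proof (rule Weierstrass_m_test_general')
    show "norm (c k * (cis (freq k \<bullet> x) * g x)) \<le> norm (c k) * K" if "x \<in> torus" for k x
      using K[OF that] by (simp add: norm_mult mult_left_mono)
    show "((\<lambda>k. c k * (cis (freq k \<bullet> x) * g x)) has_sum trig c x * g x) UNIV" for x
      using has_sum_cmult_left[OF trig_has_sum[OF c, of x], of "g x"] by (simp add: mult.assoc)
    show "(\<lambda>k. norm (c k) * K) summable_on UNIV" by (rule summable_on_cmult_left[OF c])
  qed
  note U = this
  obtain I J where I: "\<And>F. ((\<lambda>x. \<Sum>k\<in>F. c k * (cis (freq k \<bullet> x) * g x)) has_integral I F) torus"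
    and J: "((\<lambda>x. trig c x * g x) has_integral J) torus" and lim: "(I \<longlongrightarrow> J) (finite_subsets_at_top UNIV)"
  proof (rule uniform_limit_integral_cbox[where a = "\<chi> i. - pi" and b = "\<chi> i. pi", folded torus_def, OF U])
    show "continuous_on torus (\<lambda>x. \<Sum>k\<in>F. c k * (cis (freq k \<bullet> x) * g x))" for F
      by (intro continuous_on_sum cs)
  qed (simp, rule that)
  have "I F = (\<Sum>k\<in>F. c k * integral torus (\<lambda>x. cis (freq k \<bullet> x) * g x))" if "finite F" for F
  proof -
    have "I F = integral torus (\<lambda>x. \<Sum>k\<in>F. c k * (cis (freq k \<bullet> x) * g x))"
      using I by (rule integral_unique[symmetric])
    also have "\<dots> = (\<Sum>k\<in>F. integral torus (\<lambda>x. c k * (cis (freq k \<bullet> x) * g x)))"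
      by (rule integral_sum[OF that]) (rule integrable_on_torus[OF cs])
    finally show ?thesis by simp
  qed
  then have "((\<lambda>F. \<Sum>k\<in>F. c k * integral torus (\<lambda>x. cis (freq k \<bullet> x) * g x)) \<longlongrightarrow> J) (finite_subsets_at_top UNIV)"
    by (intro Lim_transform_eventually[OF lim] eventually_finite_subsets_at_top_weakI) simp
  then show ?thesis
    unfolding has_sum_def using integral_unique[OF J] by simp
qed

text \<open>Only the first factor is expanded; each of its characters merely shifts the frequency at
  which the coefficient of the continuous function \<open>f\<close> is taken. This turns the product
  in the nonlinearity into a convolution.\<close>

lemma fourier_coeff_trig_mult:
  fixes c :: "int ^ 'n \<Rightarrow> complex" and f :: "real ^ 'n \<Rightarrow> real"
  assumes c: "(\<lambda>k. norm (c k)) summable_on UNIV" "\<And>k. c (- k) = cnj (c k)" and f: "continuous_on UNIV f"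
  shows "fourier_coeff (\<lambda>x. Re (trig c x) * f x) k = (\<Sum>\<^sub>\<infinity>l. c (k - l) * fourier_coeff f l)"
proof -
  let ?N = "(2 * pi) ^ CARD('n) :: complex"
  have "fourier_coeff (\<lambda>x. Re (trig c x) * f x) k
      = integral torus (\<lambda>x. trig c x * (of_real (f x) * cis (- (freq k \<bullet> x)))) / ?N"
    by (subst fourier_coeff_eq)
      (auto intro!: continuous_intros f continuous_on_trig c simp: trig_real[of c, OF c(2)] mult.assoc)
  moreover have "((\<lambda>p. c p * integral torus (\<lambda>x. cis (freq p \<bullet> x) * (of_real (f x) * cis (- (freq k \<bullet> x)))) / ?N) has_sum
      integral torus (\<lambda>x. trig c x * (of_real (f x) * cis (- (freq k \<bullet> x)))) / ?N) UNIV"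
    by (intro has_sum_divide_const integral_trig_mult c continuous_intros f)
  moreover have "integral torus (\<lambda>x. cis (freq p \<bullet> x) * (of_real (f x) * cis (- (freq k \<bullet> x)))) / ?N
      = fourier_coeff f (k - p)" for p
  proof -
    have "cis (freq p \<bullet> x) * (of_real (f x) * cis (- (freq k \<bullet> x))) = of_real (f x) * cis (- (freq (k - p) \<bullet> x))" for x
    proof -
      have "cis (freq p \<bullet> x) * cis (- (freq k \<bullet> x)) = cis (- (freq (k - p) \<bullet> x))"
        by (simp add: cis_mult freq_diff inner_diff_left)
      then show ?thesis by (simp only: mult.left_commute)
    qed
    then show ?thesis by (simp only: fourier_coeff_eq[OF f])
  qed
  ultimately have "((\<lambda>p. c p * fourier_coeff f (k - p)) has_sum fourier_coeff (\<lambda>x. Re (trig c x) * f x) k) UNIV"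
    by (simp only: times_divide_eq_right[symmetric])
  then have "fourier_coeff (\<lambda>x. Re (trig c x) * f x) k = (\<Sum>\<^sub>\<infinity>p. c p * fourier_coeff f (k - p))"
    by (rule infsumI[symmetric])
  also have "\<dots> = (\<Sum>\<^sub>\<infinity>l. c (k - l) * fourier_coeff f l)"
    by (rule infsum_reindex_bij_witness[of _ "\<lambda>l. k - l" "\<lambda>l. k - l"]) auto
  finally show ?thesis .
qed

lemma fourier_coeff_one: "fourier_coeff (\<lambda>x :: real ^ 'n. 1) k = (if k = 0 then 1 else 0)"
  using integral_cis_freq[of "- k"] by (simp add: fourier_coeff_eq freq_minus)

text \<open>The product formula with constant second factor 1, whose only nonzero coefficient sits
  at frequency 0.\<close>

lemma fourier_coeff_trig:
  fixes c :: "int ^ 'n \<Rightarrow> complex"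
  assumes c: "(\<lambda>k. norm (c k)) summable_on UNIV" "\<And>k. c (- k) = cnj (c k)"
  shows "fourier_coeff (\<lambda>x. Re (trig c x)) k = c k"
proof -
  have "fourier_coeff (\<lambda>x. Re (trig c x)) k = (\<Sum>\<^sub>\<infinity>l. c (k - l) * fourier_coeff (\<lambda>x. 1) l)"
    using fourier_coeff_trig_mult[OF c, of "\<lambda>x. 1"] by simp
  also have "\<dots> = (\<Sum>\<^sub>\<infinity>l\<in>{0}. c (k - l) * fourier_coeff (\<lambda>x. 1) l)"
    by (rule infsum_cong_neutral) (auto simp: fourier_coeff_one)
  finally show ?thesis by (simp add: fourier_coeff_one)
qed

lemma partial_trig:
  fixes c :: "int ^ 'n \<Rightarrow> complex"
  assumes "rapid c"
  shows "partial i (\<lambda>x. Re (trig c x)) x = Re (trig (\<lambda>k. \<i> * of_int (k $ i) * c k) x)"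
proof -
  have le: "\<bar>real_of_int (k $ i)\<bar> \<le> 1 + wt k" for k :: "int ^ 'n"
    using component_le_norm_cart[of "freq k" i] by simp
  have "((\<lambda>h. \<Sum>\<^sub>\<infinity>k. c k * cis (freq k \<bullet> (x + axis i h))) has_vector_derivative
      (\<Sum>\<^sub>\<infinity>k. c k * (\<i> * of_int (k $ i) * cis (freq k \<bullet> (x + axis i 0))))) (at 0 within UNIV)"
  proof (rule has_vector_derivative_infsum)
    show "((\<lambda>h. c k * cis (freq k \<bullet> (x + axis i h))) has_vector_derivative
        c k * (\<i> * of_int (k $ i) * cis (freq k \<bullet> (x + axis i h)))) (at h within UNIV)" for k h
      by (intro has_vector_derivative_mult_right cis_freq_derivative)
    show "norm (c k * (\<i> * of_int (k $ i) * cis (freq k \<bullet> (x + axis i h)))) \<le> (1 + wt k) ^ 1 * norm (c k)" for k h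
      using mult_right_mono[OF le, of "norm (c k)" k] by (simp add: norm_mult mult.commute)
    show "(\<lambda>k. (1 + wt k) ^ 1 * norm (c k)) summable_on UNIV"
      by (rule rapid_summable[OF assms])
    show "(\<lambda>k. c k * cis (freq k \<bullet> (x + axis i h))) summable_on UNIV" for h
      using trig_has_sum[OF rapid_abs_summable[OF assms]] by (rule has_sum_imp_summable)
  qed auto
  then have "((\<lambda>h. trig c (x + axis i h)) has_vector_derivative trig (\<lambda>k. \<i> * of_int (k $ i) * c k) x) (at 0)"
    by (simp add: trig_def axis_0 mult_ac)
  from bounded_linear.has_vector_derivative[OF bounded_linear_Re this]
  show ?thesis
    unfolding partial_def by (simp add: has_real_derivative_iff_has_vector_derivative[symmetric] DERIV_imp_deriv)
qed

section \<open>Functions that are smooth up to the initial time\<close>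

lemma Ck_on_cong:
  assumes "\<And>x. x \<in> X \<Longrightarrow> f x = g x"
  shows "Ck_on k X f \<longleftrightarrow> Ck_on k X g"
proof (cases k)
  case 0
  then show ?thesis using assms by (simp cong: continuous_on_cong)
next
  case (Suc j)
  have "(f has_derivative f' x) (at x within X) \<longleftrightarrow> (g has_derivative f' x) (at x within X)" if "x \<in> X" for f' x
    using that assms by (metis has_derivative_transform)
  then show ?thesis by (simp add: Suc cong: conj_cong)
qed

abbreviation half_space :: "(real \<times> (real ^ 'n)) set" where
  "half_space \<equiv> {0..} \<times> UNIV"

text \<open>At time 0 only directions into the half-space are admissible. All basis vectors have
  nonnegative time component, so a small positive step along each of them stays inside.\<close>

lemma half_space_derivative_unique:
  fixes z :: "real \<times> (real ^ 'n)"
  assumes "z \<in> half_space"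
    and "(g has_derivative A) (at z within half_space)" "(g has_derivative B) (at z within half_space)"
  shows "A = B"
proof (rule frechet_derivative_unique_within[OF assms(2,3)])
  fix i :: "real \<times> (real ^ 'n)" and e :: real
  assume i: "i \<in> Basis" and e: "0 < e"
  have "0 \<le> fst i" using i by (auto simp: Basis_prod_def)
  then have "z + (e / 2) *\<^sub>R i \<in> half_space"
    using assms(1) e by (auto simp: mem_Times_iff)
  then show "\<exists>d. 0 < \<bar>d\<bar> \<and> \<bar>d\<bar> < e \<and> z + d *\<^sub>R i \<in> half_space"
    using e by (intro exI[of _ "e / 2"]) auto
qed

text \<open>\<open>Ck_on\<close> lets the derivative depend on the order k. Uniqueness identifies
  these choices, so a single derivative serves all orders and is itself smooth.\<close>

lemma smooth_on_derivative:
  fixes g :: "real \<times> (real ^ 'n) \<Rightarrow> real"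
  assumes "smooth_on half_space g"
  obtains g' where "\<And>z. z \<in> half_space \<Longrightarrow> (g has_derivative g' z) (at z within half_space)"
    "\<And>v. smooth_on half_space (\<lambda>z. g' z v)"
proof -
  have "\<exists>g'. (\<forall>z\<in>half_space. (g has_derivative g' z) (at z within half_space))
      \<and> (\<forall>v. Ck_on k half_space (\<lambda>z. g' z v))" for k
    using assms[unfolded smooth_on_def, rule_format, of "Suc k"] by simp
  then obtain G where G: "\<And>k z. z \<in> half_space \<Longrightarrow> (g has_derivative G k z) (at z within half_space)"
    "\<And>k v. Ck_on k half_space (\<lambda>z. G k z v)"
    by metis
  have "Ck_on k half_space (\<lambda>z. G 0 z v)" for k v
  proof -
    have "G 0 z = G k z" if "z \<in> half_space" for z
      by (rule half_space_derivative_unique[OF that G(1)[OF that] G(1)[OF that]])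
    then show ?thesis using G(2)[of k v] by (subst Ck_on_cong[of _ _ "\<lambda>z. G k z v"]) auto
  qed
  with G(1)[of _ 0] show thesis by (intro that[of "G 0"]) (auto simp: smooth_on_def)
qed

lemma smooth_on_continuous:
  "smooth_on X g \<Longrightarrow> continuous_on X g"
  unfolding smooth_on_def by (metis Ck_on.simps(1))

lemma continuous_on_slice:
  fixes g :: "real \<times> (real ^ 'n) \<Rightarrow> 'b::topological_space"
  assumes "continuous_on half_space g" "0 \<le> t"
  shows "continuous_on S (\<lambda>x. g (t, x))"
  by (rule continuous_on_compose2[OF assms(1)]) (auto intro!: continuous_intros assms(2))

text \<open>A shift by a period maps the half-space to itself and leaves \<open>g\<close> unchanged,
  so the shifted derivative is again a derivative of \<open>g\<close>; uniqueness does the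
  rest.\<close>

lemma derivative_periodic:
  fixes g :: "real \<times> (real ^ 'n) \<Rightarrow> real"
  assumes g: "\<And>z. z \<in> half_space \<Longrightarrow> (g has_derivative g' z) (at z within half_space)"
    and per: "\<And>t. 0 \<le> t \<Longrightarrow> periodic (\<lambda>x. g (t, x))" and t: "0 \<le> t"
  shows "periodic (\<lambda>x. g' (t, x) v)"
  unfolding periodic_def
proof (intro allI)
  fix x :: "real ^ 'n" and i
  let ?s = "(0, axis i (2 * pi)) :: real \<times> (real ^ 'n)"
  have tx: "(t, x) \<in> half_space" "(t, x) + ?s \<in> half_space" using t by auto
  have "((\<lambda>z. g (z + ?s)) has_derivative (\<lambda>h. g' ((t, x) + ?s) h)) (at (t, x) within half_space)"
    by (rule has_derivative_in_compose2[of half_space g g' "\<lambda>z. z + ?s" half_space "(t, x)" "\<lambda>h. h"])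
      (use g tx in \<open>auto intro!: derivative_eq_intros\<close>)
  then have "(g has_derivative (\<lambda>h. g' ((t, x) + ?s) h)) (at (t, x) within half_space)"
    by (rule has_derivative_transform[rotated 2]) (use per tx in \<open>auto simp: periodic_def\<close>)
  from fun_cong[OF half_space_derivative_unique[OF tx(1) this g[OF tx(1)]], of v]
  show "g' (t, x + axis i (2 * pi)) v = g' (t, x) v" by simp
qed

lemma space_derivative:
  fixes g :: "real \<times> (real ^ 'n) \<Rightarrow> real"
  assumes g: "\<And>z. z \<in> half_space \<Longrightarrow> (g has_derivative g' z) (at z within half_space)" and t: "0 \<le> t"
  shows "((\<lambda>h. g (t, x + axis i h)) has_real_derivative g' (t, x) (0, axis i 1)) (at 0)"
proof -
  have "((\<lambda>h. g (t, x + axis i h)) has_derivative (\<lambda>h. g' (t, x + axis i 0) (0, axis i h))) (at 0 within UNIV)"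
  proof (rule has_derivative_in_compose2[of half_space g g'])
    have "((\<lambda>h. (t, x + h *\<^sub>R axis i 1)) has_derivative (\<lambda>h. (0, h *\<^sub>R axis i 1))) (at 0 within UNIV)"
      by (auto intro!: derivative_eq_intros)
    then show "((\<lambda>h. (t, x + axis i h)) has_derivative (\<lambda>h. (0, axis i h))) (at 0 within UNIV)"
      by (simp only: axis_scaleR[symmetric])
  qed (use g t in auto)
  moreover have "g' (t, x) (0, axis i h) = h * g' (t, x) (0, axis i 1)" for h
  proof -
    have "(t, x) \<in> half_space" using t by simp
    then have "linear (g' (t, x))" using g has_derivative_linear by blast
    from linear_scale[OF this, of h "(0, axis i 1)"] show ?thesis
      by (simp add: axis_scaleR[of i h])
  qed
  then have "(\<lambda>h. g' (t, x) (0, axis i h)) = (*) (g' (t, x) (0, axis i 1))"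
    by (metis (no_types, lifting) ext mult.commute)
  ultimately show ?thesis by (simp only: has_field_derivative_def axis_0 add_0_right)
qed

lemma time_derivative:
  fixes g :: "real \<times> (real ^ 'n) \<Rightarrow> real"
  assumes g: "\<And>z. z \<in> half_space \<Longrightarrow> (g has_derivative g' z) (at z within half_space)" and t: "0 \<le> t"
  shows "((\<lambda>t. g (t, x)) has_real_derivative g' (t, x) (1, 0)) (at t within {0..})"
proof -
  have "((\<lambda>t. g (t, x)) has_derivative (\<lambda>h. g' (t, x) (h, 0))) (at t within {0..})"
    by (rule has_derivative_in_compose2[of half_space g g' "\<lambda>t. (t, x)" "{0..}" t "\<lambda>h. (h, 0)"])
      (use g t in \<open>auto intro!: derivative_eq_intros\<close>)
  moreover have "g' (t, x) (h, 0) = h * g' (t, x) (1, 0)" for h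
  proof -
    have "(t, x) \<in> half_space" using t by simp
    then have "linear (g' (t, x))" using g has_derivative_linear by blast
    from linear_scale[OF this, of h "(1, 0)"] show ?thesis by simp
  qed
  then have "(\<lambda>h. g' (t, x) (h, 0)) = (*) (g' (t, x) (1, 0))"
    by (metis (no_types, lifting) ext mult.commute)
  ultimately show ?thesis by (simp only: has_field_derivative_def)
qed

text \<open>Each spatial derivative in direction i contributes one factor k_i. The induction
  generalises over \<open>g\<close> because the derivative of \<open>g\<close> takes its place;
  compactness of the time interval times the torus makes the base bound uniform in time.\<close>

lemma fourier_coeff_component_decay:
  fixes g :: "real \<times> (real ^ 'n) \<Rightarrow> real"
  assumes "smooth_on half_space g" "\<And>t. 0 \<le> t \<Longrightarrow> periodic (\<lambda>x. g (t, x))"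
  shows "\<exists>C. \<forall>t\<in>{0..\<tau>}. \<forall>k. \<bar>real_of_int (k $ i)\<bar> ^ M * cmod (fourier_coeff (\<lambda>x. g (t, x)) k) \<le> C"
  using assms
proof (induction M arbitrary: g)
  case 0
  have cg: "continuous_on half_space g" using 0 smooth_on_continuous by blast
  have "compact ({0..\<tau>} \<times> (torus :: (real ^ 'n) set))"
    by (intro compact_Times) (auto simp: torus_def)
  then have "bounded (g ` ({0..\<tau>} \<times> torus))"
    by (intro compact_imp_bounded compact_continuous_image continuous_on_subset[OF cg]) auto
  then obtain K0 where "\<forall>y\<in>g ` ({0..\<tau>} \<times> torus). norm y \<le> K0"
    unfolding bounded_iff ..
  then have K0: "\<bar>g (t, x)\<bar> \<le> K0" if "t \<in> {0..\<tau>}" "x \<in> torus" for t x using that by fastforce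
  \<comment> \<open>For negative \<tau> the time interval is empty and \<open>K0\<close> could be
    any number; the integral bound asks for a nonnegative constant.\<close>
  define K where "K = max K0 0"
  have K: "\<bar>g (t, x)\<bar> \<le> K" if "t \<in> {0..\<tau>}" "x \<in> torus" for t x
    using K0[OF that] by (simp add: K_def)
  have K_nonneg: "0 \<le> K" by (simp add: K_def)
  show ?case
  proof (intro exI ballI allI)
    fix t k assume t: "t \<in> {0..\<tau>}"
    then have ct: "continuous_on S (\<lambda>x. g (t, x))" for S :: "(real ^ 'n) set"
      using continuous_on_slice[OF cg] by simp
    have "cmod (integral torus (\<lambda>x. of_real (g (t, x)) * cis (- (freq k \<bullet> x)))) \<le> K * measure lborel (torus :: (real ^ 'n) set)"
      unfolding torus_def
    proof (rule integrable_bound[OF K_nonneg])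
      show "(\<lambda>x. of_real (g (t, x)) * cis (- (freq k \<bullet> x))) integrable_on cbox (\<chi> i. - pi) (\<chi> i. pi)"
        by (rule integrable_continuous) (intro continuous_intros ct)
      show "cmod (of_real (g (t, x)) * cis (- (freq k \<bullet> x))) \<le> K" if "x \<in> cbox (\<chi> i. - pi) (\<chi> i. pi)" for x
        using K[OF t, of x] that by (simp add: norm_mult torus_def)
    qed
    then show "\<bar>real_of_int (k $ i)\<bar> ^ 0 * cmod (fourier_coeff (\<lambda>x. g (t, x)) k)
        \<le> K * measure lborel (torus :: (real ^ 'n) set) / (2 * pi) ^ CARD('n)"
      by (simp add: fourier_coeff_eq[OF ct] norm_divide norm_mult norm_power divide_right_mono)
  qed
next
  case (Suc M)
  obtain g' where g': "\<And>z. z \<in> half_space \<Longrightarrow> (g has_derivative g' z) (at z within half_space)"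
    "\<And>v. smooth_on half_space (\<lambda>z. g' z v)"
    using smooth_on_derivative[OF Suc.prems(1)] by metis
  let ?d = "\<lambda>z. g' z (0, axis i 1)"
  have "\<exists>C. \<forall>t\<in>{0..\<tau>}. \<forall>k. \<bar>real_of_int (k $ i)\<bar> ^ M * cmod (fourier_coeff (\<lambda>x. ?d (t, x)) k) \<le> C"
    by (rule Suc.IH[OF g'(2)]) (rule derivative_periodic[OF g'(1) Suc.prems(2)])
  then obtain C where C: "\<And>t k. t \<in> {0..\<tau>} \<Longrightarrow>
      \<bar>real_of_int (k $ i)\<bar> ^ M * cmod (fourier_coeff (\<lambda>x. ?d (t, x)) k) \<le> C" by blast
  show ?case
  proof (intro exI ballI allI)
    fix t k assume t: "t \<in> {0..\<tau>}"
    then have t0: "0 \<le> t" by simp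
    have "fourier_coeff (\<lambda>x. ?d (t, x)) k = \<i> * of_int (k $ i) * fourier_coeff (\<lambda>x. g (t, x)) k"
      by (intro fourier_coeff_partial continuous_on_slice[OF smooth_on_continuous] Suc.prems g' t0 space_derivative)
    then show "\<bar>real_of_int (k $ i)\<bar> ^ Suc M * cmod (fourier_coeff (\<lambda>x. g (t, x)) k) \<le> C"
      using C[OF t, of k] by (simp add: norm_mult mult_ac)
  qed
qed

text \<open>Every coordinate is compared with the largest one. This assembles decay in each single
  coordinate into decay in |k|.\<close>

lemma jap_power_le:
  fixes k :: "int ^ 'n"
  shows "(1 + wt k) ^ M \<le> (1 + real CARD('n)) ^ M * (1 + (\<Sum>i\<in>UNIV. \<bar>real_of_int (k $ i)\<bar> ^ M))"
proof -
  let ?a = "\<lambda>i. \<bar>real_of_int (k $ i)\<bar>"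
  have "Max (range ?a) \<in> range ?a" by (rule Max_in) auto
  then obtain j where j: "Max (range ?a) = ?a j" by (rule imageE)
  have aj: "?a i \<le> ?a j" for i unfolding j[symmetric] by (rule Max_ge) auto
  let ?b = "max 1 (?a j)"
  have "wt k \<le> (\<Sum>i\<in>UNIV. ?a i)"
    using norm_le_l1_cart[of "freq k"] by simp
  also have "\<dots> \<le> (\<Sum>i\<in>(UNIV :: 'n set). ?b)"
    by (rule sum_mono) (rule order_trans[OF aj max.cobounded2])
  finally have "1 + wt k \<le> (1 + real CARD('n)) * ?b" by (simp add: distrib_right)
  then have "(1 + wt k) ^ M \<le> ((1 + real CARD('n)) * ?b) ^ M"
    by (rule power_mono) simp
  also have "\<dots> = (1 + real CARD('n)) ^ M * ?b ^ M" by (rule power_mult_distrib)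
  also have "?b ^ M \<le> 1 + ?a j ^ M"
    by (cases "?a j \<le> 1") (auto simp: max_def)
  also have "?a j ^ M \<le> (\<Sum>i\<in>UNIV. ?a i ^ M)"
    by (rule member_le_sum) auto
  finally show ?thesis by (simp add: mult_left_mono)
qed

lemma rapid_on_fourier_coeff:
  fixes g :: "real \<times> (real ^ 'n) \<Rightarrow> real"
  assumes "smooth_on half_space g" "\<And>t. 0 \<le> t \<Longrightarrow> periodic (\<lambda>x. g (t, x))"
  shows "rapid_on {0..\<tau>} (\<lambda>t. fourier_coeff (\<lambda>x. g (t, x)))"
  unfolding rapid_on_def
proof
  fix M
  let ?f = "\<lambda>t k. cmod (fourier_coeff (\<lambda>x. g (t, x)) k)"
  \<comment> \<open>With exponent 0 the coordinate factor is 1, so the choice of the coordinate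
    (\<open>undefined\<close>) does not matter.\<close>
  have "\<exists>C. \<forall>t\<in>{0..\<tau>}. \<forall>k. ?f t k \<le> C"
    using fourier_coeff_component_decay[OF assms, of \<tau> undefined 0] by simp
  then obtain C0 where C0: "\<And>t k. t \<in> {0..\<tau>} \<Longrightarrow> ?f t k \<le> C0" by blast
  have "\<forall>i. \<exists>C. \<forall>t\<in>{0..\<tau>}. \<forall>k. \<bar>real_of_int (k $ i)\<bar> ^ M * ?f t k \<le> C"
    using fourier_coeff_component_decay[OF assms] by blast
  then obtain C where C: "\<And>i t k. t \<in> {0..\<tau>} \<Longrightarrow> \<bar>real_of_int (k $ i)\<bar> ^ M * ?f t k \<le> C i"
    by metis
  show "\<exists>C. \<forall>t\<in>{0..\<tau>}. \<forall>k. (1 + wt k) ^ M * ?f t k \<le> C"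
  proof (intro exI ballI allI)
    fix t and k :: "int ^ 'n" assume t: "t \<in> {0..\<tau>}"
    have "(1 + wt k) ^ M * ?f t k
        \<le> (1 + real CARD('n)) ^ M * (1 + (\<Sum>i\<in>UNIV. \<bar>real_of_int (k $ i)\<bar> ^ M)) * ?f t k"
      by (rule mult_right_mono[OF jap_power_le]) simp
    also have "\<dots> = (1 + real CARD('n)) ^ M * (?f t k + (\<Sum>i\<in>UNIV. \<bar>real_of_int (k $ i)\<bar> ^ M * ?f t k))"
      by (simp add: distrib_right sum_distrib_right mult.assoc)
    also have "\<dots> \<le> (1 + real CARD('n)) ^ M * (C0 + (\<Sum>i\<in>UNIV. C i))"
      by (intro mult_left_mono add_mono sum_mono C0 C t) simp
    finally show "(1 + wt k) ^ M * ?f t k \<le> (1 + real CARD('n)) ^ M * (C0 + (\<Sum>i\<in>UNIV. C i))" .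
  qed
qed

lemma fourier_coeff_time_derivative:
  fixes g :: "real \<times> (real ^ 'n) \<Rightarrow> real"
  assumes g: "\<And>z. z \<in> half_space \<Longrightarrow> (g has_derivative g' z) (at z within half_space)"
    and g': "continuous_on half_space (\<lambda>z. g' z (1, 0))" and t: "0 \<le> t"
  shows "((\<lambda>t. fourier_coeff (\<lambda>x. g (t, x)) k) has_vector_derivative
    fourier_coeff (\<lambda>x. g' (t, x) (1, 0)) k) (at t within {0..})"
proof -
  have cg: "continuous_on half_space g"
    by (rule has_derivative_continuous_on) (rule g)
  let ?e = "\<lambda>x. cis (- (freq k \<bullet> x))"
  have "((\<lambda>t. integral (cbox (\<chi> i. - pi) (\<chi> i. pi)) (\<lambda>x. of_real (g (t, x)) * ?e x)) has_vector_derivative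
      integral (cbox (\<chi> i. - pi) (\<chi> i. pi)) (\<lambda>x. of_real (g' (t, x) (1, 0)) * ?e x)) (at t within {0..})"
  proof (rule leibniz_rule_vector_derivative)
    show "((\<lambda>t. of_real (g (t, x)) * ?e x) has_vector_derivative of_real (g' (t, x) (1, 0)) * ?e x) (at t within {0..})"
      if "t \<in> {0..}" for t x
      using time_derivative[OF g, of t x] that
      by (intro has_vector_derivative_mult_left has_vector_derivative_of_real) auto
    show "(\<lambda>x. of_real (g (t, x)) * ?e x) integrable_on cbox (\<chi> i. - pi) (\<chi> i. pi)" if "t \<in> {0..}" for t
      by (rule integrable_continuous)
        (intro continuous_intros continuous_on_slice[OF cg], use that in simp)
    have "continuous_on ({0..} \<times> cbox (\<chi> i. - pi) (\<chi> i. pi)) (\<lambda>z. of_real (g' z (1, 0)) * cis (- (freq k \<bullet> snd z)))"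
      by (intro continuous_intros continuous_on_subset[OF g']) auto
    then show "continuous_on ({0..} \<times> cbox (\<chi> i. - pi) (\<chi> i. pi)) (\<lambda>(t, x). of_real (g' (t, x) (1, 0)) * ?e x)"
      by (simp add: split_beta)
  qed (use t in auto)
  then have "((\<lambda>t. integral torus (\<lambda>x. of_real (g (t, x)) * ?e x) / (2 * pi) ^ CARD('n)) has_vector_derivative
      integral torus (\<lambda>x. of_real (g' (t, x) (1, 0)) * ?e x) / (2 * pi) ^ CARD('n)) (at t within {0..})"
    unfolding torus_def by (rule has_vector_derivative_divide)
  then show ?thesis
    unfolding fourier_coeff_eq[OF continuous_on_slice[OF g' t]]
    by (rule has_vector_derivative_transform[rotated 2])
      (use t in \<open>auto simp: fourier_coeff_eq[OF continuous_on_slice[OF cg]]\<close>)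
qed

text \<open>(A1) speaks about smooth functions on the torus, so each time slice of a solution has to
  be recognised as one.\<close>

lemma Ck_on_slice:
  fixes g :: "real \<times> (real ^ 'n) \<Rightarrow> real"
  assumes "Ck_on k half_space g" "0 \<le> t"
  shows "Ck_on k UNIV (\<lambda>x. g (t, x))"
  using assms(1)
proof (induction k arbitrary: g)
  case 0
  then show ?case using continuous_on_slice[OF _ assms(2)] by simp
next
  case (Suc k)
  then obtain g' where g': "\<And>z. z \<in> half_space \<Longrightarrow> (g has_derivative g' z) (at z within half_space)"
    "\<And>v. Ck_on k half_space (\<lambda>z. g' z v)" by auto
  have "((\<lambda>x. g (t, x)) has_derivative (\<lambda>h. g' (t, x) (0, h))) (at x)" for x
    by (rule has_derivative_in_compose2[of half_space g g' "\<lambda>x. (t, x)" UNIV x "\<lambda>h. (0, h)"])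
      (use g' assms(2) in \<open>auto intro!: derivative_eq_intros\<close>)
  with Suc.IH[OF g'(2)] show ?case
    by (auto intro!: exI[of _ "\<lambda>x h. g' (t, x) (0, h)"])
qed

section \<open>Energy estimate for the transport convolution\<close>

lemma has_sum_product_nonneg:
  fixes f g :: "'k \<Rightarrow> real"
  assumes f: "f summable_on UNIV" "\<And>k. 0 \<le> f k" and g: "g summable_on UNIV" "\<And>k. 0 \<le> g k"
  shows "((\<lambda>(k, l). f k * g l) has_sum (infsum f UNIV * infsum g UNIV)) UNIV"
proof -
  have 1: "((\<lambda>l. (\<lambda>(k, l). f k * g l) (k, l)) has_sum (f k * infsum g UNIV)) UNIV" for k
    using has_sum_cmult_right[OF has_sum_infsum[OF g(1)]] by simp
  have 2: "((\<lambda>k. f k * infsum g UNIV) has_sum (infsum f UNIV * infsum g UNIV)) UNIV"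
    using has_sum_cmult_left[OF has_sum_infsum[OF f(1)]] by simp
  have 3: "(\<lambda>(k, l). f k * g l) summable_on (UNIV \<times> UNIV)"
    by (rule summable_on_SigmaI[OF 1]) (use 2 f(2) g(2) in \<open>auto simp: summable_on_def\<close>)
  show ?thesis
    using has_sum_SigmaI[OF 1 2 3] by simp
qed

text \<open>After replacing \<beta> \<gamma> by half the sum of squares both sums factor, because
  (f, g) and (f, h) each enumerate all index pairs exactly once. With \<open>f\<close>,
  \<open>g\<close>, \<open>h\<close> left abstract, the l1 factor can sit at k - l in some estimates
  and at l in others.\<close>

lemma triple_sum_bound:
  fixes \<alpha> \<beta> \<gamma> :: "'k \<Rightarrow> real" and F :: "'z \<Rightarrow> real"
  assumes \<alpha>: "\<alpha> summable_on UNIV" "\<And>k. 0 \<le> \<alpha> k"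
    and \<beta>: "(\<lambda>k. (\<beta> k)\<^sup>2) summable_on UNIV" and \<gamma>: "(\<lambda>k. (\<gamma> k)\<^sup>2) summable_on UNIV"
    and fg: "bij (\<lambda>z. (f z, g z))" and fh: "bij (\<lambda>z. (f z, h z))"
    and F: "\<And>z. 0 \<le> F z" "\<And>z. F z \<le> \<alpha> (f z) * \<beta> (g z) * \<gamma> (h z)"
  shows "F summable_on UNIV"
    and "infsum F UNIV \<le> infsum \<alpha> UNIV * ((\<Sum>\<^sub>\<infinity>k. (\<beta> k)\<^sup>2) + (\<Sum>\<^sub>\<infinity>k. (\<gamma> k)\<^sup>2)) / 2"
proof -
  let ?G = "\<lambda>z. \<alpha> (f z) * (\<beta> (g z))\<^sup>2" and ?H = "\<lambda>z. \<alpha> (f z) * (\<gamma> (h z))\<^sup>2"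
  have G: "(?G has_sum (infsum \<alpha> UNIV * (\<Sum>\<^sub>\<infinity>k. (\<beta> k)\<^sup>2))) UNIV"
    using has_sum_reindex_bij_betw[OF fg, of "\<lambda>(a, b). \<alpha> a * (\<beta> b)\<^sup>2"]
      has_sum_product_nonneg[OF \<alpha> \<beta>] by simp
  have H: "(?H has_sum (infsum \<alpha> UNIV * (\<Sum>\<^sub>\<infinity>k. (\<gamma> k)\<^sup>2))) UNIV"
    using has_sum_reindex_bij_betw[OF fh, of "\<lambda>(a, b). \<alpha> a * (\<gamma> b)\<^sup>2"]
      has_sum_product_nonneg[OF \<alpha> \<gamma>] by simp
  have GH: "((\<lambda>z. (?G z + ?H z) / 2) has_sum
      (infsum \<alpha> UNIV * (\<Sum>\<^sub>\<infinity>k. (\<beta> k)\<^sup>2) + infsum \<alpha> UNIV * (\<Sum>\<^sub>\<infinity>k. (\<gamma> k)\<^sup>2)) / 2) UNIV"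
    by (intro has_sum_divide_const has_sum_add G H)
  have le: "F z \<le> (?G z + ?H z) / 2" for z
  proof -
    have "\<beta> (g z) * \<gamma> (h z) \<le> ((\<beta> (g z))\<^sup>2 + (\<gamma> (h z))\<^sup>2) / 2"
      using sum_squares_bound[of "\<beta> (g z)" "\<gamma> (h z)"] by simp
    then have "\<alpha> (f z) * (\<beta> (g z) * \<gamma> (h z)) \<le> \<alpha> (f z) * (((\<beta> (g z))\<^sup>2 + (\<gamma> (h z))\<^sup>2) / 2)"
      by (rule mult_left_mono) (rule \<alpha>(2))
    with F(2)[of z] show ?thesis by (simp add: algebra_simps)
  qed
  show F': "F summable_on UNIV"
    by (rule summable_on_comparison_test[OF has_sum_imp_summable[OF GH]]) (use le F(1) in auto)
  have "infsum F UNIV \<le> (infsum \<alpha> UNIV * (\<Sum>\<^sub>\<infinity>k. (\<beta> k)\<^sup>2) + infsum \<alpha> UNIV * (\<Sum>\<^sub>\<infinity>k. (\<gamma> k)\<^sup>2)) / 2"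
    by (rule has_sum_mono[OF has_sum_infsum[OF F'] GH]) (rule le)
  then show "infsum F UNIV \<le> infsum \<alpha> UNIV * ((\<Sum>\<^sub>\<infinity>k. (\<beta> k)\<^sup>2) + (\<Sum>\<^sub>\<infinity>k. (\<gamma> k)\<^sup>2)) / 2"
    by (simp add: algebra_simps)
qed

section \<open>Changes of index and weight inequalities\<close>

lemma bij_diff_snd: "bij (\<lambda>z :: 'a::ab_group_add \<times> 'a. (fst z - snd z, snd z))"
  by (rule o_bij[of "\<lambda>z. (fst z + snd z, snd z)"]) (auto simp: fun_eq_iff)

lemma bij_diff_fst: "bij (\<lambda>z :: 'a::ab_group_add \<times> 'a. (fst z - snd z, fst z))"
  by (rule o_bij[of "\<lambda>z. (snd z, snd z - fst z)"]) (auto simp: fun_eq_iff)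

lemma bij_snd_diff: "bij (\<lambda>z :: 'a::ab_group_add \<times> 'a. (snd z, fst z - snd z))"
  by (rule o_bij[of "\<lambda>z. (fst z + snd z, fst z)"]) (auto simp: fun_eq_iff)

lemma bij_snd_fst: "bij (\<lambda>z :: 'a \<times> 'a. (snd z, fst z))"
  by (rule o_bij[of "\<lambda>z. (snd z, fst z)"]) (auto simp: fun_eq_iff)

text \<open>The extra factor b is the gradient in the transport term. If p <= b, then a <= 2 b and
  factoring out a - b trades one power of b for p; if p > b, both powers are at most (2 p)^m. Thus b
  never occurs with exponent m + 1.\<close>

lemma power_diff_commutator_bound:
  fixes a b p :: real
  assumes "0 \<le> a" "0 \<le> b" "\<bar>a - b\<bar> \<le> p" "1 \<le> m"
  shows "\<bar>a ^ m - b ^ m\<bar> * b \<le> real m * 2 ^ m * (p * b ^ m + p ^ m * b)"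
proof (cases "p \<le> b")
  case True
  have a: "a \<le> 2 * b" using True assms by linarith
  have "\<bar>a ^ m - b ^ m\<bar> = \<bar>a - b\<bar> * \<bar>\<Sum>i<m. b ^ (m - Suc i) * a ^ i\<bar>"
    by (simp add: power_diff_sumr2 abs_mult)
  also have "\<bar>\<Sum>i<m. b ^ (m - Suc i) * a ^ i\<bar> \<le> (\<Sum>i<m. (2 * b) ^ (m - 1))"
  proof (rule order_trans[OF sum_abs], rule sum_mono)
    fix i assume i: "i \<in> {..<m}"
    have "\<bar>b ^ (m - Suc i) * a ^ i\<bar> = b ^ (m - Suc i) * a ^ i" using assms by simp
    also have "\<dots> \<le> (2 * b) ^ (m - Suc i) * (2 * b) ^ i"
      using assms a by (intro mult_mono power_mono) auto
    also have "\<dots> = (2 * b) ^ (m - 1)" using i by (simp only: power_add[symmetric]) simp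
    finally show "\<bar>b ^ (m - Suc i) * a ^ i\<bar> \<le> (2 * b) ^ (m - 1)" .
  qed
  finally have "\<bar>a ^ m - b ^ m\<bar> \<le> \<bar>a - b\<bar> * (real m * (2 * b) ^ (m - 1))"
    by (simp add: mult_left_mono)
  also have "\<dots> \<le> p * (real m * (2 * b) ^ (m - 1))"
    using assms by (intro mult_right_mono) auto
  finally have "\<bar>a ^ m - b ^ m\<bar> * b \<le> p * (real m * (2 * b) ^ (m - 1)) * b"
    using assms by (intro mult_right_mono) auto
  also have "\<dots> = real m * 2 ^ (m - 1) * (p * b ^ m)"
    using assms by (cases m) (auto simp: power_mult_distrib)
  also have "\<dots> \<le> real m * 2 ^ m * (p * b ^ m + p ^ m * b)"
    using assms by (intro mult_mono) auto
  finally show ?thesis .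
next
  case False
  have "\<bar>a ^ m - b ^ m\<bar> \<le> max (a ^ m) (b ^ m)"
    using zero_le_power[OF assms(1), of m] zero_le_power[OF assms(2), of m] by linarith
  also have "\<dots> \<le> (2 * p) ^ m"
  proof -
    have "a \<le> 2 * p" "b \<le> 2 * p" using False assms by linarith+
    then show ?thesis using assms by (metis max_def power_mono)
  qed
  finally have "\<bar>a ^ m - b ^ m\<bar> * b \<le> (2 * p) ^ m * b"
    using assms by (intro mult_right_mono) auto
  also have "\<dots> \<le> real m * (2 ^ m * p ^ m * b)"
    using assms False mult_right_mono[of 1 "real m" "2 ^ m * p ^ m * b"] by (simp add: power_mult_distrib)
  also have "\<dots> \<le> real m * 2 ^ m * (p * b ^ m + p ^ m * b)"
    using assms False by (simp add: algebra_simps)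
  finally show ?thesis .
qed

text \<open>Nonzero frequencies have weight at least 1, so each summand of the triangle inequality
  is at most the product.\<close>

lemma wt_mult_bound:
  assumes "l \<noteq> 0" "k \<noteq> l"
  shows "wt k \<le> 2 * wt (k - l) * wt l"
proof -
  have "wt k \<le> wt (k - l) + wt l" using wt_diff_le[of k l] by linarith
  moreover have "wt (k - l) \<le> wt (k - l) * wt l" "wt l \<le> wt (k - l) * wt l"
    using wt_ge_1[of l] wt_ge_1[of "k - l"] assms by (auto simp: mult_le_cancel_left1 mult_le_cancel_right1)
  ultimately show ?thesis by linarith
qed

text \<open>Fourier form of u[x] . grad y: \<open>x\<close> generates the velocity, \<open>y\<close>
  is transported. In \<open>q p l\<close> the first argument is the frequency of the velocity and
  the second that of the differentiated factor.\<close>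

definition conv :: "(int ^ 'n \<Rightarrow> int ^ 'n \<Rightarrow> complex) \<Rightarrow> (int ^ 'n \<Rightarrow> complex) \<Rightarrow> (int ^ 'n \<Rightarrow> complex)
    \<Rightarrow> int ^ 'n \<Rightarrow> complex" where
  "conv q x y k = (\<Sum>\<^sub>\<infinity>l. x (k - l) * q (k - l) l * y l)"

lemma rapid_wt_square_summable:
  assumes "rapid c"
  shows "(\<lambda>k. (wt k ^ m * norm (c k))\<^sup>2) summable_on UNIV"
proof -
  from assms[unfolded rapid_alt, rule_format, of m] obtain C where C: "\<And>k. (1 + wt k) ^ m * norm (c k) \<le> C"
    by blast
  have "(\<lambda>k. C * ((1 + wt k) ^ m * norm (c k))) summable_on UNIV"
    by (intro summable_on_cmult_right rapid_summable assms)
  then show ?thesis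
  proof (rule summable_on_comparison_test)
    fix k
    have le: "wt k ^ m * norm (c k) \<le> (1 + wt k) ^ m * norm (c k)"
      by (intro mult_right_mono power_mono) auto
    show "(wt k ^ m * norm (c k))\<^sup>2 \<le> C * ((1 + wt k) ^ m * norm (c k))"
      unfolding power2_eq_square
      by (rule mult_mono[OF order_trans[OF le C] le]) (use order_trans[OF _ C] in auto)
  qed auto
qed

lemma rapid_wt_summable:
  assumes "rapid c"
  shows "(\<lambda>k. wt k ^ m * norm (c k)) summable_on UNIV"
  by (rule summable_on_comparison_test[OF rapid_summable[OF assms, of m]])
    (auto intro!: mult_right_mono power_mono)

section \<open>Energy bounds for an abstract transport symbol\<close>

context
  fixes q :: "int ^ 'n \<Rightarrow> int ^ 'n \<Rightarrow> complex" and Q :: real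
  assumes q_bound: "\<And>p l. cmod (q p l) \<le> Q * wt l"
    and q_add: "\<And>p l l'. q p (l + l') = q p l + q p l'"
    and q_cnj: "\<And>p l. cnj (q p l) = q (- p) (- l)"
begin

text \<open>The all-ones vector is a nonzero frequency; there \<open>q_bound\<close> forces the
  sign.\<close>

lemma Q_nonneg: "0 \<le> Q"
proof -
  have "0 \<le> Q * wt (1 :: int ^ 'n)" using order_trans[OF norm_ge_zero q_bound] .
  moreover have "(1 :: int ^ 'n) \<noteq> 0" by (simp add: vec_eq_iff)
  then have "0 < wt (1 :: int ^ 'n)" by (rule less_le_trans[OF zero_less_one wt_ge_1])
  ultimately show ?thesis by (simp add: zero_le_mult_iff)
qed

text \<open>Absolute summability over pairs justifies summing in either order and exchanging k with
  l. The velocity factor is taken in l1 and the other two in l2, the gradient adding one weight to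
  \<open>y\<close>.\<close>

lemma conv_pair_sum:
  assumes x: "rapid x" and y: "rapid y" and c: "rapid c"
  shows "(\<lambda>(k, l). of_real (wt k ^ r * wt l ^ s) * cnj (c k) * (x (k - l) * q (k - l) l * y l)) summable_on UNIV"
proof (rule abs_summable_summable, rule triple_sum_bound(1))
  show "(\<lambda>k. norm (x k)) summable_on UNIV" by (rule rapid_abs_summable[OF x])
  show "(\<lambda>k. (wt k ^ Suc s * norm (Q *\<^sub>R y k))\<^sup>2) summable_on UNIV"
    by (intro rapid_wt_square_summable rapid_bound[OF y, of _ "\<bar>Q\<bar>" 0]) auto
  show "(\<lambda>k. (wt k ^ r * norm (c k))\<^sup>2) summable_on UNIV"
    by (rule rapid_wt_square_summable[OF c])
  show "norm (case z of (k, l) \<Rightarrow> of_real (wt k ^ r * wt l ^ s) * cnj (c k) * (x (k - l) * q (k - l) l * y l))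
    \<le> norm (x (fst z - snd z)) * (wt (snd z) ^ Suc s * norm (Q *\<^sub>R y (snd z)))
      * (wt (fst z) ^ r * norm (c (fst z)))" for z
  proof -
    obtain k l where z: "z = (k, l)" by fastforce
    have "cmod (q (k - l) l) * (wt k ^ r * wt l ^ s * cmod (c k) * cmod (x (k - l)) * cmod (y l))
        \<le> (Q * wt l) * (wt k ^ r * wt l ^ s * cmod (c k) * cmod (x (k - l)) * cmod (y l))"
      by (intro mult_right_mono q_bound) auto
    then show ?thesis using Q_nonneg by (simp add: z norm_mult norm_power mult_ac)
  qed
qed (auto simp: bij_diff_snd bij_diff_fst)

lemma conv_energy:
  assumes x: "rapid x" and y: "rapid y" and c: "rapid c"
  shows "((\<lambda>k. of_real (wt k ^ r) * cnj (c k) * conv q x y k) has_sum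
    (\<Sum>\<^sub>\<infinity>(k, l). of_real (wt k ^ r) * cnj (c k) * (x (k - l) * q (k - l) l * y l))) UNIV"
proof -
  let ?P = "\<lambda>k l. of_real (wt k ^ r) * cnj (c k) * (x (k - l) * q (k - l) l * y l)"
  have s: "(\<lambda>(k, l). ?P k l) summable_on (UNIV \<times> UNIV)"
    using conv_pair_sum[OF x y c, of r 0] by simp
  have "infsum (?P k) UNIV = of_real (wt k ^ r) * cnj (c k) * conv q x y k" for k
    unfolding conv_def by (rule infsum_cmult_right')
  moreover have "((\<lambda>k. infsum (?P k) UNIV) has_sum infsum (\<lambda>(k, l). ?P k l) UNIV) UNIV"
    using has_sum_infsum[OF summable_on_Sigma_banach[OF s]]
    unfolding infsum_Sigma'_banach[OF s] UNIV_Times_UNIV .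
  ultimately show ?thesis by (simp only:)
qed

text \<open>Antisymmetry under \<open>(k, l) \<mapsto> (l, k)\<close>: the divergence-free condition \<open>q p p * x p = 0\<close>
  turns \<open>q (k - l) l\<close> into \<open>q (k - l) k\<close>.\<close>

lemma conv_cancel:
  assumes x_cnj: "\<And>k. x (- k) = cnj (x k)" and div: "\<And>p. q p p * x p = 0"
  shows "Re (\<Sum>\<^sub>\<infinity>(k, l). of_real (wt k ^ m * wt l ^ m) * cnj (c k) * (x (k - l) * q (k - l) l * c l)) = 0"
proof -
  let ?G = "\<lambda>(k, l). of_real (wt k ^ m * wt l ^ m) * cnj (c k) * (x (k - l) * q (k - l) l * c l)"
  have swap: "?G (l, k) = - cnj (?G (k, l))" for k l
  proof -
    have q0: "q p 0 = 0" for p using q_add[of p 0 0] by simp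
    have q_neg: "q p (- l) = - q p l" for p l
      using q_add[of p "- l" l] q0[of p] by (simp only: eq_neg_iff_add_eq_0) simp
    have 1: "x (k - l) * q (k - l) l = x (k - l) * q (k - l) k"
      using div[of "k - l"] q_add[of "k - l" "k - l" l] by (simp add: algebra_simps)
    have 2: "cnj (x (k - l) * q (k - l) k) = - (x (l - k) * q (l - k) k)"
      using x_cnj[of "k - l"] by (simp add: q_cnj q_neg)
    have 3: "x (l - k) * q (l - k) k = - cnj (x (k - l) * q (k - l) l)"
      unfolding 1 2 by simp
    have 4: "of_real r * cnj u * (A * v) = - cnj (of_real r * cnj v * (B * u))"
      if "A = - cnj B" for r and u v A B :: complex
      using that by simp
    show ?thesis
      unfolding case_prod_conv mult.commute[of "wt l ^ m" "wt k ^ m"] by (rule 4[OF 3])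
  qed
  have "infsum ?G UNIV = infsum (\<lambda>z. ?G (snd z, fst z)) UNIV"
    by (rule infsum_reindex_bij_betw[symmetric]) (rule bij_snd_fst)
  also have "\<dots> = infsum (\<lambda>z. - cnj (?G z)) UNIV"
    by (rule infsum_cong) (simp only: swap prod.collapse)
  also have "\<dots> = - cnj (infsum ?G UNIV)"
    by (simp add: infsum_uminus)
  finally have "Re (infsum ?G UNIV) = Re (- cnj (infsum ?G UNIV))" by simp
  then show ?thesis by simp
qed

text \<open>Subtract the sum with the symmetric weight |k|^m |l|^m, whose real part vanishes by
  \<open>conv_cancel\<close>: the weight |k|^(2m) becomes |k|^m (|k|^m - |l|^m), and the last factor
  |l| comes from \<open>q_bound\<close>. The majorant \<open>F\<close> is left open because smooth
  and rough velocities distribute the weights differently.\<close>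

lemma conv_commutator:
  assumes x: "rapid x" "\<And>k. x (- k) = cnj (x k)" "\<And>p. q p p * x p = 0" and c: "rapid c"
    and F: "F summable_on UNIV"
      "\<And>k l. Q * (wt k ^ m * (\<bar>wt k ^ m - wt l ^ m\<bar> * wt l) * cmod (c k) * cmod (x (k - l)) * cmod (c l)) \<le> F (k, l)"
  shows "\<bar>Re (\<Sum>\<^sub>\<infinity>k. of_real (wt k ^ (2 * m)) * cnj (c k) * conv q x c k)\<bar> \<le> infsum F UNIV"
proof -
  let ?P = "\<lambda>r s (k, l). of_real (wt k ^ r * wt l ^ s) * cnj (c k) * (x (k - l) * q (k - l) l * c l)"
  have "((\<lambda>z. ?P (2 * m) 0 z - ?P m m z) has_sum (infsum (?P (2 * m) 0) UNIV - infsum (?P m m) UNIV)) UNIV"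
    by (intro has_sum_diff has_sum_infsum conv_pair_sum x c)
  then have "norm (infsum (?P (2 * m) 0) UNIV - infsum (?P m m) UNIV) \<le> infsum F UNIV"
  proof (rule norm_infsum_le)
    show "(F has_sum infsum F UNIV) UNIV" using F(1) by simp
    show "norm (?P (2 * m) 0 z - ?P m m z) \<le> F z" for z
    proof -
      obtain k l where z: "z = (k, l)" by fastforce
      have sq: "(of_real (wt k) :: complex) ^ (m * 2) = of_real (wt k) ^ m * of_real (wt k) ^ m"
        by (simp only: mult_2_right power_add)
      have "?P (2 * m) 0 z - ?P m m z =
          of_real (wt k ^ m * (wt k ^ m - wt l ^ m)) * cnj (c k) * (x (k - l) * q (k - l) l * c l)"
        by (simp add: z sq right_diff_distrib left_diff_distrib mult_ac)
      also have "norm \<dots> = cmod (q (k - l) l)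
          * (wt k ^ m * \<bar>wt k ^ m - wt l ^ m\<bar> * cmod (c k) * cmod (x (k - l)) * cmod (c l))"
        by (simp add: norm_mult abs_mult norm_power del: of_real_diff of_real_power of_real_mult)
      also have "\<dots> \<le> (Q * wt l)
          * (wt k ^ m * \<bar>wt k ^ m - wt l ^ m\<bar> * cmod (c k) * cmod (x (k - l)) * cmod (c l))"
        by (intro mult_right_mono q_bound) auto
      also have "\<dots> \<le> F z" using F(2)[of k l] by (simp add: z mult_ac)
      finally show ?thesis .
    qed
  qed
  moreover have "Re (infsum (?P m m) UNIV) = 0" by (rule conv_cancel[OF x(2,3)])
  moreover have "(\<Sum>\<^sub>\<infinity>k. of_real (wt k ^ (2 * m)) * cnj (c k) * conv q x c k) = infsum (?P (2 * m) 0) UNIV"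
    using infsumI[OF conv_energy[OF x(1) c c]] by simp
  ultimately show ?thesis
    using abs_Re_le_cmod[of "infsum (?P (2 * m) 0) UNIV - infsum (?P m m) UNIV"] by simp
qed

text \<open>Both terms of the commutator bound are charged to the smooth velocity: \<open>b\<close>
  takes m + 1 weights in l1, and each copy of \<open>c\<close> keeps exactly m.\<close>

lemma conv_energy_smooth_left:
  assumes m: "1 \<le> m"
    and b: "rapid b" "\<And>k. b (- k) = cnj (b k)" "\<And>p. q p p * b p = 0" "b 0 = 0"
    and c: "rapid c" "c 0 = 0"
  shows "\<bar>Re (\<Sum>\<^sub>\<infinity>k. of_real (wt k ^ (2 * m)) * cnj (c k) * conv q b c k)\<bar>
    \<le> 2 * Q * real m * 2 ^ m * (\<Sum>\<^sub>\<infinity>k. wt k ^ Suc m * cmod (b k)) * (\<Sum>\<^sub>\<infinity>k. (wt k ^ m * cmod (c k))\<^sup>2)"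
proof -
  let ?C = "2 * Q * real m * 2 ^ m"
  let ?F = "\<lambda>(k, l). Q * (wt k ^ m * (\<bar>wt k ^ m - wt l ^ m\<bar> * wt l) * cmod (c k) * cmod (b (k - l)) * cmod (c l))"
  have F: "?F z \<le> ?C * (wt (fst z - snd z) ^ Suc m * cmod (b (fst z - snd z)))
      * (wt (snd z) ^ m * cmod (c (snd z))) * (wt (fst z) ^ m * cmod (c (fst z)))" for z
  proof -
    obtain k l where z: "z = (k, l)" by fastforce
    show ?thesis
    \<comment> \<open>The zero mode of \<open>b\<close> (k = l) or of \<open>c\<close> (l = 0) makes
      the left side vanish. Elsewhere both weights are at least 1, so the powers of |k - l| and |l|
      may be raised to m + 1 and m.\<close>
    proof (cases "k = l \<or> l = 0")
      case True
      then show ?thesis using b(4) c(2) by (auto simp: z)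
    next
      case False
      let ?p = "wt (k - l)" and ?l = "wt l"
      have 1: "1 \<le> ?p" "1 \<le> ?l" using False by (auto intro!: wt_ge_1)
      have "\<bar>wt k ^ m - ?l ^ m\<bar> * ?l \<le> real m * 2 ^ m * (?p * ?l ^ m + ?p ^ m * ?l)"
        by (rule power_diff_commutator_bound) (use m wt_diff_le in auto)
      also have "\<dots> \<le> real m * 2 ^ m * (?p ^ Suc m * ?l ^ m + ?p ^ Suc m * ?l ^ m)"
        using 1 m by (intro mult_left_mono add_mono mult_mono power_increasing self_le_power) auto
      finally have "\<bar>wt k ^ m - ?l ^ m\<bar> * ?l \<le> 2 * real m * 2 ^ m * ?p ^ Suc m * ?l ^ m"
        by (simp add: mult_ac)
      then have "(\<bar>wt k ^ m - ?l ^ m\<bar> * ?l) * (Q * wt k ^ m * cmod (c k) * cmod (b (k - l)) * cmod (c l))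
          \<le> (2 * real m * 2 ^ m * ?p ^ Suc m * ?l ^ m) * (Q * wt k ^ m * cmod (c k) * cmod (b (k - l)) * cmod (c l))"
        by (rule mult_right_mono) (simp add: Q_nonneg)
      then show ?thesis by (simp add: z mult_ac)
    qed
  qed
  have \<alpha>: "(\<lambda>k. ?C * (wt k ^ Suc m * cmod (b k))) summable_on UNIV"
    by (intro summable_on_cmult_right rapid_wt_summable b)
  note T = triple_sum_bound[of "\<lambda>k. ?C * (wt k ^ Suc m * cmod (b k))" "\<lambda>k. wt k ^ m * cmod (c k)"
      "\<lambda>k. wt k ^ m * cmod (c k)", OF \<alpha> _ _ _ bij_diff_snd bij_diff_fst _ F]
  have "?F summable_on UNIV"
    by (rule T(1)) (auto intro!: rapid_wt_square_summable c simp: Q_nonneg)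
  then have "\<bar>Re (\<Sum>\<^sub>\<infinity>k. of_real (wt k ^ (2 * m)) * cnj (c k) * conv q b c k)\<bar> \<le> infsum ?F UNIV"
    by (rule conv_commutator[OF b(1-3) c(1)]) simp
  also have "\<dots> \<le> (\<Sum>\<^sub>\<infinity>k. ?C * (wt k ^ Suc m * cmod (b k)))
      * ((\<Sum>\<^sub>\<infinity>k. (wt k ^ m * cmod (c k))\<^sup>2) + (\<Sum>\<^sub>\<infinity>k. (wt k ^ m * cmod (c k))\<^sup>2)) / 2"
    by (rule T(2)) (auto intro!: rapid_wt_square_summable c simp: Q_nonneg)
  finally show ?thesis by (simp only: infsum_cmult_right') simp
qed

text \<open>There is no antisymmetry here, but the gradient falls on the smooth \<open>b\<close>.
  One of the two factors |k|^m is split as (2 |k - l| |l|)^m, and the l1 factor of the triple sum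
  sits at l.\<close>

lemma conv_energy_smooth_right:
  assumes b: "rapid b" "b 0 = 0" and c: "rapid c" "c 0 = 0"
  shows "\<bar>Re (\<Sum>\<^sub>\<infinity>k. of_real (wt k ^ (2 * m)) * cnj (c k) * conv q c b k)\<bar>
    \<le> Q * 2 ^ m * (\<Sum>\<^sub>\<infinity>k. wt k ^ Suc m * cmod (b k)) * (\<Sum>\<^sub>\<infinity>k. (wt k ^ m * cmod (c k))\<^sup>2)"
proof -
  let ?C = "Q * 2 ^ m"
  let ?P = "\<lambda>(k, l). of_real (wt k ^ (2 * m)) * cnj (c k) * (c (k - l) * q (k - l) l * b l)"
  have F: "norm (?P z) \<le> ?C * (wt (snd z) ^ Suc m * cmod (b (snd z)))
      * (wt (fst z - snd z) ^ m * cmod (c (fst z - snd z))) * (wt (fst z) ^ m * cmod (c (fst z)))" for z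
  proof -
    obtain k l where z: "z = (k, l)" by fastforce
    show ?thesis
    proof (cases "k = l \<or> l = 0")
      case True
      then show ?thesis using b(2) c(2) by (auto simp: z)
    next
      case False
      have "wt k ^ m \<le> (2 * wt (k - l) * wt l) ^ m"
        by (rule power_mono) (use wt_mult_bound[of l k] False in auto)
      then have "wt k ^ m * cmod (q (k - l) l) \<le> (2 * wt (k - l) * wt l) ^ m * (Q * wt l)"
        by (intro mult_mono q_bound) auto
      then have "(wt k ^ m * cmod (q (k - l) l)) * (wt k ^ m * cmod (c k) * cmod (c (k - l)) * cmod (b l))
          \<le> ((2 * wt (k - l) * wt l) ^ m * (Q * wt l)) * (wt k ^ m * cmod (c k) * cmod (c (k - l)) * cmod (b l))"
        by (rule mult_right_mono) simp
      moreover have "wt k ^ (m * 2) = wt k ^ m * wt k ^ m" by (simp only: mult_2_right power_add)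
      ultimately show ?thesis
        by (simp add: z norm_mult norm_power power_mult_distrib mult_ac)
    qed
  qed
  have \<alpha>: "(\<lambda>k. ?C * (wt k ^ Suc m * cmod (b k))) summable_on UNIV"
    by (intro summable_on_cmult_right rapid_wt_summable b)
  note T = triple_sum_bound[of "\<lambda>k. ?C * (wt k ^ Suc m * cmod (b k))" "\<lambda>k. wt k ^ m * cmod (c k)"
      "\<lambda>k. wt k ^ m * cmod (c k)", OF \<alpha> _ _ _ bij_snd_diff bij_snd_fst _ F]
  have s: "(\<lambda>z. norm (?P z)) summable_on UNIV"
    by (rule T(1)) (auto intro!: rapid_wt_square_summable c simp: Q_nonneg)
  have "\<bar>Re (infsum ?P UNIV)\<bar> \<le> (\<Sum>\<^sub>\<infinity>z. norm (?P z))"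
    by (rule order_trans[OF abs_Re_le_cmod norm_infsum_bound[OF s]])
  also have "\<dots> \<le> (\<Sum>\<^sub>\<infinity>k. ?C * (wt k ^ Suc m * cmod (b k)))
      * ((\<Sum>\<^sub>\<infinity>k. (wt k ^ m * cmod (c k))\<^sup>2) + (\<Sum>\<^sub>\<infinity>k. (wt k ^ m * cmod (c k))\<^sup>2)) / 2"
    by (rule T(2)) (auto intro!: rapid_wt_square_summable c simp: Q_nonneg)
  also have "infsum ?P UNIV = (\<Sum>\<^sub>\<infinity>k. of_real (wt k ^ (2 * m)) * cnj (c k) * conv q c b k)"
    by (rule infsumI[OF conv_energy[OF c(1) b(1) c(1)], symmetric])
  finally show ?thesis by (simp only: infsum_cmult_right') simp
qed

text \<open>Charging both commutator terms to the velocity would put m + 1 weights on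
  \<open>c\<close>, more than the energy controls. Instead the term |k - l| |l|^m has its l1 factor
  at k - l and the term |k - l|^m |l| has it at l, so that factor carries a single weight.\<close>

lemma conv_energy_self:
  assumes m: "1 \<le> m"
    and c: "rapid c" "\<And>k. c (- k) = cnj (c k)" "\<And>p. q p p * c p = 0"
  shows "\<bar>Re (\<Sum>\<^sub>\<infinity>k. of_real (wt k ^ (2 * m)) * cnj (c k) * conv q c c k)\<bar>
    \<le> 2 * Q * real m * 2 ^ m * (\<Sum>\<^sub>\<infinity>k. wt k * cmod (c k)) * (\<Sum>\<^sub>\<infinity>k. (wt k ^ m * cmod (c k))\<^sup>2)"
proof -
  let ?C = "Q * real m * 2 ^ m" and ?c = "\<lambda>k. wt k ^ m * cmod (c k)"
  let ?F1 = "\<lambda>z. ?C * (wt (fst z - snd z) * cmod (c (fst z - snd z))) * ?c (snd z) * ?c (fst z)"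
  let ?F2 = "\<lambda>z. ?C * (wt (snd z) * cmod (c (snd z))) * ?c (fst z - snd z) * ?c (fst z)"
  have \<alpha>: "(\<lambda>k. ?C * (wt k * cmod (c k))) summable_on UNIV"
    using rapid_wt_summable[OF c(1), of 1] by (intro summable_on_cmult_right) simp
  note T1 = triple_sum_bound[of "\<lambda>k. ?C * (wt k * cmod (c k))" ?c ?c, OF \<alpha> _ _ _ bij_diff_snd bij_diff_fst]
  note T2 = triple_sum_bound[of "\<lambda>k. ?C * (wt k * cmod (c k))" ?c ?c, OF \<alpha> _ _ _ bij_snd_diff bij_snd_fst]
  let ?B = "(\<Sum>\<^sub>\<infinity>k. ?C * (wt k * cmod (c k))) * ((\<Sum>\<^sub>\<infinity>k. (?c k)\<^sup>2) + (\<Sum>\<^sub>\<infinity>k. (?c k)\<^sup>2)) / 2"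
  have F1: "?F1 summable_on UNIV" "infsum ?F1 UNIV \<le> ?B"
    by (rule T1; auto intro!: rapid_wt_square_summable c simp: Q_nonneg)+
  have F2: "?F2 summable_on UNIV" "infsum ?F2 UNIV \<le> ?B"
    by (rule T2; auto intro!: rapid_wt_square_summable c simp: Q_nonneg)+
  have "\<bar>Re (\<Sum>\<^sub>\<infinity>k. of_real (wt k ^ (2 * m)) * cnj (c k) * conv q c c k)\<bar> \<le> (\<Sum>\<^sub>\<infinity>z. ?F1 z + ?F2 z)"
  proof (rule conv_commutator[OF c c(1) summable_on_add[OF F1(1) F2(1)]])
    fix k l :: "int ^ 'n"
    let ?p = "wt (k - l)" and ?l = "wt l"
    have "\<bar>wt k ^ m - ?l ^ m\<bar> * ?l \<le> real m * 2 ^ m * (?p * ?l ^ m + ?p ^ m * ?l)"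
      by (rule power_diff_commutator_bound) (use m wt_diff_le in auto)
    then have "(\<bar>wt k ^ m - ?l ^ m\<bar> * ?l) * (Q * wt k ^ m * cmod (c k) * cmod (c (k - l)) * cmod (c l))
        \<le> (real m * 2 ^ m * (?p * ?l ^ m + ?p ^ m * ?l)) * (Q * wt k ^ m * cmod (c k) * cmod (c (k - l)) * cmod (c l))"
      by (rule mult_right_mono) (simp add: Q_nonneg)
    then show "Q * (wt k ^ m * (\<bar>wt k ^ m - wt l ^ m\<bar> * wt l) * cmod (c k) * cmod (c (k - l)) * cmod (c l))
        \<le> ?F1 (k, l) + ?F2 (k, l)"
      by (simp add: algebra_simps)
  qed
  also have "\<dots> = infsum ?F1 UNIV + infsum ?F2 UNIV"
    by (rule infsum_add[OF F1(1) F2(1)])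
  also have "\<dots> \<le> ?B + ?B"
    by (rule add_mono[OF F1(2) F2(2)])
  finally show ?thesis by (simp only: infsum_cmult_right') simp
qed

text \<open>A statement at a fixed time: \<open>c'\<close> stands for the time derivative of the
  difference. The multiples of |c_k|^2 coming from damping and dissipation are nonpositive and are
  dropped; the damping of \<open>b\<close> survives as a forcing proportional to
  \<open>lam\<close>.\<close>

lemma energy_inequality:
  fixes lam :: real
  assumes m: "1 \<le> m"
    and b: "rapid b" "\<And>k. b (- k) = cnj (b k)" "\<And>p. q p p * b p = 0" "b 0 = 0"
    and c: "rapid c" "\<And>k. c (- k) = cnj (c k)" "\<And>p. q p p * c p = 0" "c 0 = 0"
    and c': "rapid c'" "\<And>k. c' k = - (conv q b c k + conv q c b k + conv q c c k)
      - of_real (lam * (1 + wt k)) * (b k + c k) - of_real (g k) * c k"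
    and nn: "0 \<le> lam" "\<And>k. 0 \<le> g k"
  defines "E \<equiv> \<Sum>\<^sub>\<infinity>k. (wt k ^ m * cmod (c k))\<^sup>2"
  shows "(\<Sum>\<^sub>\<infinity>k. wt k ^ (2 * m) * Re (cnj (c k) * c' k))
    \<le> Q * (3 * real m * 2 ^ m) * (\<Sum>\<^sub>\<infinity>k. wt k ^ Suc m * cmod (b k)) * E
      + 2 * Q * real m * 2 ^ m * (\<Sum>\<^sub>\<infinity>k. wt k * cmod (c k)) * E
      + lam * (E + (\<Sum>\<^sub>\<infinity>k. ((1 + wt k) ^ Suc m * cmod (b k))\<^sup>2)) / 2"
proof -
  let ?w = "\<lambda>k. of_real (wt k ^ (2 * m)) * cnj (c k) :: complex"
  let ?N = "\<lambda>x y. \<Sum>\<^sub>\<infinity>k. ?w k * conv q x y k"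
  have Re_scale: "Re (of_real r * z) = r * Re z" for r z by simp
  \<comment> \<open>Young's inequality for the cross term of \<open>b\<close> and \<open>c\<close>
    in the damping; the factor 1 + |k| goes to \<open>b\<close>, hence the exponent
    \<open>Suc m\<close>.\<close>
  let ?L = "\<lambda>k. lam * ((wt k ^ m * cmod (c k))\<^sup>2 + ((1 + wt k) ^ Suc m * cmod (b k))\<^sup>2) / 2"
  have N: "((\<lambda>k. Re (?w k * conv q x y k)) has_sum Re (?N x y)) UNIV" if "rapid x" "rapid y" for x y
    using has_sum_Re[OF conv_energy[OF that c(1), of "2 * m"]]
    by (simp only: infsumI[OF conv_energy[OF that c(1), of "2 * m"]])
  have b2: "(\<lambda>k. ((1 + wt k) ^ Suc m * cmod (b k))\<^sup>2) summable_on UNIV"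
    using rapid_wt_square_summable[OF rapid_bound[OF b(1), of "\<lambda>k. (1 + wt k) ^ Suc m *\<^sub>R b k" 1 "Suc m"], of 0]
    by simp
  have L: "(?L has_sum (lam * (E + (\<Sum>\<^sub>\<infinity>k. ((1 + wt k) ^ Suc m * cmod (b k))\<^sup>2)) / 2)) UNIV"
    unfolding E_def
    by (intro has_sum_divide_const has_sum_cmult_right has_sum_add has_sum_infsum
      rapid_wt_square_summable c(1) b2)
  have R: "((\<lambda>k. - (Re (?w k * conv q b c k) + Re (?w k * conv q c b k) + Re (?w k * conv q c c k)) + ?L k)
    has_sum - (Re (?N b c) + Re (?N c b) + Re (?N c c))
      + lam * (E + (\<Sum>\<^sub>\<infinity>k. ((1 + wt k) ^ Suc m * cmod (b k))\<^sup>2)) / 2) UNIV"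
    by (intro has_sum_add has_sum_uminusI N L b(1) c(1))
  have s: "(\<lambda>k. wt k ^ (2 * m) * Re (cnj (c k) * c' k)) summable_on UNIV"
    proof -
    obtain K where K: "\<And>k. cmod (c k) \<le> K"
      using c(1)[unfolded rapid_alt, rule_format, of 0] by auto
    have "(\<lambda>k. K * (wt k ^ (2 * m) * cmod (c' k))) summable_on UNIV"
      by (intro summable_on_cmult_right rapid_wt_summable c')
    then have "(\<lambda>k. norm (wt k ^ (2 * m) * Re (cnj (c k) * c' k))) summable_on UNIV"
    proof (rule Infinite_Sum.abs_summable_on_comparison_test')
      fix k
      have "\<bar>Re (cnj (c k) * c' k)\<bar> \<le> cmod (c k) * cmod (c' k)"
        using abs_Re_le_cmod[of "cnj (c k) * c' k"] by (simp add: norm_mult)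
      also have "\<dots> \<le> K * cmod (c' k)"
        by (rule mult_right_mono[OF K]) simp
      finally have "wt k ^ (2 * m) * \<bar>Re (cnj (c k) * c' k)\<bar> \<le> wt k ^ (2 * m) * (K * cmod (c' k))"
        by (rule mult_left_mono) simp
      then show "norm (wt k ^ (2 * m) * Re (cnj (c k) * c' k)) \<le> K * (wt k ^ (2 * m) * cmod (c' k))"
        by (simp only: real_norm_def abs_mult power_abs abs_norm_cancel mult.left_commute)
    qed
    then show ?thesis by (rule abs_summable_summable)
  qed
  have "(\<Sum>\<^sub>\<infinity>k. wt k ^ (2 * m) * Re (cnj (c k) * c' k))
    \<le> - (Re (?N b c) + Re (?N c b) + Re (?N c c))
      + lam * (E + (\<Sum>\<^sub>\<infinity>k. ((1 + wt k) ^ Suc m * cmod (b k))\<^sup>2)) / 2"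
  proof (rule has_sum_mono[OF has_sum_infsum[OF s] R])
    fix k
    have "Re (cnj (c k) * c' k) = - Re (cnj (c k) * (conv q b c k + conv q c b k + conv q c c k))
        - lam * (1 + wt k) * Re (cnj (c k) * b k) - (lam * (1 + wt k) + g k) * (cmod (c k))\<^sup>2"
      proof -
      have "cnj (c k) * c' k = - (cnj (c k) * (conv q b c k + conv q c b k + conv q c c k))
          - of_real (lam * (1 + wt k)) * (cnj (c k) * b k) - of_real (lam * (1 + wt k) + g k) * (c k * cnj (c k))"
        unfolding c'(2) by (simp add: algebra_simps)
      also have "c k * cnj (c k) = of_real ((cmod (c k))\<^sup>2)"
        using complex_norm_square[of "c k"] by simp
      finally show ?thesis
        by (simp only: minus_complex.sel uminus_complex.sel Re_complex_of_real Re_scale)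
    qed
    also have "\<dots> \<le> - Re (cnj (c k) * (conv q b c k + conv q c b k + conv q c c k))
        + lam * (1 + wt k) * (cmod (c k) * cmod (b k))"
      proof -
      have "- Re (cnj (c k) * b k) \<le> cmod (c k) * cmod (b k)"
        using abs_Re_le_cmod[of "cnj (c k) * b k"] by (simp add: norm_mult)
      then have "lam * (1 + wt k) * - Re (cnj (c k) * b k) \<le> lam * (1 + wt k) * (cmod (c k) * cmod (b k))"
        by (rule mult_left_mono) (simp add: nn)
      moreover have "0 \<le> (lam * (1 + wt k) + g k) * (cmod (c k))\<^sup>2"
        using nn by simp
      ultimately show ?thesis unfolding mult_minus_right by linarith
    qed
    finally have "wt k ^ (2 * m) * Re (cnj (c k) * c' k) \<le>
       wt k ^ (2 * m) * (- Re (cnj (c k) * (conv q b c k + conv q c b k + conv q c c k))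
        + lam * (1 + wt k) * (cmod (c k) * cmod (b k)))"
      by (rule mult_left_mono) simp
    moreover have "wt k ^ (2 * m) * (lam * (1 + wt k) * (cmod (c k) * cmod (b k))) \<le> ?L k"
      proof -
      let ?x = "wt k ^ m * cmod (c k)" and ?y = "(1 + wt k) ^ Suc m * cmod (b k)"
      have "wt k ^ m * (1 + wt k) \<le> (1 + wt k) ^ m * (1 + wt k)"
        by (intro mult_right_mono power_mono) auto
      then have "?x * (wt k ^ m * (1 + wt k) * cmod (b k)) \<le> ?x * ?y"
        by (intro mult_left_mono mult_right_mono) (auto simp: mult.commute)
      also have "\<dots> \<le> (?x\<^sup>2 + ?y\<^sup>2) / 2"
        using sum_squares_bound[of ?x ?y] by simp
      finally have "lam * (?x * (wt k ^ m * (1 + wt k) * cmod (b k))) \<le> lam * ((?x\<^sup>2 + ?y\<^sup>2) / 2)"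
        by (rule mult_left_mono) (rule nn)
      moreover have "wt k ^ (2 * m) = wt k ^ m * wt k ^ m"
        by (simp only: mult_2 power_add)
      ultimately show ?thesis
        by (simp only: mult_ac times_divide_eq_right)
    qed
    moreover have "wt k ^ (2 * m) * Re (cnj (c k) * (conv q b c k + conv q c b k + conv q c c k)) =
      Re (?w k * conv q b c k) + Re (?w k * conv q c b k) + Re (?w k * conv q c c k)"
      proof -
      have "wt k ^ (2 * m) * Re z = Re (of_real (wt k ^ (2 * m)) * z)" for z
        by (simp only: Re_scale)
      then show ?thesis by (simp only: distrib_left plus_complex.sel mult.assoc)
    qed
    ultimately show "wt k ^ (2 * m) * Re (cnj (c k) * c' k)
      \<le> - (Re (?w k * conv q b c k) + Re (?w k * conv q c b k) + Re (?w k * conv q c c k)) + ?L k"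
      by (simp only: distrib_left)
  qed
  \<comment> \<open>Enlarged by the factor m so that the two bounds linear in \<open>b\<close> merge
    into one term with coefficient 2 + 1 = 3.\<close>
  moreover have "Q * 2 ^ m * (\<Sum>\<^sub>\<infinity>k. wt k ^ Suc m * cmod (b k)) * E
      \<le> Q * real m * 2 ^ m * (\<Sum>\<^sub>\<infinity>k. wt k ^ Suc m * cmod (b k)) * E"
    proof -
    have "0 \<le> E" unfolding E_def by (rule infsum_nonneg) simp
    moreover have "0 \<le> (\<Sum>\<^sub>\<infinity>k. wt k ^ Suc m * cmod (b k))" by (rule infsum_nonneg) simp
    ultimately show ?thesis
      using m Q_nonneg mult_left_mono[of 1 "real m" Q] by (intro mult_right_mono) auto
  qed
  ultimately show ?thesis
    using conv_energy_smooth_left[OF m b c(1,4), THEN abs_le_D2]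
      conv_energy_smooth_right[OF b(1,4) c(1,4), of m, THEN abs_le_D2]
      conv_energy_self[OF m c(1-3), THEN abs_le_D2]
    unfolding E_def[symmetric] by linarith
qed

end

section \<open>Fourier symbols of the equation\<close>

lemma fourier_coeff_add:
  fixes f g :: "real ^ 'n \<Rightarrow> real"
  assumes "continuous_on UNIV f" "continuous_on UNIV g"
  shows "fourier_coeff (\<lambda>x. f x + g x) k = fourier_coeff f k + fourier_coeff g k"
  by (simp add: fourier_coeff_eq assms continuous_intros distrib_right integral_add
      integrable_on_torus add_divide_distrib)

lemma fourier_coeff_diff:
  fixes f g :: "real ^ 'n \<Rightarrow> real"
  assumes "continuous_on UNIV f" "continuous_on UNIV g"
  shows "fourier_coeff (\<lambda>x. f x - g x) k = fourier_coeff f k - fourier_coeff g k"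
  by (simp add: fourier_coeff_eq assms continuous_intros left_diff_distrib integral_diff
      integrable_on_torus diff_divide_distrib)

lemma fourier_coeff_cmult:
  fixes f :: "real ^ 'n \<Rightarrow> real"
  assumes "continuous_on UNIV f"
  shows "fourier_coeff (\<lambda>x. r * f x) k = r * fourier_coeff f k"
  by (simp add: fourier_coeff_eq assms continuous_intros mult.assoc)

lemma fourier_coeff_sum:
  fixes f :: "'i \<Rightarrow> real ^ 'n \<Rightarrow> real"
  assumes "finite I" "\<And>i. i \<in> I \<Longrightarrow> continuous_on UNIV (f i)"
  shows "fourier_coeff (\<lambda>x. \<Sum>i\<in>I. f i x) k = (\<Sum>i\<in>I. fourier_coeff (f i) k)"
  using assms
proof (induction I rule: finite_induct)
  case empty
  then show ?case by (simp add: fourier_coeff_eq)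
next
  case (insert j I)
  then show ?case by (simp add: fourier_coeff_add continuous_on_sum)
qed

lemma fourier_coeff_minus:
  fixes f :: "real ^ 'n \<Rightarrow> real"
  assumes "continuous_on UNIV f"
  shows "fourier_coeff f (- k) = cnj (fourier_coeff f k)"
  by (simp add: fourier_coeff_eq assms freq_minus integral_cnj cis_cnj)

lemma fourier_coeff_0:
  fixes f :: "real ^ 'n \<Rightarrow> real"
  assumes "torus_integral f = 0"
  shows "fourier_coeff f 0 = 0"
  using assms by (simp add: fourier_coeff_def torus_integral_def freq_0 integral_complex_of_real)

definition lam_symbol :: "real \<Rightarrow> int ^ 'n \<Rightarrow> real" where
  "lam_symbol s k = (if s = 0 then 1 else wt k powr s)"

lemma lam_symbol_nonneg: "0 \<le> lam_symbol s k"
  by (simp add: lam_symbol_def)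

lemma lam_symbol_minus: "lam_symbol s (- k) = lam_symbol s k"
  by (simp add: lam_symbol_def)

lemma lam_symbol_1: "lam_symbol 1 k = wt k"
  by (simp add: lam_symbol_def)

text \<open>Real exponents are rounded up to natural ones, which is harmless since nonzero
  frequencies have weight at least 1.\<close>

lemma lam_symbol_le:
  assumes "0 \<le> s" "k \<noteq> 0"
  shows "lam_symbol s k \<le> wt k ^ nat \<lceil>s\<rceil>"
proof (cases "s = 0")
  case False
  have "wt k powr s \<le> wt k powr real (nat \<lceil>s\<rceil>)"
    using wt_ge_1[OF assms(2)] assms(1) by (intro powr_mono) linarith+
  with False show ?thesis
    using powr_realpow[OF less_le_trans[OF zero_less_one wt_ge_1[OF assms(2)]]] by (simp add: lam_symbol_def)
qed (simp add: lam_symbol_def)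

lemma lam_symbol_le_jap:
  assumes "0 \<le> s"
  shows "lam_symbol s k \<le> (1 + wt k) ^ nat \<lceil>s\<rceil>"
proof (cases "k = 0")
  case True
  then show ?thesis by (simp add: lam_symbol_def)
next
  case False
  have "wt k ^ nat \<lceil>s\<rceil> \<le> (1 + wt k) ^ nat \<lceil>s\<rceil>" by (intro power_mono) auto
  with lam_symbol_le[OF assms False] show ?thesis by linarith
qed

lemma Lam_pow_eq_trig:
  "Lam_pow s f = (\<lambda>x. Re (trig (\<lambda>k. of_real (lam_symbol s k) * fourier_coeff f k) x))"
  unfolding Lam_pow_def fourier_multiplier_eq_trig by (simp add: lam_symbol_def if_distrib cong: if_cong)

lemma rapid_lam_symbol:
  assumes "rapid c" "0 \<le> s"
  shows "rapid (\<lambda>k. of_real (lam_symbol s k) * c k :: complex)"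
  by (rule rapid_bound[OF assms(1), of _ 1 "nat \<lceil>s\<rceil>"])
    (auto simp: norm_mult abs_of_nonneg lam_symbol_nonneg intro!: mult_right_mono lam_symbol_le_jap assms)

lemma
  fixes f :: "real ^ 'n \<Rightarrow> real"
  assumes f: "continuous_on UNIV f" "rapid (fourier_coeff f)" and s: "0 \<le> s"
  shows continuous_on_Lam_pow: "continuous_on S (Lam_pow s f)"
    and fourier_coeff_Lam_pow: "fourier_coeff (Lam_pow s f) k = of_real (lam_symbol s k) * fourier_coeff f k"
  unfolding Lam_pow_eq_trig
  by (intro continuous_on_Re continuous_on_trig fourier_coeff_trig rapid_abs_summable rapid_lam_symbol f s;
    simp add: lam_symbol_minus fourier_coeff_minus[OF f(1)])+

definition velocity_symbol :: "('n \<Rightarrow> 'n \<Rightarrow> int ^ 'n \<Rightarrow> complex) \<Rightarrow> 'n \<Rightarrow> int ^ 'n \<Rightarrow> complex" where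
  "velocity_symbol T j p = (\<Sum>i\<in>UNIV. \<i> * of_int (p $ i) * T i j p)"

text \<open>Velocity symbol at p paired with the gradient symbol at l. On the diagonal l = p it is
  the symbol of the divergence of the velocity.\<close>

definition transport_symbol ::
  "('n::finite \<Rightarrow> 'n \<Rightarrow> int ^ 'n \<Rightarrow> complex) \<Rightarrow> int ^ 'n \<Rightarrow> int ^ 'n \<Rightarrow> complex" where
  "transport_symbol T p l = (\<Sum>j\<in>UNIV. velocity_symbol T j p * (\<i> * of_int (l $ j)))"

lemma transport_symbol_add: "transport_symbol T p (l + l') = transport_symbol T p l + transport_symbol T p l'"
  by (simp add: transport_symbol_def algebra_simps sum.distrib)

lemma velocity_symbol_minus:
  assumes "\<And>i j. hermitian_symbol (T i j)"
  shows "velocity_symbol T j (- p) = cnj (velocity_symbol T j p)"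
  using assms by (simp add: velocity_symbol_def hermitian_symbol_def)

lemma transport_symbol_cnj:
  assumes "\<And>i j. hermitian_symbol (T i j)"
  shows "cnj (transport_symbol T p l) = transport_symbol T (- p) (- l)"
  by (simp add: transport_symbol_def velocity_symbol_minus[OF assms])

text \<open>Away from 0 the bound |k|^(-3) is at most |k|^(-1), which pays for the derivative in the
  velocity; the factor |l| is the gradient of the transported function. (A4) takes care of k =
  0.\<close>

lemma symbol_bounds:
  fixes T :: "'n::finite \<Rightarrow> 'n \<Rightarrow> int ^ 'n \<Rightarrow> complex"
  assumes "condA3' T" "condA4 T"
  obtains C where "0 < C" "\<And>i j k. cmod (T i j k) \<le> C" "\<And>j p. cmod (velocity_symbol T j p) \<le> C"
    "\<And>p l. cmod (transport_symbol T p l) \<le> C * wt l"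
proof -
  obtain C where C: "0 < C" "\<And>i j k. k \<noteq> 0 \<Longrightarrow> cmod (T i j k) \<le> C * wt k powr (- 3)"
    using assms(1) unfolding condA3'_def by blast
  let ?n = "real CARD('n)"
  have n: "1 \<le> ?n" by (simp add: Suc_leI)
  have T1: "(1 + wt k) * cmod (T i j k) \<le> 2 * C" for i j k
  proof (cases "k = 0")
    case True
    then show ?thesis using assms(2) C(1) by (simp add: condA4_def)
  next
    case False
    then have w: "1 \<le> wt k" by (rule wt_ge_1)
    have "wt k powr (- 3) \<le> wt k powr (- 1)" by (rule powr_mono) (use w in auto)
    also have "\<dots> = 1 / wt k" using w by (simp add: powr_minus_divide)
    finally have "C * wt k powr (- 3) \<le> C * (1 / wt k)" using C(1) by (intro mult_left_mono) auto
    then have "cmod (T i j k) \<le> C / wt k" using C(2)[OF False, of i j] by simp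
    then have "(1 + wt k) * cmod (T i j k) \<le> (1 + wt k) * (C / wt k)"
      using w by (intro mult_left_mono) auto
    also have "\<dots> = C / wt k + C" using w by (auto simp: distrib_right add_divide_distrib)
    also have "C / wt k \<le> C" using w C(1) by (simp add: divide_le_eq mult_le_cancel_left1)
    finally show ?thesis by simp
  qed
  have T0: "cmod (T i j k) \<le> 2 * C" for i j k
    using T1[of k i j] mult_right_mono[of 1 "1 + wt k" "cmod (T i j k)"] by simp
  have V: "cmod (velocity_symbol T j p) \<le> ?n * (2 * C)" for j p
  proof -
    have "cmod (\<i> * of_int (p $ i) * T i j p) \<le> 2 * C" for i
    proof -
      have "\<bar>real_of_int (p $ i)\<bar> * cmod (T i j p) \<le> (1 + wt p) * cmod (T i j p)"
        using component_le_norm_cart[of "freq p" i] by (intro mult_right_mono) auto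
      with T1[of p i j] show ?thesis by (simp add: norm_mult)
    qed
    then show ?thesis
      unfolding velocity_symbol_def using sum_norm_bound[of UNIV "\<lambda>i. \<i> * of_int (p $ i) * T i j p" "2 * C"] by simp
  qed
  have W: "cmod (transport_symbol T p l) \<le> ?n * (?n * (2 * C) * wt l)" for p l
  proof -
    have "cmod (velocity_symbol T j p * (\<i> * of_int (l $ j))) \<le> ?n * (2 * C) * wt l" for j
      unfolding norm_mult using component_le_norm_cart[of "freq l" j] V C(1)
      by (intro mult_mono) auto
    then show ?thesis
      unfolding transport_symbol_def
      using sum_norm_bound[of UNIV "\<lambda>j. velocity_symbol T j p * (\<i> * of_int (l $ j))" "?n * (2 * C) * wt l"] by simp
  qed
  have 1: "2 * C \<le> ?n * (2 * C)" using mult_right_mono[OF n, of "2 * C"] C(1) by simp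
  then have 2: "?n * (2 * C) \<le> ?n * (?n * (2 * C))" by (rule mult_left_mono) simp
  show thesis
  \<comment> \<open>The two factors \<open>?n\<close> count the sums over i and over j; as
    \<open>?n\<close> is at least 1, this one constant dominates all three bounds.\<close>
  proof (rule that[of "?n * (?n * (2 * C))"])
    show "cmod (T i j k) \<le> ?n * (?n * (2 * C))" for i j k using T0[of i j k] 1 2 by linarith
    show "cmod (velocity_symbol T j p) \<le> ?n * (?n * (2 * C))" for j p using V[of j p] 1 2 by linarith
    show "cmod (transport_symbol T p l) \<le> ?n * (?n * (2 * C)) * wt l" for p l
      using W[of p l] by (simp add: mult.assoc)
  qed (use C(1) n in auto)
qed

lemma rapid_times_bounded:
  assumes "rapid c" "\<And>k. cmod (d k) \<le> C"
  shows "rapid (\<lambda>k. d k * c k :: complex)"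
  by (rule rapid_bound[OF assms(1), of _ C 0]) (simp add: norm_mult assms(2) mult_right_mono)

lemma rapid_times_freq:
  fixes c :: "int ^ 'n \<Rightarrow> complex"
  assumes "rapid c"
  shows "rapid (\<lambda>k. \<i> * of_int (k $ i) * c k :: complex)"
proof (rule rapid_bound[OF assms, of _ 1 1])
  fix k :: "int ^ 'n"
  have "\<bar>real_of_int (k $ i)\<bar> \<le> 1 + wt k" using component_le_norm_cart[of "freq k" i] by simp
  then show "norm (\<i> * of_int (k $ i) * c k) \<le> 1 * (1 + wt k) ^ 1 * norm (c k)"
    by (simp add: norm_mult mult_right_mono)
qed

section \<open>The velocity and the nonlinear term on the Fourier side\<close>

context
  fixes T :: "'n::finite \<Rightarrow> 'n \<Rightarrow> int ^ 'n \<Rightarrow> complex" and f :: "real ^ 'n \<Rightarrow> real"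
  assumes herm: "\<And>i j. hermitian_symbol (T i j)"
    and A3: "condA3' T" and A4: "condA4 T"
    and f: "continuous_on UNIV f" "rapid (fourier_coeff f)"
begin

lemma rapid_multiplier: "rapid (\<lambda>k. T i j k * fourier_coeff f k)"
  using symbol_bounds[OF A3 A4] rapid_times_bounded[OF f(2)] by metis

lemma rapid_velocity: "rapid (\<lambda>k. velocity_symbol T j k * fourier_coeff f k)"
  using symbol_bounds[OF A3 A4] rapid_times_bounded[OF f(2)] by metis

lemma velocity_eq_trig:
  "velocity T f x $ j = Re (trig (\<lambda>k. velocity_symbol T j k * fourier_coeff f k) x)"
proof -
  have "velocity T f x $ j = (\<Sum>i\<in>UNIV. Re (trig (\<lambda>k. \<i> * of_int (k $ i) * (T i j k * fourier_coeff f k)) x))"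
    unfolding velocity_def fourier_multiplier_eq_trig by (simp add: partial_trig[OF rapid_multiplier])
  also have "\<dots> = Re (trig (\<lambda>k. \<Sum>i\<in>UNIV. \<i> * of_int (k $ i) * (T i j k * fourier_coeff f k)) x)"
    by (subst trig_sum) (auto intro!: rapid_abs_summable rapid_times_freq rapid_multiplier)
  finally show ?thesis
    by (simp add: velocity_symbol_def sum_distrib_right mult.assoc)
qed

text \<open>The velocity component is the factor given as an absolutely convergent series, the
  partial derivative the merely continuous one; the product formula is applied for each j, and the
  finite sum over j is then moved inside.\<close>

lemma
  assumes D: "\<And>j x. ((\<lambda>h. f (x + axis j h)) has_real_derivative f' j x) (at 0)"
    and f': "\<And>j. continuous_on UNIV (f' j)" and per: "periodic f"
  shows continuous_on_transport: "continuous_on UNIV (\<lambda>x. velocity T f x \<bullet> grad f x)"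
    and fourier_coeff_transport: "fourier_coeff (\<lambda>x. velocity T f x \<bullet> grad f x) k
      = conv (transport_symbol T) (fourier_coeff f) (fourier_coeff f) k"
proof -
  let ?v = "\<lambda>j x. Re (trig (\<lambda>k. velocity_symbol T j k * fourier_coeff f k) x)"
  have eq: "velocity T f x \<bullet> grad f x = (\<Sum>j\<in>UNIV. ?v j x * f' j x)" for x
    by (simp add: inner_vec_def velocity_eq_trig grad_def partial_def DERIV_imp_deriv[OF D])
  have cv: "continuous_on UNIV (\<lambda>x. ?v j x * f' j x)" for j
    by (intro continuous_intros continuous_on_trig rapid_abs_summable rapid_velocity f')
  show "continuous_on UNIV (\<lambda>x. velocity T f x \<bullet> grad f x)"
    unfolding eq by (intro continuous_on_sum cv)
  let ?s = "\<lambda>j l. velocity_symbol T j (k - l) * fourier_coeff f (k - l) * (\<i> * of_int (l $ j) * fourier_coeff f l)"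
  have sm: "?s j summable_on UNIV" for j
  proof -
    obtain K where K: "\<And>k. cmod (velocity_symbol T j k * fourier_coeff f k) \<le> K"
      using rapid_velocity[of j, unfolded rapid_alt, rule_format, of 0] by auto
    show ?thesis
      by (rule rapid_summable_on, rule rapid_times_bounded[OF rapid_times_freq[OF f(2)]]) (rule K)
  qed
  have "fourier_coeff (\<lambda>x. velocity T f x \<bullet> grad f x) k = (\<Sum>j\<in>UNIV. fourier_coeff (\<lambda>x. ?v j x * f' j x) k)"
    unfolding eq by (rule fourier_coeff_sum) (auto intro: cv)
  also have "\<dots> = (\<Sum>j\<in>UNIV. \<Sum>\<^sub>\<infinity>l. ?s j l)"
    by (subst fourier_coeff_trig_mult)
      (auto intro!: rapid_abs_summable rapid_velocity f'
        simp: fourier_coeff_partial[OF f(1) per f' D] velocity_symbol_minus[OF herm] fourier_coeff_minus[OF f(1)])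
  also have "\<dots> = (\<Sum>\<^sub>\<infinity>l. \<Sum>j\<in>UNIV. ?s j l)"
    by (rule infsum_finite_sum[symmetric]) (auto intro: sm)
  also have "\<dots> = conv (transport_symbol T) (fourier_coeff f) (fourier_coeff f) k"
    unfolding conv_def transport_symbol_def
    by (simp add: sum_distrib_left sum_distrib_right mult_ac)
  finally show "fourier_coeff (\<lambda>x. velocity T f x \<bullet> grad f x) k
      = conv (transport_symbol T) (fourier_coeff f) (fourier_coeff f) k" .
qed

text \<open>(A1) says that a finite sum of trigonometric series vanishes identically; its
  coefficient at p is read off. The condition is tested on \<open>f\<close> itself, which is why the
  coefficient of \<open>f\<close> stays as a factor.\<close>

lemma transport_divergence_free:
  assumes A1: "condA1 T" and sm: "smooth_torus f"
  shows "transport_symbol T p p * fourier_coeff f p = 0"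
proof -
  let ?c = "\<lambda>i j k. \<i> * of_int (k $ i) * (\<i> * of_int (k $ j) * (T i j k * fourier_coeff f k))"
  have r: "rapid (?c i j)" for i j
    by (intro rapid_times_freq rapid_multiplier)
  have "partial i (partial j (fourier_multiplier (T i j) f)) x = Re (trig (?c i j) x)" for i j x
  proof -
    have "partial j (fourier_multiplier (T i j) f)
        = (\<lambda>x. Re (trig (\<lambda>k. \<i> * of_int (k $ j) * (T i j k * fourier_coeff f k)) x))"
      unfolding fourier_multiplier_eq_trig by (rule ext) (rule partial_trig[OF rapid_multiplier])
    then show ?thesis
      by (simp only: partial_trig[OF rapid_times_freq[OF rapid_multiplier]])
  qed
  then have "(\<Sum>i\<in>UNIV. \<Sum>j\<in>UNIV. Re (trig (?c i j) x)) = 0" for x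
    using A1[unfolded condA1_def, rule_format, OF sm, of x] by simp
  moreover have "(\<Sum>i\<in>UNIV. \<Sum>j\<in>UNIV. Re (trig (?c i j) x)) = (\<Sum>z\<in>UNIV. Re (trig (?c (fst z) (snd z)) x))" for x
    by (simp add: sum.cartesian_product split_beta)
  ultimately have z: "(\<Sum>z\<in>UNIV. Re (trig (?c (fst z) (snd z)) x)) = 0" for x
    by simp
  have "(\<Sum>z\<in>UNIV. ?c (fst z) (snd z) p) = (\<Sum>z\<in>UNIV. fourier_coeff (\<lambda>x. Re (trig (?c (fst z) (snd z)) x)) p)"
    using herm by (intro sum.cong refl fourier_coeff_trig[symmetric] rapid_abs_summable r)
      (simp add: hermitian_symbol_def fourier_coeff_minus[OF f(1)])
  also have "\<dots> = fourier_coeff (\<lambda>x. \<Sum>z\<in>UNIV. Re (trig (?c (fst z) (snd z)) x)) p"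
    by (rule fourier_coeff_sum[symmetric])
      (auto intro!: continuous_on_Re continuous_on_trig rapid_abs_summable r)
  also have "\<dots> = 0" by (simp add: z fourier_coeff_eq)
  finally have "(\<Sum>i\<in>UNIV. \<Sum>j\<in>UNIV. ?c i j p) = 0"
    by (simp add: sum.cartesian_product split_beta)
  then have "(\<Sum>j\<in>UNIV. \<Sum>i\<in>UNIV. ?c i j p) = 0"
    by (subst sum.swap)
  then show ?thesis
    unfolding transport_symbol_def velocity_symbol_def
    by (simp add: sum_distrib_left sum_distrib_right mult_ac)
qed

end

section \<open>A continuity argument and interpolation\<close>

text \<open>The function exp(-C t) E(t) - d t is nonincreasing, because exp(-C t) <= 1 in front of
  the constant d.\<close>

lemma gronwall_affine:
  fixes E E' :: "real \<Rightarrow> real"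
  assumes \<sigma>: "0 \<le> \<sigma>" and E0: "E 0 = 0" and cont: "continuous_on {0..\<sigma>} E"
    and D: "\<And>t. 0 < t \<Longrightarrow> t < \<sigma> \<Longrightarrow> (E has_real_derivative E' t) (at t)"
    and le: "\<And>t. 0 < t \<Longrightarrow> t < \<sigma> \<Longrightarrow> E' t \<le> C * E t + d" and C: "0 \<le> C" and d: "0 \<le> d"
  shows "E \<sigma> \<le> d * \<sigma> * exp (C * \<sigma>)"
proof (cases "\<sigma> = 0")
  case False
  with \<sigma> have "0 < \<sigma>" by simp
  let ?F = "\<lambda>t. exp (- C * t) * E t - d * t"
  have "?F \<sigma> \<le> ?F 0"
  proof (rule DERIV_nonpos_imp_decreasing_open[OF \<sigma>])
    fix t assume t: "0 < t" "t < \<sigma>"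
    have "(?F has_real_derivative exp (- C * t) * (E' t - C * E t) - d) (at t)"
      by (auto intro!: derivative_eq_intros D[OF t] simp: algebra_simps)
    moreover have "exp (- C * t) * (E' t - C * E t) - d \<le> 0"
    proof -
      have "exp (- C * t) * (E' t - C * E t) \<le> exp (- C * t) * d"
        using le[OF t] by (intro mult_left_mono) auto
      also have "\<dots> \<le> 1 * d" using C d t by (intro mult_right_mono) auto
      finally show ?thesis by simp
    qed
    ultimately show "\<exists>y. (?F has_real_derivative y) (at t) \<and> y \<le> 0" by blast
  qed (intro continuous_intros cont)
  then have "exp (- C * \<sigma>) * E \<sigma> \<le> d * \<sigma>" using E0 by simp
  then have "exp (C * \<sigma>) * (exp (- C * \<sigma>) * E \<sigma>) \<le> exp (C * \<sigma>) * (d * \<sigma>)"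
    by (rule mult_left_mono) simp
  moreover have "exp (C * \<sigma>) * (exp (- C * \<sigma>) * E \<sigma>) = E \<sigma>"
    by (simp add: exp_minus)
  ultimately show ?thesis by (simp only: mult_ac)
qed (simp add: E0)

text \<open>The differential inequality is known only where E <= 1. If \<open>E\<close> ever reached
  1, there would be a first such time; Gronwall applies up to it and keeps \<open>E\<close> strictly
  below 1 there.\<close>

lemma gronwall_bootstrap:
  fixes E E' :: "real \<Rightarrow> real"
  assumes E0: "E 0 = 0" and cont: "continuous_on {0..\<tau>} E"
    and D: "\<And>t. 0 < t \<Longrightarrow> t < \<tau> \<Longrightarrow> (E has_real_derivative E' t) (at t)"
    and le: "\<And>t. 0 < t \<Longrightarrow> t < \<tau> \<Longrightarrow> E t \<le> 1 \<Longrightarrow> E' t \<le> C * E t + d" and C: "0 \<le> C" and d: "0 \<le> d"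
    and small: "d * \<tau> * exp (C * \<tau>) < 1" and t: "0 \<le> t" "t \<le> \<tau>"
  shows "E t \<le> d * \<tau> * exp (C * \<tau>)"
proof -
  have G: "E \<sigma> \<le> d * \<tau> * exp (C * \<tau>)" if "0 \<le> \<sigma>" "\<sigma> \<le> \<tau>" "\<And>s. 0 \<le> s \<Longrightarrow> s < \<sigma> \<Longrightarrow> E s \<le> 1" for \<sigma>
  proof -
    have "E \<sigma> \<le> d * \<sigma> * exp (C * \<sigma>)"
      by (rule gronwall_affine[OF that(1) E0 continuous_on_subset[OF cont] D le C d]) (use that in auto)
    also have "\<dots> \<le> d * \<tau> * exp (C * \<tau>)"
      using that C d by (intro mult_mono) (auto intro: mult_left_mono)
    finally show ?thesis .
  qed
  let ?A = "{s \<in> {0..\<tau>}. 1 \<le> E s}"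
  have "?A = {}"
  proof (rule ccontr)
    assume ne: "?A \<noteq> {}"
    have "closed ?A"
      by (rule continuous_on_closed_Collect_le[OF continuous_on_const cont]) simp
    then have "compact ?A"
      by (rule compact_Int_closed[of "{0..\<tau>}", simplified, THEN back_subst[where P = compact]]) auto
    then obtain \<sigma> where \<sigma>: "\<sigma> \<in> ?A" "\<And>s. s \<in> ?A \<Longrightarrow> \<sigma> \<le> s"
      using compact_attains_inf[OF _ ne] by blast
    have "E \<sigma> \<le> d * \<tau> * exp (C * \<tau>)"
    proof (rule G)
      show "E s \<le> 1" if "0 \<le> s" "s < \<sigma>" for s
        using \<sigma>(2)[of s] \<sigma>(1) that by (cases "E s \<le> 1") auto
    qed (use \<sigma>(1) in auto)
    with small \<sigma>(1) show False by simp
  qed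
  then have "E s \<le> 1" if "0 \<le> s" "s \<le> \<tau>" for s using that by fastforce
  then show ?thesis using t by (intro G) auto
qed

text \<open>Write |k|^p |c_k| as |k|^(p - m) times |k|^m |c_k| and use Young's inequality with
  parameter \<delta>. The gap m - p >= d makes the squares of the first factor summable. The
  parameter is 1 in the energy estimate and sqrt \<lambda> in the final limit.\<close>

lemma weighted_l1_bound:
  fixes c :: "int ^ 'n \<Rightarrow> complex"
  assumes c: "rapid c" "c 0 = 0" and m: "p + CARD('n) \<le> m" and \<delta>: "0 < \<delta>"
  shows "(\<Sum>\<^sub>\<infinity>k. wt k ^ p * cmod (c k))
    \<le> (\<delta> * (4 ^ CARD('n) * (\<Sum>\<^sub>\<infinity>k::int ^ 'n. inverse ((1 + wt k) ^ (2 * CARD('n)))))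
      + (\<Sum>\<^sub>\<infinity>k. (wt k ^ m * cmod (c k))\<^sup>2) / \<delta>) / 2"
proof -
  let ?n = "CARD('n)"
  let ?R = "\<lambda>k. (\<delta> * (4 ^ ?n * inverse ((1 + wt k) ^ (2 * ?n))) + (wt k ^ m * cmod (c k))\<^sup>2 / \<delta>) / 2"
  have R: "(?R has_sum (\<delta> * (4 ^ ?n * (\<Sum>\<^sub>\<infinity>k::int ^ 'n. inverse ((1 + wt k) ^ (2 * ?n))))
      + (\<Sum>\<^sub>\<infinity>k. (wt k ^ m * cmod (c k))\<^sup>2) / \<delta>) / 2) UNIV"
    by (intro has_sum_divide_const has_sum_add has_sum_cmult_right has_sum_infsum summable_jap
        rapid_wt_square_summable c order_refl)
  show ?thesis
  proof (rule has_sum_mono[OF has_sum_infsum[OF rapid_wt_summable[OF c(1)]] R])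
    fix k :: "int ^ 'n"
    show "wt k ^ p * cmod (c k) \<le> ?R k"
    proof (cases "k = 0")
      case True
      then show ?thesis using c(2) \<delta> by simp
    next
      case False
      then have w: "1 \<le> wt k" by (rule wt_ge_1)
      define r where "r = inverse (wt k ^ (m - p))"
      let ?y = "wt k ^ m * cmod (c k)"
      have wm: "wt k ^ m = wt k ^ p * wt k ^ (m - p)" using m by (simp flip: power_add)
      have "r * wt k ^ (m - p) = 1"
        unfolding r_def by (rule left_inverse) (use w in auto)
      moreover have "r * ?y = (r * wt k ^ (m - p)) * (wt k ^ p * cmod (c k))"
        unfolding wm by (simp only: mult_ac)
      ultimately have 1: "wt k ^ p * cmod (c k) = r * ?y"
        by (simp only: mult_1_left)
      \<comment> \<open>Since |k| >= 1, (1 + |k|) / 2 <= |k|; the power 2 d of the 2 is the constant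
        4^d.\<close>
      have "((1 + wt k) / 2) ^ (2 * ?n) \<le> wt k ^ (2 * ?n)" using w by (intro power_mono) auto
      also have "\<dots> \<le> wt k ^ (2 * (m - p))" using w m by (intro power_increasing) auto
      finally have "inverse (wt k ^ (2 * (m - p))) \<le> inverse (((1 + wt k) / 2) ^ (2 * ?n))"
        by (rule le_imp_inverse_le) (use w in auto)
      moreover have "r\<^sup>2 = inverse (wt k ^ (2 * (m - p)))"
        by (simp only: r_def power_inverse power_mult[symmetric] mult.commute)
      moreover have "inverse (((1 + wt k) / 2) ^ (2 * ?n)) = 4 ^ ?n * inverse ((1 + wt k) ^ (2 * ?n))"
      proof -
        have "(2 :: real) ^ (2 * ?n) = 4 ^ ?n" by (simp add: power_mult)
        then show ?thesis unfolding power_divide inverse_divide by (simp only: divide_inverse)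
      qed
      ultimately have "r\<^sup>2 \<le> 4 ^ ?n * inverse ((1 + wt k) ^ (2 * ?n))"
        by (simp only:)
      then have le: "\<delta> * r\<^sup>2 \<le> \<delta> * (4 ^ ?n * inverse ((1 + wt k) ^ (2 * ?n)))"
        by (rule mult_left_mono) (use \<delta> in simp)
      have am: "x * y \<le> (\<delta> * x\<^sup>2 + y\<^sup>2 / \<delta>) / 2" for x y
      proof -
        have "0 \<le> (\<delta> * x - y)\<^sup>2 / \<delta>" using \<delta> by simp
        also have "\<dots> = \<delta> * x\<^sup>2 - 2 * (x * y) + y\<^sup>2 / \<delta>"
          using \<delta> by (simp add: power2_eq_square field_simps)
        finally show ?thesis by simp
      qed
      show ?thesis
        unfolding 1 by (rule order_trans[OF am divide_right_mono[OF add_right_mono[OF le]]]) simp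
    qed
  qed
qed

text \<open>In the termwise derivative \<open>c\<close> is bounded uniformly and \<open>c'\<close>
  has a summable majorant with 2 m weights, so the series may be differentiated up to the end points
  of the interval.\<close>

lemma energy_has_derivative:
  fixes c c' :: "real \<Rightarrow> int ^ 'n \<Rightarrow> complex"
  assumes c: "rapid_on {0..\<tau>} c" and c': "rapid_on {0..\<tau>} c'"
    and D: "\<And>t k. t \<in> {0..\<tau>} \<Longrightarrow> ((\<lambda>t. c t k) has_vector_derivative c' t k) (at t within {0..\<tau>})"
    and t: "t \<in> {0..\<tau>}"
  shows "((\<lambda>t. \<Sum>\<^sub>\<infinity>k. (wt k ^ m * cmod (c t k))\<^sup>2) has_vector_derivative
    2 * (\<Sum>\<^sub>\<infinity>k. wt k ^ (2 * m) * Re (cnj (c t k) * c' t k))) (at t within {0..\<tau>})"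
proof -
  obtain K where "\<forall>t\<in>{0..\<tau>}. \<forall>k. cmod (c t k) \<le> K"
    using c[unfolded rapid_on_def, rule_format, of 0] by auto
  then have K: "cmod (c t k) \<le> K" if "t \<in> {0..\<tau>}" for t k using that by blast
  obtain g :: "int ^ 'n \<Rightarrow> real" where g: "g summable_on UNIV" "\<And>k. 0 \<le> g k"
    "\<And>t k. t \<in> {0..\<tau>} \<Longrightarrow> (1 + wt k) ^ (2 * m) * cmod (c' t k) \<le> g k"
    by (rule rapid_majorant[OF c', of "2 * m"]) (rule that)
  have "((\<lambda>t. \<Sum>\<^sub>\<infinity>k. (wt k ^ m * cmod (c t k))\<^sup>2) has_vector_derivative
    (\<Sum>\<^sub>\<infinity>k. 2 * (wt k ^ (2 * m) * Re (cnj (c t k) * c' t k)))) (at t within {0..\<tau>})"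
  proof (rule has_vector_derivative_infsum[OF _ t])
    fix k s assume s: "s \<in> {0..\<tau>}"
    have "((\<lambda>t. c t k \<bullet> c t k) has_vector_derivative c s k \<bullet> c' s k + c' s k \<bullet> c s k) (at s within {0..\<tau>})"
      by (rule bounded_bilinear.has_vector_derivative[OF bounded_bilinear_inner D[OF s] D[OF s]])
    then have "((\<lambda>t. wt k ^ (2 * m) * (c t k \<bullet> c t k)) has_vector_derivative
        wt k ^ (2 * m) * (c s k \<bullet> c' s k + c' s k \<bullet> c s k)) (at s within {0..\<tau>})"
      by (rule has_vector_derivative_mult_right)
    moreover have "wt k ^ (2 * m) * (c t k \<bullet> c t k) = (wt k ^ m * cmod (c t k))\<^sup>2" for t
      by (simp add: power_mult_distrib power_mult dot_square_norm mult.commute[of 2 m])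
    moreover have "c s k \<bullet> c' s k + c' s k \<bullet> c s k = 2 * Re (cnj (c s k) * c' s k)"
      by (simp add: inner_complex_def)
    ultimately show "((\<lambda>t. (wt k ^ m * cmod (c t k))\<^sup>2) has_vector_derivative
        2 * (wt k ^ (2 * m) * Re (cnj (c s k) * c' s k))) (at s within {0..\<tau>})"
      by (simp only: mult.left_commute)
    have "\<bar>Re (cnj (c s k) * c' s k)\<bar> \<le> cmod (c s k) * cmod (c' s k)"
      using abs_Re_le_cmod[of "cnj (c s k) * c' s k"] by (simp add: norm_mult)
    also have "\<dots> \<le> K * cmod (c' s k)"
      by (rule mult_right_mono[OF K[OF s]]) simp
    finally have "wt k ^ (2 * m) * \<bar>Re (cnj (c s k) * c' s k)\<bar> \<le> (1 + wt k) ^ (2 * m) * (K * cmod (c' s k))"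
      by (intro mult_mono power_mono) auto
    also have "\<dots> = K * ((1 + wt k) ^ (2 * m) * cmod (c' s k))" by simp
    also have "\<dots> \<le> K * g k"
      using order_trans[OF norm_ge_zero K[OF s, of k]] by (intro mult_left_mono g(3)[OF s])
    finally show "norm (2 * (wt k ^ (2 * m) * Re (cnj (c s k) * c' s k))) \<le> 2 * (K * g k)"
      by (simp only: real_norm_def abs_mult power_abs abs_norm_cancel abs_numeral)
  next
    show "(\<lambda>k. 2 * (K * g k)) summable_on UNIV"
      by (intro summable_on_cmult_right g(1))
    show "(\<lambda>k. (wt k ^ m * cmod (c s k))\<^sup>2) summable_on UNIV" if "s \<in> {0..\<tau>}" for s
      by (rule rapid_wt_square_summable[OF rapid_onD[OF c that]])
  qed simp
  then show ?thesis by (simp only: infsum_cmult_right')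
qed

section \<open>Convergence as the damping vanishes\<close>

lemma conv_summable:
  assumes "\<And>p l. cmod (q p l) \<le> Q * wt l" "rapid x" "rapid y"
  shows "(\<lambda>l. x (k - l) * q (k - l) l * y l) summable_on UNIV"
proof -
  obtain K where K: "\<And>k. cmod (x k) \<le> K"
    using assms(2)[unfolded rapid_alt, rule_format, of 0] by auto
  have "cmod (x (k - l) * q (k - l) l * y l) \<le> K * \<bar>Q\<bar> * (1 + wt l) ^ 1 * cmod (y l)" for l
  proof -
    have K0: "0 \<le> K" by (rule order_trans[OF norm_ge_zero K])
    have "cmod (q (k - l) l) \<le> Q * wt l" by (rule assms(1))
    also have "\<dots> \<le> \<bar>Q\<bar> * (1 + wt l)" by (rule mult_mono) auto
    finally have "cmod (x (k - l)) * cmod (q (k - l) l) * cmod (y l) \<le> K * (\<bar>Q\<bar> * (1 + wt l)) * cmod (y l)"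
      using K K0 by (intro mult_right_mono mult_mono) auto
    then show ?thesis by (simp add: norm_mult mult_ac)
  qed
  then show ?thesis by (intro rapid_summable_on rapid_bound[OF assms(3)])
qed

text \<open>Isolates the part quadratic in \<open>b\<close>, which cancels when the equation for
  \<lambda> = 0 is subtracted.\<close>

lemma conv_add_add:
  assumes "\<And>p l. cmod (q p l) \<le> Q * wt l" "rapid b" "rapid c"
  shows "conv q (\<lambda>k. b k + c k) (\<lambda>k. b k + c k) k
    = conv q b b k + (conv q b c k + conv q c b k + conv q c c k)"
proof -
  note h = has_sum_infsum[OF conv_summable[OF assms(1)]]
  have "((\<lambda>l. b (k - l) * q (k - l) l * b l + (b (k - l) * q (k - l) l * c l
      + c (k - l) * q (k - l) l * b l + c (k - l) * q (k - l) l * c l)) has_sum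
      (conv q b b k + (conv q b c k + conv q c b k + conv q c c k))) UNIV"
    unfolding conv_def by (intro has_sum_add h assms)
  then show ?thesis
    unfolding conv_def[of q "\<lambda>k. b k + c k"] by (intro infsumI) (simp add: algebra_simps)
qed

text \<open>The series of \<open>Lam_pow s f\<close> is bounded pointwise by its l1 norm, and the
  supremum bounds the L2 norm up to the square root of the volume of the torus.\<close>

lemma Hs_norm_le:
  fixes f :: "real ^ 'n \<Rightarrow> real"
  assumes f: "continuous_on UNIV f" "rapid (fourier_coeff f)" "fourier_coeff f 0 = 0" and s: "0 \<le> s"
  shows "Hs_norm s f \<le> sqrt ((2 * pi) ^ CARD('n)) * (\<Sum>\<^sub>\<infinity>k. wt k ^ nat \<lceil>s\<rceil> * cmod (fourier_coeff f k))"
proof -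
  let ?B = "\<Sum>\<^sub>\<infinity>k. wt k ^ nat \<lceil>s\<rceil> * cmod (fourier_coeff f k)"
  let ?g = "\<lambda>k. of_real (lam_symbol s k) * fourier_coeff f k :: complex"
  have le: "\<bar>Lam_pow s f x\<bar> \<le> ?B" for x
  proof -
    have r: "(\<lambda>k. norm (?g k)) summable_on UNIV"
      by (rule rapid_abs_summable[OF rapid_lam_symbol[OF f(2) s]])
    have "\<bar>Lam_pow s f x\<bar> \<le> norm (trig ?g x)"
      unfolding Lam_pow_eq_trig by (rule abs_Re_le_cmod)
    also have "\<dots> \<le> (\<Sum>\<^sub>\<infinity>k. norm (?g k))" by (rule norm_trig_le[OF r])
    also have "\<dots> \<le> ?B"
    proof (rule infsum_mono[OF r rapid_wt_summable[OF f(2)]])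
      show "norm (?g k) \<le> wt k ^ nat \<lceil>s\<rceil> * cmod (fourier_coeff f k)" for k
      proof (cases "k = 0")
        case False
        then show ?thesis
          using lam_symbol_le[OF s False]
          by (simp add: norm_mult abs_of_nonneg lam_symbol_nonneg mult_right_mono)
      qed (simp add: f(3))
    qed
    finally show ?thesis .
  qed
  have B0: "0 \<le> ?B" by (rule infsum_nonneg) simp
  have cL: "continuous_on UNIV (\<lambda>x. (Lam_pow s f x)\<^sup>2)"
    by (intro continuous_intros continuous_on_Lam_pow f s)
  have "norm (integral torus (\<lambda>x. (Lam_pow s f x)\<^sup>2)) \<le> ?B\<^sup>2 * measure lborel (torus :: (real ^ 'n) set)"
    unfolding torus_def
  proof (rule integrable_bound)
    show "(\<lambda>x. (Lam_pow s f x)\<^sup>2) integrable_on cbox (\<chi> i. - pi) (\<chi> i. pi)"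
      using integrable_on_torus[OF cL] by (simp add: torus_def)
    show "norm ((Lam_pow s f x)\<^sup>2) \<le> ?B\<^sup>2" for x
      using power_mono[OF le[of x], of 2] by simp
  qed simp
  also have "measure lborel (torus :: (real ^ 'n) set) = (2 * pi) ^ CARD('n)"
    by (simp add: torus_def content_cbox_cart interval_ne_empty_cart)
  finally have "torus_integral (\<lambda>x. (Lam_pow s f x)\<^sup>2) \<le> ?B\<^sup>2 * (2 * pi) ^ CARD('n)"
    by (simp add: torus_integral_eq[OF cL])
  then have "Hs_norm s f \<le> sqrt (?B\<^sup>2 * (2 * pi) ^ CARD('n))"
    unfolding Hs_norm_def L2_norm_def by (rule real_sqrt_le_mono)
  also have "\<dots> = sqrt ((2 * pi) ^ CARD('n)) * ?B"
    using B0 by (simp add: real_sqrt_mult mult.commute)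
  finally show ?thesis .
qed

lemma Hs_norm_nonneg: "0 \<le> Hs_norm s f"
  by (simp add: Hs_norm_def L2_norm_def torus_integral_def)

section \<open>The equation as a system for Fourier coefficients, and the limit\<close>

locale multiplier_velocity =
  fixes T :: "'n::finite \<Rightarrow> 'n \<Rightarrow> int ^ 'n \<Rightarrow> complex" and S \<theta>\<^sub>0 :: "real ^ 'n \<Rightarrow> real" and \<kappa> \<gamma> :: real
  assumes herm: "\<And>i j. hermitian_symbol (T i j)"
    and A1: "condA1 T" and A3: "condA3' T" and A4: "condA4 T"
    and S: "continuous_on UNIV S" and \<kappa>: "0 < \<kappa>" and \<gamma>: "0 < \<gamma>"
begin

text \<open>Here \<open>a'\<close> consists of the coefficients of the time derivative, which is
  smooth up to t = 0; this gives its rapid decay on closed intervals, while the equation itself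
  identifies \<open>a'\<close> only for t > 0.\<close>

lemma solution_fourier:
  assumes sol: "smooth_solution T \<kappa> \<gamma> S \<theta>\<^sub>0 lam \<theta>"
  obtains a' where
    "\<And>\<tau>. rapid_on {0..\<tau>} (\<lambda>t. fourier_coeff (\<theta> t))" "\<And>\<tau>. rapid_on {0..\<tau>} a'"
    "\<And>t k. 0 \<le> t \<Longrightarrow> ((\<lambda>t. fourier_coeff (\<theta> t) k) has_vector_derivative a' t k) (at t within {0..})"
    "\<And>t k. 0 < t \<Longrightarrow> a' t k = fourier_coeff S k
      - conv (transport_symbol T) (fourier_coeff (\<theta> t)) (fourier_coeff (\<theta> t)) k
      - of_real (lam * (1 + wt k)) * fourier_coeff (\<theta> t) k
      - of_real (\<kappa> * lam_symbol \<gamma> k) * fourier_coeff (\<theta> t) k"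
    "\<And>t. 0 \<le> t \<Longrightarrow> continuous_on UNIV (\<theta> t)"
    "\<And>t k. 0 \<le> t \<Longrightarrow> fourier_coeff (\<theta> t) (- k) = cnj (fourier_coeff (\<theta> t) k)"
    "\<And>t p. 0 \<le> t \<Longrightarrow> transport_symbol T p p * fourier_coeff (\<theta> t) p = 0"
    "\<And>t. 0 \<le> t \<Longrightarrow> fourier_coeff (\<theta> t) 0 = 0"
proof -
  let ?g = "\<lambda>(t, x). \<theta> t x"
  have sm: "smooth_on half_space ?g" and per: "\<And>t. 0 \<le> t \<Longrightarrow> periodic (\<theta> t)"
    and mean: "\<And>t. 0 \<le> t \<Longrightarrow> torus_integral (\<theta> t) = 0"
    and pde: "\<And>t x. 0 < t \<Longrightarrow> deriv (\<lambda>\<tau>. \<theta> \<tau> x) t + velocity T (\<theta> t) x \<bullet> grad (\<theta> t) x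
                 + lam * D_op (\<theta> t) x + \<kappa> * Lam_pow \<gamma> (\<theta> t) x = S x"
    using sol unfolding smooth_solution_def by blast+
  obtain g' where g': "\<And>z. z \<in> half_space \<Longrightarrow> (?g has_derivative g' z) (at z within half_space)"
    "\<And>v. smooth_on half_space (\<lambda>z. g' z v)"
    using smooth_on_derivative[OF sm] by metis
  have cg': "continuous_on UNIV (\<lambda>x. g' (t, x) v)" if "0 \<le> t" for t v
    by (rule continuous_on_slice[OF smooth_on_continuous[OF g'(2)] that])
  have c: "continuous_on UNIV (\<theta> t)" if "0 \<le> t" for t
    using continuous_on_slice[OF smooth_on_continuous[OF sm] that] by simp
  have r: "rapid_on {0..\<tau>} (\<lambda>t. fourier_coeff (\<theta> t))" for \<tau>
    using rapid_on_fourier_coeff[OF sm] per by simp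
  have rt: "rapid (fourier_coeff (\<theta> t))" if "0 \<le> t" for t
    using rapid_onD[OF r[of t], of t] that by simp
  have smt: "smooth_torus (\<theta> t)" if "0 \<le> t" for t
    using sm per[OF that] Ck_on_slice[of _ ?g t] that by (simp add: smooth_torus_def smooth_on_def)
  have Dx: "((\<lambda>h. \<theta> t (x + axis i h)) has_real_derivative g' (t, x) (0, axis i 1)) (at 0)" if "0 \<le> t" for t x i
    using space_derivative[OF g'(1) that] by simp
  show thesis
  proof (rule that[of "\<lambda>t. fourier_coeff (\<lambda>x. g' (t, x) (1, 0))"])
    show "rapid_on {0..\<tau>} (\<lambda>t. fourier_coeff (\<lambda>x. g' (t, x) (1, 0)))" for \<tau>
    proof (rule rapid_on_fourier_coeff[OF g'(2)])
      have pg: "periodic (\<lambda>x. ?g (s, x))" if "0 \<le> s" for s using per[OF that] by simp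
      show "periodic (\<lambda>x. g' (s, x) (1, 0))" if "0 \<le> s" for s
        by (rule derivative_periodic[OF g'(1) pg that])
    qed
    show "((\<lambda>t. fourier_coeff (\<theta> t) k) has_vector_derivative fourier_coeff (\<lambda>x. g' (t, x) (1, 0)) k) (at t within {0..})"
      if "0 \<le> t" for t k
      using fourier_coeff_time_derivative[OF g'(1) smooth_on_continuous[OF g'(2)] that] by simp
    show "fourier_coeff (\<lambda>x. g' (t, x) (1, 0)) k = fourier_coeff S k
      - conv (transport_symbol T) (fourier_coeff (\<theta> t)) (fourier_coeff (\<theta> t)) k
      - of_real (lam * (1 + wt k)) * fourier_coeff (\<theta> t) k
      - of_real (\<kappa> * lam_symbol \<gamma> k) * fourier_coeff (\<theta> t) k" if t: "0 < t" for t k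
    proof -
      have t0: "0 \<le> t" using t by simp
      have deriv: "deriv (\<lambda>\<tau>. \<theta> \<tau> x) t = g' (t, x) (1, 0)" for x
      proof -
        have "((\<lambda>\<tau>. \<theta> \<tau> x) has_real_derivative g' (t, x) (1, 0)) (at t within {0..})"
          using time_derivative[OF g'(1) t0, of x] by simp
        \<comment> \<open>For t > 0 the derivative within the half-line is a full one, because the
          open half-line is a neighbourhood of t; this matches the \<open>deriv\<close> of the
          equation.\<close>
        then have "((\<lambda>\<tau>. \<theta> \<tau> x) has_real_derivative g' (t, x) (1, 0)) (at t within {0<..})"
          by (rule DERIV_subset) auto
        moreover have "at t within {0<..} = at t" by (rule at_within_open) (use t in auto)
        ultimately show ?thesis by (simp only:) (rule DERIV_imp_deriv)
      qed
      have "(\<lambda>x. g' (t, x) (1, 0)) = (\<lambda>x. S x - velocity T (\<theta> t) x \<bullet> grad (\<theta> t) x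
          - lam * (Lam_pow 1 (\<theta> t) x + \<theta> t x) - \<kappa> * Lam_pow \<gamma> (\<theta> t) x)"
      proof
        fix x
        show "g' (t, x) (1, 0) = S x - velocity T (\<theta> t) x \<bullet> grad (\<theta> t) x
          - lam * (Lam_pow 1 (\<theta> t) x + \<theta> t x) - \<kappa> * Lam_pow \<gamma> (\<theta> t) x"
          using pde[OF t, of x] unfolding deriv D_op_def by linarith
      qed
      then have eq: "fourier_coeff (\<lambda>x. g' (t, x) (1, 0)) k = fourier_coeff (\<lambda>x. S x - velocity T (\<theta> t) x \<bullet> grad (\<theta> t) x
          - lam * (Lam_pow 1 (\<theta> t) x + \<theta> t x) - \<kappa> * Lam_pow \<gamma> (\<theta> t) x) k" by (rule arg_cong)
      note L = continuous_on_Lam_pow[OF c[OF t0] rt[OF t0]] fourier_coeff_Lam_pow[OF c[OF t0] rt[OF t0]]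
      have V: "continuous_on UNIV (\<lambda>x. velocity T (\<theta> t) x \<bullet> grad (\<theta> t) x)"
        by (rule continuous_on_transport[OF herm A3 A4 c[OF t0] rt[OF t0], where f' = "\<lambda>j x. g' (t, x) (0, axis j 1)"])
          (rule Dx[OF t0] cg'[OF t0] per[OF t0])+
      have 1: "continuous_on UNIV (\<lambda>x. lam * (Lam_pow 1 (\<theta> t) x + \<theta> t x))"
        by (intro continuous_intros L c[OF t0]) simp
      have 2: "continuous_on UNIV (\<lambda>x. \<kappa> * Lam_pow \<gamma> (\<theta> t) x)"
        by (intro continuous_intros L) (use \<gamma> in simp)
      have 3: "continuous_on UNIV (\<lambda>x. Lam_pow 1 (\<theta> t) x + \<theta> t x)"
        by (intro continuous_intros L c[OF t0]) simp
      have F: "fourier_coeff (\<lambda>x. velocity T (\<theta> t) x \<bullet> grad (\<theta> t) x) k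
          = conv (transport_symbol T) (fourier_coeff (\<theta> t)) (fourier_coeff (\<theta> t)) k"
        by (rule fourier_coeff_transport[OF herm A3 A4 c[OF t0] rt[OF t0], where f' = "\<lambda>j x. g' (t, x) (0, axis j 1)"])
          (rule Dx[OF t0] cg'[OF t0] per[OF t0])+
      show ?thesis
        unfolding eq fourier_coeff_diff[OF continuous_on_diff[OF continuous_on_diff[OF S V] 1] 2]
          fourier_coeff_diff[OF continuous_on_diff[OF S V] 1] fourier_coeff_diff[OF S V] F
          fourier_coeff_cmult[OF 3] fourier_coeff_cmult[OF L(1)[OF less_imp_le[OF \<gamma>]]]
          fourier_coeff_add[OF L(1)[OF zero_le_one] c[OF t0]]
          L(2)[OF zero_le_one] L(2)[OF less_imp_le[OF \<gamma>]] lam_symbol_1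
        by (simp add: algebra_simps)
    qed
    show "transport_symbol T p p * fourier_coeff (\<theta> t) p = 0" if "0 \<le> t" for t p
      by (rule transport_divergence_free[OF herm A3 A4 c[OF that] rt[OF that] A1 smt[OF that]])
    show "rapid_on {0..\<tau>} (\<lambda>t. fourier_coeff (\<theta> t))" for \<tau> by (rule r)
    show "continuous_on UNIV (\<theta> t)" if "0 \<le> t" for t by (rule c[OF that])
    show "fourier_coeff (\<theta> t) (- k) = cnj (fourier_coeff (\<theta> t) k)" if "0 \<le> t" for t k
      by (rule fourier_coeff_minus[OF c[OF that]])
    show "fourier_coeff (\<theta> t) 0 = 0" if "0 \<le> t" for t by (rule fourier_coeff_0[OF mean[OF that]])
  qed
qed

text \<open>\<open>M\<close> and \<delta> are fixed before \<lambda>: they are built from the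
  solution for \<lambda> = 0, the symbol bound, m and \<tau> alone.\<close>

lemma difference_energy_bound:
  assumes sol: "\<And>lam. 0 \<le> lam \<Longrightarrow> smooth_solution T \<kappa> \<gamma> S \<theta>\<^sub>0 lam (\<theta> lam)"
    and m: "1 + CARD('n) \<le> m" and \<tau>: "0 < \<tau>"
  obtains M \<delta> where "0 \<le> M" "0 < \<delta>"
    "\<And>lam t. 0 < lam \<Longrightarrow> lam < \<delta> \<Longrightarrow> 0 \<le> t \<Longrightarrow> t \<le> \<tau> \<Longrightarrow>
      (\<Sum>\<^sub>\<infinity>k. (wt k ^ m * cmod (fourier_coeff (\<theta> lam t) k - fourier_coeff (\<theta> 0 t) k))\<^sup>2) \<le> M * lam"
proof -
  let ?q = "transport_symbol T"
  let ?b = "\<lambda>t. fourier_coeff (\<theta> 0 t)"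
  obtain Q where Q: "0 < Q" "\<And>p l. cmod (?q p l) \<le> Q * wt l"
    using symbol_bounds[OF A3 A4] by metis
  obtain b' where b: "\<And>\<tau>. rapid_on {0..\<tau>} ?b" "\<And>\<tau>. rapid_on {0..\<tau>} b'"
    "\<And>t k. 0 \<le> t \<Longrightarrow> ((\<lambda>t. ?b t k) has_vector_derivative b' t k) (at t within {0..})"
    "\<And>t k. 0 < t \<Longrightarrow> b' t k = fourier_coeff S k - conv ?q (?b t) (?b t) k
      - of_real (0 * (1 + wt k)) * ?b t k - of_real (\<kappa> * lam_symbol \<gamma> k) * ?b t k"
    "\<And>t k. 0 \<le> t \<Longrightarrow> ?b t (- k) = cnj (?b t k)"
    "\<And>t p. 0 \<le> t \<Longrightarrow> ?q p p * ?b t p = 0" "\<And>t. 0 \<le> t \<Longrightarrow> ?b t 0 = 0"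
    by (rule solution_fourier[OF sol[OF order_refl]]) (rule that)
  obtain g :: "int ^ 'n \<Rightarrow> real" where g: "g summable_on UNIV" "\<And>k. 0 \<le> g k"
    "\<And>t k. t \<in> {0..\<tau>} \<Longrightarrow> (1 + wt k) ^ Suc m * cmod (?b t k) \<le> g k"
    by (rule rapid_majorant[OF b(1), of \<tau> "Suc m"]) (rule that)
  \<comment> \<open>One majorant serves twice: its sum \<open>B\<close> bounds the weighted l1 norm
    of the coefficients, and, as each \<open>g k\<close> is at most \<open>B\<close>, the weighted
    sum of squares is at most B^2.\<close>
  define B where "B = infsum g UNIV"
  define K where "K = 4 ^ CARD('n) * (\<Sum>\<^sub>\<infinity>k::int ^ 'n. inverse ((1 + wt k) ^ (2 * CARD('n))))"
  define P where "P = Q * real m * 2 ^ m"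
  \<comment> \<open>The 2 comes from differentiating squares; 3 P B from the terms linear in
    \<open>c\<close>, P (K + 1) from the self-interaction while E <= 1, and 1/2 from the damping
    with \<open>lam\<close> at most 1. \<open>M\<close> is then the Gronwall factor for the forcing
    \<open>lam\<close> B^2.\<close>
  define C where "C = 2 * (3 * P * B + P * (K + 1) + 1 / 2)"
  define M where "M = B\<^sup>2 * \<tau> * exp (C * \<tau>)"
  have B0: "0 \<le> B" unfolding B_def by (rule infsum_nonneg) (rule g(2))
  have K0: "0 \<le> K" unfolding K_def by (intro mult_nonneg_nonneg infsum_nonneg) auto
  have P0: "0 \<le> P" unfolding P_def using Q(1) by simp
  have C0: "0 \<le> C" unfolding C_def using B0 K0 P0 by simp
  have M0: "0 \<le> M" unfolding M_def using \<tau> by simp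
  have B1: "(\<Sum>\<^sub>\<infinity>k. wt k ^ Suc m * cmod (?b t k)) \<le> B" if t: "t \<in> {0..\<tau>}" for t
    unfolding B_def
  proof (rule infsum_mono[OF rapid_wt_summable[OF rapid_onD[OF b(1) t]] g(1)])
    fix k
    have "wt k ^ Suc m * cmod (?b t k) \<le> (1 + wt k) ^ Suc m * cmod (?b t k)"
      by (intro mult_right_mono power_mono) auto
    with g(3)[OF t, of k] show "wt k ^ Suc m * cmod (?b t k) \<le> g k" by linarith
  qed
  have B2: "(\<Sum>\<^sub>\<infinity>k. ((1 + wt k) ^ Suc m * cmod (?b t k))\<^sup>2) \<le> B\<^sup>2" if t: "t \<in> {0..\<tau>}" for t
  proof -
    have le: "((1 + wt k) ^ Suc m * cmod (?b t k))\<^sup>2 \<le> B * g k" for k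
    proof -
      have "g k \<le> B" unfolding B_def using finite_sum_le_infsum[OF g(1), of "{k}"] g(2) by simp
      then have "((1 + wt k) ^ Suc m * cmod (?b t k)) * ((1 + wt k) ^ Suc m * cmod (?b t k)) \<le> B * g k"
        using g(3)[OF t, of k] B0 by (intro mult_mono order_trans[OF g(3)[OF t]]) auto
      then show ?thesis by (simp only: power2_eq_square)
    qed
    have Bg: "(\<lambda>k. B * g k) summable_on UNIV" by (intro summable_on_cmult_right g(1))
    have "(\<Sum>\<^sub>\<infinity>k. ((1 + wt k) ^ Suc m * cmod (?b t k))\<^sup>2) \<le> (\<Sum>\<^sub>\<infinity>k. B * g k)"
      by (rule infsum_mono[OF summable_on_comparison_test[OF Bg] Bg]) (use le in auto)
    also have "\<dots> = B\<^sup>2" unfolding infsum_cmult_right' B_def by (simp only: power2_eq_square)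
    finally show ?thesis .
  qed
  show thesis
  \<comment> \<open>From \<open>lam\<close> (M + 1) < 1 follow both M \<open>lam\<close> < 1, the
    smallness for the bootstrap, and \<open>lam\<close> <= 1.\<close>
  proof (rule that[OF M0, of "1 / (M + 1)"])
    fix lam t :: real assume lam: "0 < lam" "lam < 1 / (M + 1)" and t: "0 \<le> t" "t \<le> \<tau>"
    have small: "M * lam < 1" and lam1: "lam \<le> 1"
      proof -
      have "lam * (M + 1) < 1" using lam M0 by (simp add: pos_less_divide_eq)
      then have "M * lam + lam < 1" by (simp add: algebra_simps)
      moreover have "0 \<le> M * lam" using M0 lam by simp
      ultimately show "M * lam < 1" "lam \<le> 1" using lam by linarith+
    qed
    let ?a = "\<lambda>t. fourier_coeff (\<theta> lam t)"
    obtain a' where a: "\<And>\<tau>. rapid_on {0..\<tau>} ?a" "\<And>\<tau>. rapid_on {0..\<tau>} a'"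
      "\<And>t k. 0 \<le> t \<Longrightarrow> ((\<lambda>t. ?a t k) has_vector_derivative a' t k) (at t within {0..})"
      "\<And>t k. 0 < t \<Longrightarrow> a' t k = fourier_coeff S k - conv ?q (?a t) (?a t) k
        - of_real (lam * (1 + wt k)) * ?a t k - of_real (\<kappa> * lam_symbol \<gamma> k) * ?a t k"
      "\<And>t k. 0 \<le> t \<Longrightarrow> ?a t (- k) = cnj (?a t k)"
      "\<And>t p. 0 \<le> t \<Longrightarrow> ?q p p * ?a t p = 0" "\<And>t. 0 \<le> t \<Longrightarrow> ?a t 0 = 0"
      by (rule solution_fourier[OF sol[OF less_imp_le[OF lam(1)]]]) (rule that)
    define c where "c = (\<lambda>t k. ?a t k - ?b t k)"
    define c' where "c' = (\<lambda>t k. a' t k - b' t k)"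
    have c: "rapid_on {0..\<tau>} c" "rapid_on {0..\<tau>} c'"
      unfolding c_def c'_def by (intro rapid_on_diff a b)+
    define E where "E = (\<lambda>t. \<Sum>\<^sub>\<infinity>k. (wt k ^ m * cmod (c t k))\<^sup>2)"
    define E' where "E' = (\<lambda>t. 2 * (\<Sum>\<^sub>\<infinity>k. wt k ^ (2 * m) * Re (cnj (c t k) * c' t k)))"
    have E: "(E has_vector_derivative E' t) (at t within {0..\<tau>})" if "t \<in> {0..\<tau>}" for t
      unfolding E_def E'_def
    proof (rule energy_has_derivative[OF c _ that])
      show "((\<lambda>t. c t k) has_vector_derivative c' t k) (at t within {0..\<tau>})" if "t \<in> {0..\<tau>}" for t k
        unfolding c_def c'_def using that
        by (intro has_vector_derivative_diff has_vector_derivative_within_subset[OF a(3)]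
          has_vector_derivative_within_subset[OF b(3)]) auto
    qed
    have le: "E' t \<le> C * E t + lam * B\<^sup>2" if t: "0 < t" "t < \<tau>" and E1: "E t \<le> 1" for t
    proof -
      have t0: "0 \<le> t" and tt: "t \<in> {0..\<tau>}" using t by auto
      have rb: "rapid (?b t)" and rc: "rapid (c t)" and rc': "rapid (c' t)"
        by (rule rapid_onD[OF b(1) tt] rapid_onD[OF c(1) tt] rapid_onD[OF c(2) tt])+
      have E0: "0 \<le> E t" unfolding E_def by (rule infsum_nonneg) simp
      \<comment> \<open>Subtracting the equations removes the forcing and the part quadratic in
        \<open>b\<close>. The equation for \<open>b\<close> has no damping, so the damping acts on b
        + c rather than on \<open>c\<close>.\<close>
      have c'_eq: "c' t k = - (conv ?q (?b t) (c t) k + conv ?q (c t) (?b t) k + conv ?q (c t) (c t) k)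
          - of_real (lam * (1 + wt k)) * (?b t k + c t k) - of_real (\<kappa> * lam_symbol \<gamma> k) * c t k" for k
      proof -
        have "?a t = (\<lambda>k. ?b t k + c t k)" by (simp add: c_def)
        then have "conv ?q (?a t) (?a t) k = conv ?q (?b t) (?b t) k
            + (conv ?q (?b t) (c t) k + conv ?q (c t) (?b t) k + conv ?q (c t) (c t) k)"
          by (simp only: conv_add_add[OF Q(2) rb rc])
        then show ?thesis
          unfolding c'_def by (simp add: a(4)[OF t(1)] b(4)[OF t(1)]) (simp add: c_def algebra_simps)
      qed
      have "(\<Sum>\<^sub>\<infinity>k. wt k ^ (2 * m) * Re (cnj (c t k) * c' t k))
        \<le> Q * (3 * real m * 2 ^ m) * (\<Sum>\<^sub>\<infinity>k. wt k ^ Suc m * cmod (?b t k)) * E t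
          + 2 * Q * real m * 2 ^ m * (\<Sum>\<^sub>\<infinity>k. wt k * cmod (c t k)) * E t
          + lam * (E t + (\<Sum>\<^sub>\<infinity>k. ((1 + wt k) ^ Suc m * cmod (?b t k))\<^sup>2)) / 2"
        unfolding E_def
      proof (rule energy_inequality[where q = ?q and b = "?b t" and c = "c t" and c' = "c' t"
            and g = "\<lambda>k. \<kappa> * lam_symbol \<gamma> k" and lam = lam])
        show "c t (- k) = cnj (c t k)" for k by (simp add: c_def a(5)[OF t0] b(5)[OF t0])
        show "?q p p * c t p = 0" for p by (simp only: c_def right_diff_distrib a(6)[OF t0] b(6)[OF t0] diff_self)
        show "c t 0 = 0" by (simp only: c_def a(7)[OF t0] b(7)[OF t0] diff_self)
        show "0 \<le> \<kappa> * lam_symbol \<gamma> k" for k using \<kappa> lam_symbol_nonneg[of \<gamma> k] by simp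
        show "cnj (?q p l) = ?q (- p) (- l)" for p l by (rule transport_symbol_cnj[of T, OF herm])
        show "1 \<le> m" using m by simp
      qed (rule Q(2) transport_symbol_add rb rc rc' b(5-7)[OF t0] c'_eq less_imp_le[OF lam(1)])+
      also have "\<dots> \<le> 3 * P * B * E t + P * (K + 1) * E t + lam * (E t + B\<^sup>2) / 2"
        proof -
        \<comment> \<open>Here 1 + d <= m enters. Together with E <= 1 the l1 factor is at most (K +
          1) / 2, and the cubic term becomes linear in \<open>E\<close>.\<close>
        have "(\<Sum>\<^sub>\<infinity>k. wt k ^ 1 * cmod (c t k)) \<le> (1 * K + E t / 1) / 2"
          unfolding K_def E_def
          by (rule weighted_l1_bound[OF rc _ m]) (simp_all add: c_def a(7)[OF t0] b(7)[OF t0])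
        then have "2 * P * (\<Sum>\<^sub>\<infinity>k. wt k * cmod (c t k)) * E t \<le> 2 * P * ((K + 1) / 2) * E t"
          using E1 E0 P0 by (intro mult_right_mono mult_left_mono) auto
        moreover have "3 * P * (\<Sum>\<^sub>\<infinity>k. wt k ^ Suc m * cmod (?b t k)) * E t \<le> 3 * P * B * E t"
          using B1[OF tt] E0 P0 by (intro mult_right_mono mult_left_mono) auto
        moreover have "lam * (E t + (\<Sum>\<^sub>\<infinity>k. ((1 + wt k) ^ Suc m * cmod (?b t k))\<^sup>2)) / 2 \<le> lam * (E t + B\<^sup>2) / 2"
          using B2[OF tt] lam by (intro divide_right_mono mult_left_mono add_left_mono) auto
        moreover have "2 * P * x = 2 * Q * real m * 2 ^ m * x" "3 * P * x = Q * (3 * real m * 2 ^ m) * x"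
          "2 * P * ((K + 1) / 2) = P * (K + 1)" for x
          by (simp_all add: P_def)
        ultimately show ?thesis by (simp only:)
      qed
      \<comment> \<open>\<open>lam\<close> is kept only in front of B^2, so that the Gronwall rate
        \<open>C\<close> does not depend on it.\<close>
      also have "lam * (E t + B\<^sup>2) / 2 \<le> (E t + lam * B\<^sup>2) / 2"
        using lam1 E0 mult_right_mono[of lam 1 "E t"] by (simp add: algebra_simps)
      finally have "E' t \<le> 2 * (3 * P * B * E t + P * (K + 1) * E t + (E t + lam * B\<^sup>2) / 2)"
        unfolding E'_def by (intro mult_left_mono) auto
      also have "\<dots> = C * E t + lam * B\<^sup>2"
        unfolding C_def by (simp add: field_simps)
      finally show ?thesis .
    qed
    have "E t \<le> (lam * B\<^sup>2) * \<tau> * exp (C * \<tau>)"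
    proof (rule gronwall_bootstrap[where E' = E', OF _ _ _ le C0 _ _ t])
      show "E 0 = 0"
        proof -
        have "\<theta> lam 0 = \<theta> 0 0"
          using sol[OF less_imp_le[OF lam(1)]] sol[OF order_refl] by (simp add: smooth_solution_def fun_eq_iff)
        then show ?thesis by (simp add: E_def c_def)
      qed
      show "continuous_on {0..\<tau>} E"
        unfolding continuous_on_eq_continuous_within by (intro ballI has_vector_derivative_continuous[OF E])
      show "(E has_real_derivative E' t) (at t)" if "0 < t" "t < \<tau>" for t
        using E[of t] that by (simp add: has_real_derivative_iff_has_vector_derivative at_within_Icc_at)
      show "(lam * B\<^sup>2) * \<tau> * exp (C * \<tau>) < 1"
        using small by (simp add: M_def mult_ac)
    qed (use lam in auto)
    then show "(\<Sum>\<^sub>\<infinity>k. (wt k ^ m * cmod (?a t k - ?b t k))\<^sup>2) \<le> M * lam"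
      by (simp add: E_def c_def M_def mult_ac)
  qed (use M0 in auto)
qed

lemma difference_Hs_tendsto:
  assumes sol: "\<And>lam. 0 \<le> lam \<Longrightarrow> smooth_solution T \<kappa> \<gamma> S \<theta>\<^sub>0 lam (\<theta> lam)"
    and s: "0 \<le> s" and t: "0 \<le> t"
  shows "((\<lambda>lam. Hs_norm s (\<lambda>x. \<theta> lam t x - \<theta> 0 t x)) \<longlongrightarrow> 0) (at_right 0)"
proof -
  let ?p = "nat \<lceil>s\<rceil>"
  \<comment> \<open>Large enough both for the energy bound (1 + d) and for the weighted l1 bound
    with p weights (p + d).\<close>
  define m where "m = 1 + ?p + CARD('n)"
  define K where "K = 4 ^ CARD('n) * (\<Sum>\<^sub>\<infinity>k::int ^ 'n. inverse ((1 + wt k) ^ (2 * CARD('n))))"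
  obtain M \<delta> where M: "0 \<le> M" "0 < \<delta>"
    "\<And>lam t'. 0 < lam \<Longrightarrow> lam < \<delta> \<Longrightarrow> 0 \<le> t' \<Longrightarrow> t' \<le> t + 1 \<Longrightarrow>
      (\<Sum>\<^sub>\<infinity>k. (wt k ^ m * cmod (fourier_coeff (\<theta> lam t') k - fourier_coeff (\<theta> 0 t') k))\<^sup>2) \<le> M * lam"
  \<comment> \<open>The interval must have positive length even when t = 0.\<close>
  proof (rule difference_energy_bound[OF sol, of m "t + 1"])
    show "1 + CARD('n) \<le> m" by (simp add: m_def)
    show "0 < t + 1" using t by simp
  qed (assumption, rule that)
  have "continuous_on UNIV (\<theta> lam t) \<and> rapid (fourier_coeff (\<theta> lam t)) \<and> fourier_coeff (\<theta> lam t) 0 = 0"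
    if "0 \<le> lam" for lam
  proof (rule solution_fourier[OF sol[OF that]])
    assume c: "\<And>t. 0 \<le> t \<Longrightarrow> continuous_on UNIV (\<theta> lam t)"
      and r: "\<And>\<tau>. rapid_on {0..\<tau>} (\<lambda>t. fourier_coeff (\<theta> lam t))"
      and z: "\<And>t. 0 \<le> t \<Longrightarrow> fourier_coeff (\<theta> lam t) 0 = 0"
    show ?thesis using c[OF t] z[OF t] rapid_onD[OF r[of t], of t] t by simp
  qed
  then have reg: "continuous_on UNIV (\<theta> lam t)" "rapid (fourier_coeff (\<theta> lam t))" "fourier_coeff (\<theta> lam t) 0 = 0"
    if "0 \<le> lam" for lam using that by blast+
  let ?V = "sqrt ((2 * pi) ^ CARD('n))"
  have bound: "Hs_norm s (\<lambda>x. \<theta> lam t x - \<theta> 0 t x) \<le> ?V * (sqrt lam * ((K + M) / 2))"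
    if lam: "0 < lam" "lam < \<delta>" for lam
  proof -
    let ?f = "\<lambda>x. \<theta> lam t x - \<theta> 0 t x"
    let ?c = "\<lambda>k. fourier_coeff (\<theta> lam t) k - fourier_coeff (\<theta> 0 t) k"
    have l0: "0 \<le> lam" using lam by simp
    have fc: "fourier_coeff ?f = ?c"
      by (rule ext) (rule fourier_coeff_diff[OF reg(1)[OF l0] reg(1)[OF order_refl]])
    have rc: "rapid ?c"
      using rapid_on_diff[of UNIV "\<lambda>_::unit. fourier_coeff (\<theta> lam t)" "\<lambda>_. fourier_coeff (\<theta> 0 t)"]
        reg(2)[OF l0] reg(2)[OF order_refl] by (simp add: rapid_def)
    have c0: "?c 0 = 0" by (simp only: reg(3)[OF l0] reg(3)[OF order_refl] diff_self)
    have "Hs_norm s ?f \<le> ?V * (\<Sum>\<^sub>\<infinity>k. wt k ^ ?p * cmod (?c k))"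
      using Hs_norm_le[of ?f s] continuous_on_diff[OF reg(1)[OF l0] reg(1)[OF order_refl]] rc c0 s
      unfolding fc by blast
    \<comment> \<open>The parameter sqrt \<open>lam\<close> balances both terms: K sqrt
      \<open>lam\<close> against M \<open>lam\<close> / sqrt \<open>lam\<close>.\<close>
    also have "(\<Sum>\<^sub>\<infinity>k. wt k ^ ?p * cmod (?c k)) \<le> (sqrt lam * K + (\<Sum>\<^sub>\<infinity>k. (wt k ^ m * cmod (?c k))\<^sup>2) / sqrt lam) / 2"
      unfolding K_def by (rule weighted_l1_bound[OF rc c0]) (use lam in \<open>simp_all add: m_def\<close>)
    also have "\<dots> \<le> (sqrt lam * K + (M * lam) / sqrt lam) / 2"
      using M(3)[OF lam t] lam by (intro divide_right_mono add_left_mono) auto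
    also have "(M * lam) / sqrt lam = M * sqrt lam"
      using lam by (simp add: real_div_sqrt flip: times_divide_eq_right)
    finally show ?thesis
      by (simp add: mult_left_mono algebra_simps)
  qed
  have "((\<lambda>lam. ?V * (sqrt lam * ((K + M) / 2))) \<longlongrightarrow> ?V * (sqrt 0 * ((K + M) / 2))) (at_right 0)"
    by (intro tendsto_intros)
  then have lim: "((\<lambda>lam. ?V * (sqrt lam * ((K + M) / 2))) \<longlongrightarrow> 0) (at_right 0)" by simp
  have "\<forall>\<^sub>F lam in at_right 0. 0 < lam \<and> lam < \<delta>"
    using M(2) by (auto simp: eventually_at_right_field)
  then have "\<forall>\<^sub>F lam in at_right 0. Hs_norm s (\<lambda>x. \<theta> lam t x - \<theta> 0 t x) \<le> ?V * (sqrt lam * ((K + M) / 2))"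
    by eventually_elim (use bound in auto)
  then show ?thesis
    by (rule tendsto_sandwich[OF always_eventually _ tendsto_const lim, rotated]) (simp add: Hs_norm_nonneg)
qed

end

theorem theorem2p2:
  fixes T :: "'n::finite \<Rightarrow> 'n \<Rightarrow> int ^ 'n \<Rightarrow> complex"
    and \<theta>\<^sub>0 S :: "real ^ 'n \<Rightarrow> real"
    and \<theta> :: "real \<Rightarrow> real \<Rightarrow> real ^ 'n \<Rightarrow> real"
    and \<kappa> \<gamma> :: real
  assumes "CARD('n) \<in> {2, 3}"
    and "\<kappa> > 0" and "0 < \<gamma>" and "\<gamma> \<le> 2"
    and "smooth_torus \<theta>\<^sub>0" and "torus_integral \<theta>\<^sub>0 = 0"
    and "smooth_torus S" and "torus_integral S = 0"
    and "\<And>i j. hermitian_symbol (T i j)"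
    and "condA1 T" and "condA2 T" and "condA3' T" and "condA4 T"
    and "\<And>lam. lam > 0 \<Longrightarrow> smooth_solution T \<kappa> \<gamma> S \<theta>\<^sub>0 lam (\<theta> lam)"
    and "smooth_solution T \<kappa> \<gamma> S \<theta>\<^sub>0 0 (\<theta> 0)"
  shows "\<forall>s\<ge>0. \<forall>t\<ge>0.
    ((\<lambda>lam. Hs_norm s (\<lambda>x. \<theta> lam t x - \<theta> 0 t x)) \<longlongrightarrow> 0) (at_right 0)"
proof -
  interpret multiplier_velocity T S \<theta>\<^sub>0 \<kappa> \<gamma>
    by unfold_locales (use assms smooth_on_continuous in \<open>auto simp: smooth_torus_def\<close>)
  have "smooth_solution T \<kappa> \<gamma> S \<theta>\<^sub>0 lam (\<theta> lam)" if "0 \<le> lam" for lam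
    using assms(14)[of lam] assms(15) that by (cases "lam = 0") auto
  then show ?thesis using difference_Hs_tendsto by blast
qed

end
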